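(* Let $d\ge2$ and let $\Theta_1\subset\mathbb R^d$ be a bounded strictly convex set with $0\in\Theta_1$. Let $\Omega_1=\mathbb R^d\setminus\overline{\Theta_1}$, let $m_1,m_2>0$ be masses and $q_1,q_2,q^{\rm ncl}\in\mathbb R$ charges. Let $$H=\sum_{j=1}^2\Big(-\frac1{2m_j}\Delta_{x_j}+\frac{q_jq^{\rm ncl}}{|x_j|}\Big)+\frac{q_1q_2}{|x_1-x_2|}$$ on $L^2(\Omega_1\times\Omega_1)$ with Dirichlet boundary condition (i.e. $H$ is the self-adjoint operator associated with the corresponding quadratic form with form domain $H^1_0(\Omega_1\times\Omega_1)$). Then $H$ does not have positive eigenvalues.
   Context: A bounded open set $\Theta\subset\mathbb R^d$, $d\geq 2$, is called strictly convex if it is connected, has smooth boundary $S$, and there is $\kappa>0$ such that $(\nabla\nu)_{|S}\ge\kappa\,g_{|S}$, where $\nu$ is the outward unit normal field on $S$ and $g$ the Euclidean metric (i.e. $\langle D_v\nu,v\rangle\ge\kappa|v|^2$ for all $v$ tangent to $S$; all principal curvatures are at least $\kappa$). *)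

theory Defs
  imports "HOL-Analysis.Analysis"
begin

section \<open>Smooth functions\<close>

text \<open>Intended for open \<open>S\<close> in a Euclidean space: all directional derivatives of order at most
  \<open>k\<close> exist and are continuous, and \<open>f\<close> is Frechet differentiable at each stage.\<close>

primrec Ck_on :: "nat \<Rightarrow> 'a::euclidean_space set \<Rightarrow> ('a \<Rightarrow> 'b::real_normed_vector) \<Rightarrow> bool" where
  "Ck_on 0 S f \<longleftrightarrow> continuous_on S f"
| "Ck_on (Suc k) S f \<longleftrightarrow>
     (\<forall>x\<in>S. f differentiable (at x)) \<and> (\<forall>v. Ck_on k S (\<lambda>x. frechet_derivative f (at x) v))"

definition smooth_on :: "'a::euclidean_space set \<Rightarrow> ('a \<Rightarrow> 'b::real_normed_vector) \<Rightarrow> bool" where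
  "smooth_on S f \<longleftrightarrow> (\<forall>k. Ck_on k S f)"

section \<open>Strictly convex sets\<close>

text \<open>\<open>\<rho>\<close> is a defining function of \<open>\<Theta>\<close> on the open neighbourhood \<open>U\<close> of the boundary point \<open>p\<close>.
  As \<open>d\<rho>\<close> does not vanish on \<open>U\<close>, the boundary inside \<open>U\<close> is the regular level set \<open>\<rho> = 0\<close>,
  and \<open>\<Theta>\<close> lies on one side of it.\<close>

definition local_defining_function ::
    "'a::euclidean_space set \<Rightarrow> 'a \<Rightarrow> 'a set \<Rightarrow> ('a \<Rightarrow> real) \<Rightarrow> bool" where
  "local_defining_function \<Theta> p U \<rho> \<longleftrightarrow>
     open U \<and> p \<in> U \<and> smooth_on U \<rho> \<and>
     (\<forall>x\<in>U. \<exists>v. frechet_derivative \<rho> (at x) v \<noteq> 0) \<and>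
     \<Theta> \<inter> U = {x \<in> U. \<rho> x < 0}"

definition smooth_boundary :: "'a::euclidean_space set \<Rightarrow> bool" where
  "smooth_boundary \<Theta> \<longleftrightarrow> (\<forall>p\<in>frontier \<Theta>. \<exists>U \<rho>. local_defining_function \<Theta> p U \<rho>)"

text \<open>The outward unit normal at \<open>p\<close> is the normalized gradient of any local defining function;
  gradients at \<open>p\<close> of two defining functions are positive multiples of each other.
  Only the values on the boundary are meaningful.\<close>

definition outward_normal :: "'a::euclidean_space set \<Rightarrow> 'a \<Rightarrow> 'a" where
  "outward_normal \<Theta> p =
     (THE n. norm n = 1 \<and>
        (\<exists>U \<rho> c. local_defining_function \<Theta> p U \<rho> \<and> c > 0 \<and>
            (\<forall>v. frechet_derivative \<rho> (at p) v = c * (n \<bullet> v))))"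

definition boundary_tangent_space :: "'a::euclidean_space set \<Rightarrow> 'a \<Rightarrow> 'a set" where
  "boundary_tangent_space \<Theta> p = {v. outward_normal \<Theta> p \<bullet> v = 0}"

text \<open>The normal field is differentiated along the boundary only (\<open>at p within frontier \<Theta>\<close>).
  Such a derivative \<open>D\<close> is determined exactly on tangent vectors, which is where it is used.\<close>

definition strictly_convex :: "'a::euclidean_space set \<Rightarrow> bool" where
  "strictly_convex \<Theta> \<longleftrightarrow>
     open \<Theta> \<and> bounded \<Theta> \<and> connected \<Theta> \<and> smooth_boundary \<Theta> \<and>
     (\<exists>\<kappa>>0. \<forall>p\<in>frontier \<Theta>. \<exists>D.
        (outward_normal \<Theta> has_derivative D) (at p within frontier \<Theta>) \<and>
        (\<forall>v\<in>boundary_tangent_space \<Theta> p. D v \<bullet> v \<ge> \<kappa> * (norm v)\<^sup>2))"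

section \<open>Complex Lebesgue and Sobolev spaces on an open set\<close>

text \<open>Elements are represented by functions on the whole space of which only the values on
  \<open>\<Omega>\<close> matter, and which are identified when they agree almost everywhere on \<open>\<Omega>\<close>.\<close>

definition L2 :: "'a::euclidean_space set \<Rightarrow> ('a \<Rightarrow> complex) set" where
  "L2 \<Omega> = {u. set_borel_measurable lebesgue \<Omega> u \<and>
              set_integrable lebesgue \<Omega> (\<lambda>x. (cmod (u x))\<^sup>2)}"

definition L2_inner ::
    "'a::euclidean_space set \<Rightarrow> ('a \<Rightarrow> complex) \<Rightarrow> ('a \<Rightarrow> complex) \<Rightarrow> complex" where
  "L2_inner \<Omega> u v = (LINT x:\<Omega>|lebesgue. u x * cnj (v x))"

definition L2_norm :: "'a::euclidean_space set \<Rightarrow> ('a \<Rightarrow> complex) \<Rightarrow> real" where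
  "L2_norm \<Omega> u = sqrt (LINT x:\<Omega>|lebesgue. (cmod (u x))\<^sup>2)"

definition test_functions :: "'a::euclidean_space set \<Rightarrow> ('a \<Rightarrow> complex) set" where
  "test_functions \<Omega> = {\<phi>. smooth_on UNIV \<phi> \<and> compact (closure {x. \<phi> x \<noteq> 0}) \<and>
                          closure {x. \<phi> x \<noteq> 0} \<subseteq> \<Omega>}"

definition has_weak_partial ::
    "'a::euclidean_space set \<Rightarrow> 'a \<Rightarrow> ('a \<Rightarrow> complex) \<Rightarrow> ('a \<Rightarrow> complex) \<Rightarrow> bool" where
  "has_weak_partial \<Omega> b u g \<longleftrightarrow> g \<in> L2 \<Omega> \<and>
     (\<forall>\<phi>\<in>test_functions \<Omega>.
        (LINT x:\<Omega>|lebesgue. u x * frechet_derivative \<phi> (at x) b) =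
        - (LINT x:\<Omega>|lebesgue. g x * \<phi> x))"

text \<open>Weak derivatives are unique up to null sets, so the choice is immaterial.\<close>

definition weak_partial ::
    "'a::euclidean_space set \<Rightarrow> 'a \<Rightarrow> ('a \<Rightarrow> complex) \<Rightarrow> 'a \<Rightarrow> complex" where
  "weak_partial \<Omega> b u = (SOME g. has_weak_partial \<Omega> b u g)"

definition H1 :: "'a::euclidean_space set \<Rightarrow> ('a \<Rightarrow> complex) set" where
  "H1 \<Omega> = {u \<in> L2 \<Omega>. \<forall>b\<in>Basis. \<exists>g. has_weak_partial \<Omega> b u g}"

definition H1_norm :: "'a::euclidean_space set \<Rightarrow> ('a \<Rightarrow> complex) \<Rightarrow> real" where
  "H1_norm \<Omega> u =
     sqrt ((L2_norm \<Omega> u)\<^sup>2 + (\<Sum>b\<in>Basis. (L2_norm \<Omega> (weak_partial \<Omega> b u))\<^sup>2))"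

definition H10 :: "'a::euclidean_space set \<Rightarrow> ('a \<Rightarrow> complex) set" where
  "H10 \<Omega> = {u \<in> H1 \<Omega>. \<exists>\<phi>. (\<forall>n. \<phi> n \<in> test_functions \<Omega>) \<and>
                          (\<lambda>n. H1_norm \<Omega> (\<lambda>x. u x - \<phi> n x)) \<longlonglongrightarrow> 0}"

section \<open>The operator associated with a quadratic form\<close>

text \<open>The graph of the operator given by the first representation theorem for the (polarized)
  form \<open>h\<close> with form domain \<open>Q\<close>.\<close>

definition form_operator ::
    "'a::euclidean_space set \<Rightarrow> ('a \<Rightarrow> complex) set \<Rightarrow>
     (('a \<Rightarrow> complex) \<Rightarrow> ('a \<Rightarrow> complex) \<Rightarrow> complex) \<Rightarrow>
     (('a \<Rightarrow> complex) \<times> ('a \<Rightarrow> complex)) set" where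
  "form_operator \<Omega> Q h =
     {(u, f). u \<in> Q \<and> f \<in> L2 \<Omega> \<and> (\<forall>v\<in>Q. h u v = L2_inner \<Omega> f v)}"

definition is_eigenvalue ::
    "'a::euclidean_space set \<Rightarrow> (('a \<Rightarrow> complex) \<times> ('a \<Rightarrow> complex)) set \<Rightarrow> complex \<Rightarrow> bool" where
  "is_eigenvalue \<Omega> T z \<longleftrightarrow>
     (\<exists>u. (u, \<lambda>x. z * u x) \<in> T \<and> \<not> (AE x in lebesgue. x \<in> \<Omega> \<longrightarrow> u x = 0))"

section \<open>Two charged particles outside an obstacle containing a fixed charge\<close>

definition coulomb_potential ::
    "real \<Rightarrow> real \<Rightarrow> real \<Rightarrow> 'a::euclidean_space \<times> 'a \<Rightarrow> real" where
  "coulomb_potential q1 q2 qncl x =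
     q1 * qncl / norm (fst x) + q2 * qncl / norm (snd x) + q1 * q2 / norm (fst x - snd x)"

text \<open>The potential term converges absolutely for \<open>u\<close>, \<open>v\<close> in \<open>H10 \<Omega>\<close> when the dimension of
  \<open>'a\<close> is at least 2.\<close>

definition coulomb_form ::
    "real \<Rightarrow> real \<Rightarrow> real \<Rightarrow> real \<Rightarrow> real \<Rightarrow> ('a::euclidean_space \<times> 'a) set \<Rightarrow>
     ('a \<times> 'a \<Rightarrow> complex) \<Rightarrow> ('a \<times> 'a \<Rightarrow> complex) \<Rightarrow> complex" where
  "coulomb_form m1 m2 q1 q2 qncl \<Omega> u v =
     complex_of_real (1 / (2 * m1)) *
       (\<Sum>e\<in>Basis. L2_inner \<Omega> (weak_partial \<Omega> (e, 0) u) (weak_partial \<Omega> (e, 0) v)) +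
     complex_of_real (1 / (2 * m2)) *
       (\<Sum>e\<in>Basis. L2_inner \<Omega> (weak_partial \<Omega> (0, e) u) (weak_partial \<Omega> (0, e) v)) +
     (LINT x:\<Omega>|lebesgue. complex_of_real (coulomb_potential q1 q2 qncl x) * u x * cnj (v x))"

definition dirichlet_hamiltonian ::
    "real \<Rightarrow> real \<Rightarrow> real \<Rightarrow> real \<Rightarrow> real \<Rightarrow> ('a::euclidean_space \<times> 'a) set \<Rightarrow>
     (('a \<times> 'a \<Rightarrow> complex) \<times> ('a \<times> 'a \<Rightarrow> complex)) set" where
  "dirichlet_hamiltonian m1 m2 q1 q2 qncl \<Omega> =
     form_operator \<Omega> (H10 \<Omega>) (coulomb_form m1 m2 q1 q2 qncl \<Omega>)"

end

theory Submission
  imports Defs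
begin

text \<open>
  The proof is a virial argument. Strict convexity makes the closure of \<open>\<Theta>\<^sub>1\<close> convex, hence
  star-shaped about \<open>0\<close>, so the dilations \<open>x \<mapsto> l x\<close> with \<open>l \<ge> 1\<close> map \<open>\<Omega> = \<Omega>\<^sub>1 \<times> \<Omega>\<^sub>1\<close> into
  itself, and the unitary dilation \<open>D\<close> preserves \<open>H10 \<Omega>\<close>. For an eigenfunction \<open>u\<close> with eigenvalue
  \<open>E > 0\<close>, kinetic energy \<open>T\<close> and potential energy \<open>W\<close> the difference \<open>w = D u - u\<close> is admissible and,
  as the Coulomb potential is homogeneous of degree \<open>-1\<close>,
  \<open>(h - E)(w, w) = (1/l\<^sup>2 - 1) T + (1/l - 1) W\<close>. The left-hand side is at least \<open>- C \<parallel>w\<parallel>\<^sup>2\<close>, which is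
  \<open>O((l - 1)\<^sup>2)\<close> if \<open>u\<close> decays; dividing by \<open>l - 1\<close> gives \<open>2 T + W \<le> 0\<close>. Together with
  \<open>T + W = E \<parallel>u\<parallel>\<^sup>2\<close> this forces \<open>T + E \<parallel>u\<parallel>\<^sup>2 \<le> 0\<close>, so \<open>u = 0\<close>. Only forward dilations are
  used, so no boundary regularity of \<open>u\<close> enters. Since no decay of \<open>u\<close> is known, the argument is
  applied to \<open>\<theta> u\<close> with the Gaussian \<open>\<theta> = exp (- s\<^sup>2 |x|\<^sup>2)\<close>: the bound \<open>\<parallel>w\<parallel> \<le> O((l - 1) / s)\<close>
  is compensated by the commutator of \<open>h\<close> with \<open>\<theta>\<close>, which is \<open>o(s)\<close> on \<open>u\<close>.
\<close>

section \<open>Convexity of strictly convex sets\<close>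

text \<open>The formula for (h - E)(w, w) comes from expanding (h - E)(u + w, u + w) with u + w = D
  u: scaling evaluates the left side, and the cross term vanishes because w is itself an admissible
  test function in the eigenvalue equation. The substitute is the identity div (y / |y|) = (d - 1) /
  |y|: integrating it by parts against |u|^2 gives, for every \<eta> > 0, a bound of the integral of
  |u|^2 / |y| by |u|^2 / \<eta> + \<eta> |grad u|^2. The terms with the fixed charge are bounded,
  since 0 is an interior point of the obstacle. The two limits are ordered: l -> 1 at fixed s
  removes the part quadratic in l - 1 whatever its dependence on s; s -> 0 comes afterwards.
  Convexity is a local-to-global statement: curvature forbids a segment inside the closure from
  touching the boundary at an inner point, and connectedness propagates visibility from a point to
  all of \<Theta>.\<close>

lemma sequence_has_derivative:
  fixes f :: "'a::real_normed_vector \<Rightarrow> 'b::real_normed_vector" and t :: "nat \<Rightarrow> real"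
  assumes f: "(f has_derivative D) (at p within S)"
    and q: "\<And>k. q k \<in> S" and t: "\<And>k. t k > 0" "t \<longlonglongrightarrow> 0"
    and v: "(\<lambda>k. (q k - p) /\<^sub>R t k) \<longlonglongrightarrow> v"
  shows "(\<lambda>k. (f (q k) - f p) /\<^sub>R t k) \<longlonglongrightarrow> D v"
proof -
  have D: "bounded_linear D" using f by (rule has_derivative_bounded_linear)
  interpret D: bounded_linear D by fact
  have "(\<lambda>k. t k *\<^sub>R ((q k - p) /\<^sub>R t k)) \<longlonglongrightarrow> 0 *\<^sub>R v"
    by (intro tendsto_intros t v)
  moreover have "t k *\<^sub>R ((q k - p) /\<^sub>R t k) = q k - p" for k
    using t(1)[of k] by simp
  ultimately have qp: "(\<lambda>k. q k - p) \<longlonglongrightarrow> 0" by simp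
  \<comment> \<open>The remainder is o(|q k - p|), and |q k - p| / t k stays bounded because the
    quotients converge. So D v is recovered from points of \<open>S\<close> alone, which is all that
    a field differentiated along the frontier offers.\<close>
  have "(\<lambda>k. (f (q k) - f p - D (q k - p)) /\<^sub>R t k) \<longlonglongrightarrow> 0"
  proof (rule LIMSEQ_I)
    fix r :: real assume r: "0 < r"
    define e where "e = r / (2 * (norm v + 1))"
    have e: "e > 0" using r by (simp add: e_def add_nonneg_pos)
    obtain d where d: "d > 0" "\<And>y. y \<in> S \<Longrightarrow> norm (y - p) < d \<Longrightarrow>
        norm (f y - f p - D (y - p)) \<le> e * norm (y - p)"
      using f e unfolding has_derivative_within_alt by meson
    have 1: "\<forall>\<^sub>F k in sequentially. norm (q k - p) < d"
      using tendstoD[OF qp d(1)] by (simp add: dist_norm)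
    have 2: "\<forall>\<^sub>F k in sequentially. norm ((q k - p) /\<^sub>R t k) < norm v + 1"
      using order_tendstoD(2)[OF tendsto_norm[OF v], of "norm v + 1"] by simp
    have "\<forall>\<^sub>F k in sequentially. norm ((f (q k) - f p - D (q k - p)) /\<^sub>R t k) < r"
      using 1 2
    proof eventually_elim
      case (elim k)
      have "norm ((f (q k) - f p - D (q k - p)) /\<^sub>R t k) \<le> (e * norm (q k - p)) / t k"
        using d(2)[OF q elim(1)] t(1)[of k] by (simp add: divide_simps)
      also have "\<dots> = e * norm ((q k - p) /\<^sub>R t k)"
        using t(1)[of k] by (simp add: divide_simps)
      also have "\<dots> \<le> e * (norm v + 1)" using elim(2) e by (intro mult_left_mono) auto
      also have "\<dots> = r / 2" unfolding e_def
        by (metis add_nonneg_pos divide_divide_eq_left nonzero_eq_divide_eq norm_ge_zero order_less_irrefl times_divide_eq_left zero_less_one mult.commute)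
      also have "\<dots> < r" using r by simp
      finally show ?case .
    qed
    then show "\<exists>no. \<forall>n\<ge>no. norm ((f (q n) - f p - D (q n - p)) /\<^sub>R t n - 0) < r"
      by (simp add: eventually_sequentially)
  qed
  moreover have "(\<lambda>k. D ((q k - p) /\<^sub>R t k)) \<longlonglongrightarrow> D v"
    by (rule D.tendsto[OF v])
  ultimately have "(\<lambda>k. (f (q k) - f p - D (q k - p)) /\<^sub>R t k + D ((q k - p) /\<^sub>R t k)) \<longlonglongrightarrow> 0 + D v"
    by (rule tendsto_add)
  moreover have "(f (q k) - f p - D (q k - p)) /\<^sub>R t k + D ((q k - p) /\<^sub>R t k) = (f (q k) - f p) /\<^sub>R t k" for k
    by (simp only: D.scaleR scaleR_add_right[symmetric] diff_add_cancel)
  ultimately show ?thesis by simp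
qed

lemma has_derivative_along_line:
  fixes f :: "'a::real_normed_vector \<Rightarrow> real"
  assumes "(f has_derivative D) (at (p + s *\<^sub>R v))"
  shows "((\<lambda>t. f (p + t *\<^sub>R v)) has_real_derivative D v) (at s)"
proof -
  have D: "linear D" using assms has_derivative_linear by blast
  have "((\<lambda>t. p + t *\<^sub>R v) has_derivative (\<lambda>t. t *\<^sub>R v)) (at s)"
    by (auto intro!: derivative_eq_intros)
  from has_derivative_compose[OF this assms]
  show ?thesis by (simp add: has_field_derivative_def linear_scale[OF D] mult_commute_abs)
qed

lemma linear_real_inner_representation:
  fixes D :: "'a::euclidean_space \<Rightarrow> real"
  assumes "linear D"
  shows "D v = (\<Sum>b\<in>Basis. D b *\<^sub>R b) \<bullet> v"
proof -
  have "D v = D (\<Sum>b\<in>Basis. (v \<bullet> b) *\<^sub>R b)" by (simp add: euclidean_representation)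
  also have "\<dots> = (\<Sum>b\<in>Basis. (v \<bullet> b) * D b)" by (simp add: linear_sum[OF assms] linear_scale[OF assms])
  also have "\<dots> = (\<Sum>b\<in>Basis. D b *\<^sub>R b) \<bullet> v" by (simp add: inner_sum_right inner_commute[of _ v] mult.commute)
  finally show ?thesis .
qed

section \<open>Local defining functions and the outward unit normal\<close>

context
  fixes \<Theta> :: "'a::euclidean_space set" and p U \<rho>
  assumes op: "open \<Theta>" and ldf: "local_defining_function \<Theta> p U \<rho>"
begin

lemma ldf_open: "open U" and ldf_mem: "p \<in> U" and ldf_iff: "x \<in> U \<Longrightarrow> x \<in> \<Theta> \<longleftrightarrow> \<rho> x < 0"
  using ldf unfolding local_defining_function_def by auto

lemma ldf_at: "x \<in> U \<Longrightarrow> local_defining_function \<Theta> x U \<rho>"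
  using ldf unfolding local_defining_function_def by auto

lemma ldf_derivative:
  assumes "x \<in> U" shows "(\<rho> has_derivative frechet_derivative \<rho> (at x)) (at x)"
proof -
  have "Ck_on (Suc 0) U \<rho>" using ldf unfolding local_defining_function_def smooth_on_def by blast
  then show ?thesis using assms by (auto simp: frechet_derivative_works)
qed

lemma ldf_continuous: "continuous_on U \<rho>"
  by (intro continuous_at_imp_continuous_on ballI has_derivative_continuous[OF ldf_derivative])

lemma ldf_derivative2:
  assumes "x \<in> U"
  shows "((\<lambda>x. frechet_derivative \<rho> (at x) v) has_derivative
    frechet_derivative (\<lambda>x. frechet_derivative \<rho> (at x) v) (at x)) (at x)"
proof -
  have "Ck_on (Suc (Suc 0)) U \<rho>" using ldf unfolding local_defining_function_def smooth_on_def by blast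
  then show ?thesis using assms by (auto simp: frechet_derivative_works)
qed

lemma ldf_closure:
  assumes "x \<in> U" "x \<in> closure \<Theta>" shows "\<rho> x \<le> 0"
proof (rule ccontr)
  assume "\<not> \<rho> x \<le> 0"
  then have "x \<in> U \<inter> \<rho> -` {0<..}" using assms by auto
  moreover have "open (U \<inter> \<rho> -` {0<..})"
    using ldf_continuous ldf_open by (simp add: continuous_open_preimage)
  ultimately have "(U \<inter> \<rho> -` {0<..}) \<inter> \<Theta> \<noteq> {}"
    using assms(2) open_Int_closure_eq_empty by blast
  then show False using ldf_iff by force
qed

lemma ldf_frontier:
  assumes "x \<in> U" "x \<in> frontier \<Theta>" shows "\<rho> x = 0"
proof -
  have "x \<notin> \<Theta>" using assms op by (simp add: frontier_def interior_open)
  then show ?thesis using ldf_closure[of x] assms ldf_iff[of x] by (auto simp: frontier_def)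
qed

lemma ldf_descend:
  assumes x: "x \<in> U" "\<rho> x = 0" and v: "frechet_derivative \<rho> (at x) v < 0"
  shows "\<exists>d>0. \<forall>h>0. h < d \<longrightarrow> x + h *\<^sub>R v \<in> \<Theta>"
proof -
  have "((\<lambda>t. \<rho> (x + t *\<^sub>R v)) has_real_derivative frechet_derivative \<rho> (at x) v) (at 0)"
    using ldf_derivative[OF x(1)] by (intro has_derivative_along_line) simp
  from DERIV_neg_dec_right[OF this v] obtain d where d: "d > 0" "\<And>h. h > 0 \<Longrightarrow> h < d \<Longrightarrow> \<rho> (x + h *\<^sub>R v) < 0"
    using x by auto
  have "((\<lambda>h. x + h *\<^sub>R v) \<longlongrightarrow> x + 0 *\<^sub>R v) (at 0)" by (intro tendsto_intros)
  then have "\<forall>\<^sub>F h in at 0. x + h *\<^sub>R v \<in> U"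
    using ldf_open x(1) topological_tendstoD by fastforce
  then obtain e where "e > 0" "\<And>h. h \<noteq> 0 \<Longrightarrow> dist h 0 < e \<Longrightarrow> x + h *\<^sub>R v \<in> U"
    unfolding eventually_at by auto
  with d show ?thesis by (intro exI[of _ "min d e"]) (auto simp: ldf_iff)
qed

text \<open>As the differential does not vanish at a zero of \<rho>, some direction descends; moving
  along it enters \<Theta>, so the zero is a limit of points of \<Theta>.\<close>

lemma ldf_frontierI:
  assumes x: "x \<in> U" "\<rho> x = 0" shows "x \<in> frontier \<Theta>"
proof -
  obtain v where v: "frechet_derivative \<rho> (at x) v \<noteq> 0"
    using ldf x unfolding local_defining_function_def by auto
  have lin: "linear (frechet_derivative \<rho> (at x))" using ldf_derivative[OF x(1)] has_derivative_linear by blast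
  obtain w where "frechet_derivative \<rho> (at x) w < 0"
    using v linear_neg[OF lin, of v] by (cases "frechet_derivative \<rho> (at x) v < 0") (auto intro: that[of "-v"] that)
  from ldf_descend[OF x this] obtain d where d: "d > 0" "\<And>h. h>0 \<Longrightarrow> h < d \<Longrightarrow> x + h *\<^sub>R w \<in> \<Theta>" by blast
  have "((\<lambda>h. x + h *\<^sub>R w) \<longlongrightarrow> x + 0 *\<^sub>R w) (at_right 0)" by (intro tendsto_intros)
  moreover have "\<forall>\<^sub>F h in at_right 0. x + h *\<^sub>R w \<in> closure \<Theta>"
    unfolding eventually_at_right_field using d closure_subset by blast
  ultimately have "x \<in> closure \<Theta>"
    using Lim_in_closed_set[of "closure \<Theta>" _ "at_right (0::real)"] by simp
  moreover have "x \<notin> \<Theta>" using ldf_iff x by simp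
  ultimately show ?thesis using op by (simp add: frontier_def interior_open)
qed

end

text \<open>The normal is a definite description over all defining functions, so before it can be
  used with one \<rho> its value must be shown independent of \<rho>. Two different candidates would
  have a direction that enters \<Theta> according to one function and leaves it according to the
  other.\<close>

lemma outward_normal_defining_function:
  fixes \<Theta> :: "'a::euclidean_space set"
  assumes op: "open \<Theta>" and ldf: "local_defining_function \<Theta> q U \<rho>" and q: "q \<in> frontier \<Theta>"
  shows "norm (outward_normal \<Theta> q) = 1"
    and "\<exists>c>0. \<forall>v. frechet_derivative \<rho> (at q) v = c * (outward_normal \<Theta> q \<bullet> v)"
proof -
  let ?P = "\<lambda>U \<rho> c n. local_defining_function \<Theta> q U \<rho> \<and> c > 0 \<and>
            (\<forall>v. frechet_derivative \<rho> (at q) v = c * (n \<bullet> v))"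
  have ex: "\<exists>n c. norm n = 1 \<and> ?P U \<rho> c n" if ldf: "local_defining_function \<Theta> q U \<rho>" for U \<rho>
  proof -
    let ?D = "frechet_derivative \<rho> (at q)"
    have qU: "q \<in> U" using ldf_mem[OF op ldf] .
    have lin: "linear ?D" using ldf_derivative[OF op ldf qU] has_derivative_linear by blast
    define g where "g = (\<Sum>b\<in>Basis. ?D b *\<^sub>R b)"
    have g: "?D v = g \<bullet> v" for v unfolding g_def by (rule linear_real_inner_representation[OF lin])
    have "g \<noteq> 0" using ldf qU g unfolding local_defining_function_def by auto
    then have "norm (g /\<^sub>R norm g) = 1" "?P U \<rho> (norm g) (g /\<^sub>R norm g)"
      using ldf g by auto
    then show ?thesis by blast
  qed
  have uniq: "n = n'" if "norm n = 1" "norm n' = 1" and P: "?P U \<rho> c n" and P': "?P U' \<rho>' c' n'"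
    for n n' U \<rho> c U' \<rho>' c'
  proof (rule ccontr)
    assume "n \<noteq> n'"
    have l: "local_defining_function \<Theta> q U \<rho>" and l': "local_defining_function \<Theta> q U' \<rho>'" using P P' by auto
    have lt: "n \<bullet> n' < 1"
    proof -
      have "0 < (norm (n - n'))\<^sup>2" using \<open>n \<noteq> n'\<close> by simp
      also have "\<dots> = 2 - 2 * (n \<bullet> n')" using that(1,2)
        by (simp add: power2_norm_eq_inner inner_diff inner_commute norm_eq_1)
      finally show ?thesis by simp
    qed
    \<comment> \<open>Distinct unit vectors have inner product below 1, so this direction descends
      for \<rho> and ascends for \<rho>'.\<close>
    define v where "v = n' - n"
    have v: "n \<bullet> v < 0" "n' \<bullet> v > 0" using lt that(1,2) by (auto simp: v_def inner_diff norm_eq_1 inner_commute)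
    have qU: "q \<in> U" "q \<in> U'" using ldf_mem[OF op l] ldf_mem[OF op l'] by auto
    have "frechet_derivative \<rho> (at q) v < 0" using P v by (simp add: mult_pos_neg)
    from ldf_descend[OF op l qU(1) ldf_frontier[OF op l qU(1) q] this]
    obtain d where d: "d > 0" "\<And>h. h>0 \<Longrightarrow> h < d \<Longrightarrow> q + h *\<^sub>R v \<in> \<Theta>" by blast
    have "((\<lambda>t. \<rho>' (q + t *\<^sub>R v)) has_real_derivative frechet_derivative \<rho>' (at q) v) (at 0)"
      using ldf_derivative[OF op l' qU(2)] by (intro has_derivative_along_line) simp
    moreover have "frechet_derivative \<rho>' (at q) v > 0" using P' v by simp
    ultimately obtain e where e: "e > 0" "\<And>h. h > 0 \<Longrightarrow> h < e \<Longrightarrow> \<rho>' (q + h *\<^sub>R v) > 0"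
      using DERIV_pos_inc_right[of "\<lambda>t. \<rho>' (q + t *\<^sub>R v)" _ 0] ldf_frontier[OF op l' qU(2) q] by auto
    have "((\<lambda>h. q + h *\<^sub>R v) \<longlongrightarrow> q + 0 *\<^sub>R v) (at 0)" by (intro tendsto_intros)
    then have "\<forall>\<^sub>F h in at 0. q + h *\<^sub>R v \<in> U'"
      using ldf_open[OF op l'] qU(2) topological_tendstoD by fastforce
    then obtain r where r: "r > 0" "\<And>h. h \<noteq> 0 \<Longrightarrow> dist h 0 < r \<Longrightarrow> q + h *\<^sub>R v \<in> U'"
      unfolding eventually_at by auto
    define h where "h = min (min d e) r / 2"
    have h: "h > 0" "h < d" "h < e" "dist h 0 < r" using d e r by (auto simp: h_def)
    have "q + h *\<^sub>R v \<in> \<Theta>" "q + h *\<^sub>R v \<in> U'" "\<rho>' (q + h *\<^sub>R v) > 0"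
      using d(2) e(2) r(2) h by auto
    then show False using ldf_iff[OF op l'] by force
  qed
  obtain n c where n: "norm n = 1" "?P U \<rho> c n" using ex[OF ldf] by blast
  have "outward_normal \<Theta> q = n" unfolding outward_normal_def
    by (rule the_equality) (use n uniq in blast)+
  with n show "norm (outward_normal \<Theta> q) = 1"
    "\<exists>c>0. \<forall>v. frechet_derivative \<rho> (at q) v = c * (outward_normal \<Theta> q \<bullet> v)" by auto
qed

text \<open>Boundary points approaching p in the tangent direction v, a substitute for a boundary
  curve from the implicit function theorem. On the short normal segment from p + t (v - e n) to p +
  t (v + e n) the function \<rho> changes sign, and the intermediate value theorem gives a
  zero.\<close>

lemma frontier_curve_points:
  fixes \<Theta> :: "'a::euclidean_space set"
  assumes op: "open \<Theta>" and ldf: "local_defining_function \<Theta> p U \<rho>" and p: "p \<in> frontier \<Theta>"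
    and v: "frechet_derivative \<rho> (at p) v = 0" and e: "(e::real) > 0"
  shows "\<exists>t q. 0 < t \<and> t < e \<and> q \<in> frontier \<Theta> \<and> q \<in> U \<and> norm ((q - p) /\<^sub>R t - v) \<le> e"
proof -
  let ?D = "frechet_derivative \<rho> (at p)"
  define n where "n = outward_normal \<Theta> p"
  obtain c where n: "norm n = 1" "c > 0" "\<And>v. ?D v = c * (n \<bullet> v)"
    using outward_normal_defining_function[OF op ldf p] unfolding n_def by blast
  have pU: "p \<in> U" using ldf_mem[OF op ldf] .
  have p0: "\<rho> p = 0" using ldf_frontier[OF op ldf pU p] .
  have nn: "n \<bullet> n = 1" using n(1) by (simp add: norm_eq_1)
  have nv: "n \<bullet> v = 0" using n v by auto
  have d: "((\<lambda>t. \<rho> (p + t *\<^sub>R w)) has_real_derivative ?D w) (at 0)" for w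
    using ldf_derivative[OF op ldf pU] by (intro has_derivative_along_line) simp
  have "?D (v + e *\<^sub>R n) > 0" "?D (v - e *\<^sub>R n) < 0"
    using n e nv nn by (auto simp: inner_add inner_diff)
  from DERIV_pos_inc_right[OF d this(1)] DERIV_neg_dec_right[OF d this(2)]
  obtain d1 d2 where d1: "d1 > 0" "\<And>h. h > 0 \<Longrightarrow> h < d1 \<Longrightarrow> \<rho> (p + h *\<^sub>R (v + e *\<^sub>R n)) > 0"
    and d2: "d2 > 0" "\<And>h. h > 0 \<Longrightarrow> h < d2 \<Longrightarrow> \<rho> (p + h *\<^sub>R (v - e *\<^sub>R n)) < 0"
    using p0 by auto
  obtain r where r: "r > 0" "ball p r \<subseteq> U" using ldf_open[OF op ldf] pU open_contains_ball by blast
  \<comment> \<open>\<open>M\<close> bounds |v + s n| for |s| <= e, so t < r / M keeps the whole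
    normal segment inside the ball of radius r in \<open>U\<close>.\<close>
  define M where "M = norm v + e"
  have M: "M > 0" using e by (simp add: M_def add_nonneg_pos)
  define m where "m = min (min d1 d2) (min e (r / M))"
  define t where "t = m / 2"
  have "m > 0" using d1 d2 e r M by (simp add: m_def)
  then have "t < m" "t > 0" by (auto simp: t_def)
  then have t: "t > 0" "t < d1" "t < d2" "t < e" "t < r / M" by (auto simp: m_def)
  have inU: "p + t *\<^sub>R (v + s *\<^sub>R n) \<in> U" if "s \<in> {-e..e}" for s
  proof -
    have "norm (t *\<^sub>R (v + s *\<^sub>R n)) \<le> t * M"
      using t that norm_triangle_ineq[of v "s *\<^sub>R n"] n(1) by (auto simp: M_def intro!: mult_left_mono)
    also have "\<dots> < r" using t M by (simp add: pos_less_divide_eq)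
    finally show ?thesis using r by (intro subsetD[OF r(2)]) (simp add: dist_norm)
  qed
  have cont: "continuous_on {-e..e} (\<lambda>s. \<rho> (p + t *\<^sub>R (v + s *\<^sub>R n)))"
    using inU by (intro continuous_on_compose2[OF ldf_continuous[OF op ldf]] continuous_intros) auto
  have "\<rho> (p + t *\<^sub>R (v + (-e) *\<^sub>R n)) \<le> 0" using d2(2)[of t] t by simp
  moreover have "0 \<le> \<rho> (p + t *\<^sub>R (v + e *\<^sub>R n))" using d1(2)[of t] t by simp
  ultimately have "\<exists>s. -e \<le> s \<and> s \<le> e \<and> \<rho> (p + t *\<^sub>R (v + s *\<^sub>R n)) = 0"
    using e cont by (intro IVT') auto
  then obtain s where s: "s \<in> {-e..e}" "\<rho> (p + t *\<^sub>R (v + s *\<^sub>R n)) = 0" by auto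
  let ?q = "p + t *\<^sub>R (v + s *\<^sub>R n)"
  have "(?q - p) /\<^sub>R t - v = s *\<^sub>R n" using t by simp
  then have "norm ((?q - p) /\<^sub>R t - v) \<le> e" using s n(1) by auto
  then show ?thesis using ldf_frontierI[OF op ldf inU[OF s(1)] s(2)] inU[OF s(1)] t by blast
qed

text \<open>Transfers the curvature bound from the normal field to the Hessian of \<rho>. At
  boundary points q k the derivative of \<rho> in direction v is a positive multiple of
  \<open>outward_normal\<close> applied to v. Its difference quotient tends to the Hessian at (v,
  v), while the quotient of the normal tends to D v . v >= \<kappa> |v|^2.\<close>

lemma strictly_convex_second_derivative:
  fixes \<Theta> :: "'a::euclidean_space set"
  assumes sc: "strictly_convex \<Theta>" and ldf: "local_defining_function \<Theta> p U \<rho>" and p: "p \<in> frontier \<Theta>"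
    and v: "frechet_derivative \<rho> (at p) v = 0" "v \<noteq> 0"
  shows "frechet_derivative (\<lambda>x. frechet_derivative \<rho> (at x) v) (at p) v > 0"
proof -
  let ?\<nu> = "outward_normal \<Theta>" and ?g = "\<lambda>w x. frechet_derivative \<rho> (at x) w"
  have op: "open \<Theta>" using sc unfolding strictly_convex_def by auto
  obtain \<kappa> D where \<kappa>: "\<kappa> > 0" and D: "(?\<nu> has_derivative D) (at p within frontier \<Theta>)"
    and Dge: "\<And>v. v \<in> boundary_tangent_space \<Theta> p \<Longrightarrow> D v \<bullet> v \<ge> \<kappa> * (norm v)\<^sup>2"
    using sc p unfolding strictly_convex_def by metis
  have pU: "p \<in> U" using ldf_mem[OF op ldf] .
  obtain c where n: "norm (?\<nu> p) = 1" "c > 0" "\<And>v. frechet_derivative \<rho> (at p) v = c * (?\<nu> p \<bullet> v)"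
    using outward_normal_defining_function[OF op ldf p] by blast
  have nv: "?\<nu> p \<bullet> v = 0" using n v by auto
  have "\<exists>t q. 0 < t \<and> t < inverse (real (Suc k)) \<and> q \<in> frontier \<Theta> \<and> q \<in> U \<and>
     norm ((q - p) /\<^sub>R t - v) \<le> inverse (real (Suc k))" for k
    by (rule frontier_curve_points[OF op ldf p v(1)]) simp
  then obtain t q where t: "\<And>k. 0 < t k" "\<And>k. t k < inverse (real (Suc k))"
    and q: "\<And>k. q k \<in> frontier \<Theta>" "\<And>k. q k \<in> U"
    and qv: "\<And>k. norm ((q k - p) /\<^sub>R t k - v) \<le> inverse (real (Suc k))"
    by metis
  have t0: "t \<longlonglongrightarrow> 0"
    by (rule tendsto_sandwich[OF _ _ tendsto_const LIMSEQ_inverse_real_of_nat])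
      (use t in \<open>auto intro!: always_eventually less_imp_le\<close>)
  have qv0: "(\<lambda>k. (q k - p) /\<^sub>R t k) \<longlonglongrightarrow> v"
    by (rule LIM_zero_cancel, rule Lim_null_comparison[OF _ LIMSEQ_inverse_real_of_nat])
      (use qv in \<open>auto intro!: always_eventually\<close>)
  have "(\<lambda>k. (?\<nu> (q k) - ?\<nu> p) /\<^sub>R t k) \<longlonglongrightarrow> D v"
    by (rule sequence_has_derivative[OF D q(1) t(1) t0 qv0])
  then have "(\<lambda>k. ((?\<nu> (q k) - ?\<nu> p) /\<^sub>R t k) \<bullet> v) \<longlonglongrightarrow> D v \<bullet> v" by (intro tendsto_intros)
  then have l1: "(\<lambda>k. (?\<nu> (q k) \<bullet> v) / t k) \<longlonglongrightarrow> D v \<bullet> v"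
    by (simp add: inner_diff nv divide_inverse_commute)
  have l2: "(\<lambda>k. (?g v (q k) - ?g v p) /\<^sub>R t k) \<longlonglongrightarrow> frechet_derivative (?g v) (at p) v"
    by (rule sequence_has_derivative[OF ldf_derivative2[OF op ldf pU] UNIV_I t(1) t0 qv0])
  have "(\<lambda>k. t k *\<^sub>R ((q k - p) /\<^sub>R t k)) \<longlonglongrightarrow> 0 *\<^sub>R v"
    by (intro tendsto_intros t0 qv0)
  moreover have "t k *\<^sub>R ((q k - p) /\<^sub>R t k) = q k - p" for k
    using t(1)[of k] by simp
  ultimately have "(\<lambda>k. q k - p) \<longlonglongrightarrow> 0" by simp
  then have qp: "q \<longlonglongrightarrow> p" by (rule LIM_zero_cancel)
  have "isCont (?g (?\<nu> p)) p" using ldf_derivative2[OF op ldf pU] has_derivative_continuous by blast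
  then have l3: "(\<lambda>k. ?g (?\<nu> p) (q k)) \<longlonglongrightarrow> ?g (?\<nu> p) p"
    using qp isCont_tendsto_compose by blast
  have gp: "?g (?\<nu> p) p = c" using n by (simp add: norm_eq_1)
  have qk: "\<exists>c>0. \<forall>v. frechet_derivative \<rho> (at (q k)) v = c * (?\<nu> (q k) \<bullet> v)" "norm (?\<nu> (q k)) = 1" for k
    using outward_normal_defining_function[OF op ldf_at[OF op ldf q(2)] q(1)] by auto
  define \<beta> where "\<beta> = \<kappa> * (norm v)\<^sup>2"
  have \<beta>: "\<beta> > 0" using \<kappa> v by (simp add: \<beta>_def)
  have "D v \<bullet> v \<ge> \<beta>" using Dge[of v] nv by (simp add: \<beta>_def boundary_tangent_space_def)
  then have e1: "\<forall>\<^sub>F k in sequentially. (?\<nu> (q k) \<bullet> v) / t k > \<beta> / 2"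
    using order_tendstoD(1)[OF l1, of "\<beta>/2"] \<beta> by simp
  have e2: "\<forall>\<^sub>F k in sequentially. ?g (?\<nu> p) (q k) > c / 2"
    using order_tendstoD(1)[OF l3, of "c/2"] n(2) gp by simp
  have "\<forall>\<^sub>F k in sequentially. c / 2 * (\<beta> / 2) \<le> (?g v (q k) - ?g v p) /\<^sub>R t k"
    using e1 e2
  proof eventually_elim
    case (elim k)
    obtain a where a: "a > 0" "\<And>v. frechet_derivative \<rho> (at (q k)) v = a * (?\<nu> (q k) \<bullet> v)"
      using qk by blast
    \<comment> \<open>The multiplier \<open>a\<close> depends on k. It is bounded below through the
      derivative of \<rho> in the fixed direction of the normal at p, which is continuous in the
      base point, equals c at p, and is at most \<open>a\<close> at q k by Cauchy-Schwarz.\<close>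
    have "c / 2 < a * (?\<nu> (q k) \<bullet> ?\<nu> p)" using elim(2) a(2) by simp
    also have "\<dots> \<le> a * 1" using norm_cauchy_schwarz[of "?\<nu> (q k)" "?\<nu> p"] qk(2) n(1) a(1)
      by (intro mult_left_mono) auto
    finally have "c / 2 \<le> a" by simp
    then have "c / 2 * (\<beta> / 2) \<le> a * ((?\<nu> (q k) \<bullet> v) / t k)"
      using elim(1) \<beta> n(2) by (intro mult_mono) auto
    moreover have "(?g v (q k) - ?g v p) /\<^sub>R t k = a * ((?\<nu> (q k) \<bullet> v) / t k)"
      unfolding a(2) v(1) by (simp add: divide_inverse)
    ultimately show ?case by simp
  qed
  then have "c / 2 * (\<beta> / 2) \<le> frechet_derivative (?g v) (at p) v"
    by (intro tendsto_lowerbound[OF l2]) auto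
  moreover have "c / 2 * (\<beta> / 2) > 0" using n(2) \<beta> by simp
  ultimately show ?thesis by linarith
qed

text \<open>Along the segment \<rho> is at most 0 and attains 0 at p, so its first derivative
  vanishes there and v is tangent. The second derivative is then positive, which forces \<rho> > 0
  just after p.\<close>

lemma strictly_convex_no_touching_segment:
  fixes \<Theta> :: "'a::euclidean_space set"
  assumes sc: "strictly_convex \<Theta>" and p: "p \<in> frontier \<Theta>" and v: "v \<noteq> 0" and d: "d > 0"
    and seg: "\<And>t. \<bar>t\<bar> < d \<Longrightarrow> p + t *\<^sub>R v \<in> closure \<Theta>"
  shows False
proof -
  have op: "open \<Theta>" and "smooth_boundary \<Theta>" using sc unfolding strictly_convex_def by auto
  then obtain U \<rho> where ldf: "local_defining_function \<Theta> p U \<rho>" using p unfolding smooth_boundary_def by blast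
  let ?g = "\<lambda>x. frechet_derivative \<rho> (at x) v"
  let ?\<phi> = "\<lambda>t. \<rho> (p + t *\<^sub>R v)"
  have pU: "p \<in> U" using ldf_mem[OF op ldf] .
  have p0: "\<rho> p = 0" using ldf_frontier[OF op ldf pU p] .
  have "((\<lambda>h. p + h *\<^sub>R v) \<longlongrightarrow> p + 0 *\<^sub>R v) (at 0)" by (intro tendsto_intros)
  then have "\<forall>\<^sub>F h in at 0. p + h *\<^sub>R v \<in> U"
    using ldf_open[OF op ldf] pU topological_tendstoD by fastforce
  then obtain r where r: "r > 0" "\<And>h. h \<noteq> 0 \<Longrightarrow> dist h 0 < r \<Longrightarrow> p + h *\<^sub>R v \<in> U"
    unfolding eventually_at by auto
  define e where "e = min d r"
  have e: "e > 0" using d r by (simp add: e_def)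
  have inU: "p + h *\<^sub>R v \<in> U" if "\<bar>h\<bar> < e" for h using that r pU by (cases "h = 0") (auto simp: e_def)
  have le: "?\<phi> h \<le> 0" if "\<bar>h\<bar> < e" for h
    using ldf_closure[OF op ldf inU[OF that]] seg[of h] that by (simp add: e_def)
  have der: "(?\<phi> has_real_derivative ?g (p + h *\<^sub>R v)) (at h)" if "\<bar>h\<bar> < e" for h
    by (rule has_derivative_along_line[OF ldf_derivative[OF op ldf inU[OF that]]])
  have g0: "?g p = 0"
    using DERIV_local_max[OF der e, of 0] e le p0 by simp
  have "((\<lambda>t. ?g (p + t *\<^sub>R v)) has_real_derivative frechet_derivative ?g (at p) v) (at 0)"
    by (rule has_derivative_along_line) (use ldf_derivative2[OF op ldf pU] in simp)
  from DERIV_pos_inc_right[OF this strictly_convex_second_derivative[OF sc ldf p g0 v]]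
  obtain s where s: "s > 0" "\<And>h. h > 0 \<Longrightarrow> h < s \<Longrightarrow> ?g (p + h *\<^sub>R v) > 0"
    using g0 by auto
  define b where "b = min e s / 2"
  have b: "0 < b" "b < e" "b < s" using e s by (auto simp: b_def)
  have "?\<phi> 0 < ?\<phi> b"
  proof (rule DERIV_pos_imp_increasing_open[OF b(1)])
    fix x assume "0 < x" "x < b"
    then show "\<exists>y. (?\<phi> has_real_derivative y) (at x) \<and> y > 0"
      using der[of x] s(2)[of x] b by auto
  next
    have "continuous_on {0..b} ?\<phi>"
      using b by (intro DERIV_continuous_on[OF DERIV_subset[OF der]]) auto
    then show "continuous_on {0..b} ?\<phi>" .
  qed
  then show False using le[of b] b p0 by simp
qed

text \<open>The set \<open>A\<close> of points of \<Theta> visible from x is open, as a compact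
  segment has a uniform neighbourhood in \<Theta>. It is closed in \<Theta>, as a limit of visible
  segments lies in the closure and cannot touch the frontier at an inner point. Connectedness then
  gives A = \<Theta>.\<close>

lemma strictly_convex_imp_convex:
  fixes \<Theta> :: "'a::euclidean_space set"
  assumes sc: "strictly_convex \<Theta>"
  shows "convex \<Theta>"
proof -
  have op: "open \<Theta>" and con: "connected \<Theta>" using sc unfolding strictly_convex_def by auto
  have "closed_segment x y \<subseteq> \<Theta>" if x: "x \<in> \<Theta>" and y: "y \<in> \<Theta>" for x y
  proof -
    define A where "A = {y \<in> \<Theta>. closed_segment x y \<subseteq> \<Theta>}"
    have "open A"
      unfolding open_contains_ball
    proof
      fix y assume y: "y \<in> A"
      then have "compact (closed_segment x y)" "closed_segment x y \<subseteq> \<Theta>" by (auto simp: A_def)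
      from compact_subset_open_imp_ball_epsilon_subset[OF this(1) op this(2)]
      obtain e where e: "e > 0" "(\<Union>z\<in>closed_segment x y. ball z e) \<subseteq> \<Theta>" by blast
      have "closed_segment x y' \<subseteq> \<Theta>" if "y' \<in> ball y e" for y'
      proof
        fix z assume "z \<in> closed_segment x y'"
        then obtain t where t: "0 \<le> t" "t \<le> 1" "z = (1 - t) *\<^sub>R x + t *\<^sub>R y'" by (auto simp: in_segment)
        let ?w = "(1 - t) *\<^sub>R x + t *\<^sub>R y"
        have "?w - z = t *\<^sub>R (y - y')" by (simp add: t algebra_simps)
        then have "dist ?w z \<le> dist y y'" using t(1,2) by (simp add: dist_norm mult_left_le_one_le)
        then have "z \<in> ball ?w e" using that by simp
        moreover have "?w \<in> closed_segment x y" using t by (auto simp: in_segment)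
        ultimately show "z \<in> \<Theta>" using e(2) by blast
      qed
      then have "ball y e \<subseteq> A" using ends_in_segment(2)[of x] by (auto simp: A_def subset_iff)
      then show "\<exists>e>0. ball y e \<subseteq> A" using e(1) by blast
    qed
    then have "openin (top_of_set \<Theta>) A" by (intro open_openin_trans op) (auto simp: A_def)
    moreover have "closedin (top_of_set \<Theta>) A"
    proof -
      have "l \<in> A" if l: "l \<in> \<Theta>" "l \<in> closure A" for l
      proof -
      obtain f where *: "(\<forall>n. f n \<in> A) \<and> l \<in> \<Theta> \<and> f \<longlonglongrightarrow> l" using l unfolding closure_sequential by blast
      let ?p = "\<lambda>t. (1 - t) *\<^sub>R x + t *\<^sub>R l"
      have cl: "?p t \<in> closure \<Theta>" if t: "0 \<le> t" "t \<le> 1" for t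
      proof (rule Lim_in_closed_set)
        show "(\<lambda>n. (1 - t) *\<^sub>R x + t *\<^sub>R f n) \<longlonglongrightarrow> ?p t" using * by (intro tendsto_intros) auto
        have "(1 - t) *\<^sub>R x + t *\<^sub>R f n \<in> closure \<Theta>" for n
        proof -
          have "(1 - t) *\<^sub>R x + t *\<^sub>R f n \<in> closed_segment x (f n)" using t by (auto simp: in_segment)
          then show ?thesis using * closure_subset[of \<Theta>] by (auto simp: A_def)
        qed
        then show "\<forall>\<^sub>F n in sequentially. (1 - t) *\<^sub>R x + t *\<^sub>R f n \<in> closure \<Theta>" by simp
      qed auto
      have "?p t \<in> \<Theta>" if t: "0 \<le> t" "t \<le> 1" for t
      proof (rule ccontr)
        assume n: "?p t \<notin> \<Theta>"
        then have fr: "?p t \<in> frontier \<Theta>" using cl[OF t] op by (simp add: frontier_def interior_open)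
        have "t \<noteq> 0" "t \<noteq> 1" "x \<noteq> l" using n x * by (auto simp flip: scaleR_left.add)
        then have t': "0 < t" "t < 1" using t by auto
        show False
        proof (rule strictly_convex_no_touching_segment[OF sc fr, of "l - x" "min t (1 - t)"])
          show "l - x \<noteq> 0" using \<open>x \<noteq> l\<close> by simp
          show "0 < min t (1 - t)" using t' by simp
          fix s assume "\<bar>s\<bar> < min t (1 - t)"
          then have "?p (t + s) \<in> closure \<Theta>" by (intro cl) auto
          also have "?p (t + s) = ?p t + s *\<^sub>R (l - x)" by (simp add: algebra_simps)
          finally show "?p t + s *\<^sub>R (l - x) \<in> closure \<Theta>" .
        qed
      qed
      then have "closed_segment x l \<subseteq> \<Theta>" by (auto simp: in_segment)
      then show "l \<in> A" using * by (simp add: A_def)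
      qed
      then have "A = \<Theta> \<inter> closure A" using closure_subset[of A] by (auto simp: A_def)
      then show ?thesis by (metis closedin_closed_Int closed_closure)
    qed
    moreover have "x \<in> A" using x by (simp add: A_def)
    ultimately have "A = \<Theta>" using con unfolding connected_clopen by blast
    then show ?thesis using y by (auto simp: A_def)
  qed
  then show ?thesis by (simp add: convex_contains_segment)
qed

section \<open>Smooth functions and smooth bumps\<close>

text \<open>\<open>Ck_on\<close> is phrased with the chosen \<open>frechet_derivative\<close>. This
  rule accepts an explicit derivative instead, so that each closure property below is an induction
  on the order driven by the corresponding differentiation rule.\<close>

lemma Ck_on_SucI:
  assumes "\<And>x. (f has_derivative f' x) (at x)" and "\<And>v. Ck_on k UNIV (\<lambda>x. f' x v)"
  shows "Ck_on (Suc k) UNIV f"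
proof -
  have "frechet_derivative f (at x) = f' x" for x using frechet_derivative_at[OF assms(1)] by simp
  then show ?thesis using assms by (auto simp: differentiable_def)
qed

lemma Ck_on_Suc_derivative:
  assumes "Ck_on (Suc k) UNIV f"
  shows "(f has_derivative frechet_derivative f (at x)) (at x)"
    and "Ck_on k UNIV (\<lambda>x. frechet_derivative f (at x) v)"
  using assms by (auto simp: frechet_derivative_works)

lemma Ck_on_decrease: "Ck_on (Suc k) UNIV f \<Longrightarrow> Ck_on k UNIV f"
proof (induction k arbitrary: f)
  case 0
  then show ?case
    using has_derivative_continuous[OF Ck_on_Suc_derivative(1)[OF 0]] by (simp add: continuous_at_imp_continuous_on)
qed auto

lemma Ck_on_continuous: "Ck_on k UNIV f \<Longrightarrow> continuous_on UNIV f"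
  by (induction k) (auto dest: Ck_on_decrease simp del: Ck_on.simps(2))

lemma Ck_on_const: "Ck_on k UNIV (\<lambda>x. c)"
  by (induction k arbitrary: c) (auto intro!: Ck_on_SucI[where f' = "\<lambda>x v. 0"] continuous_intros simp del: Ck_on.simps(2))

lemma Ck_on_bounded_linear: "bounded_linear f \<Longrightarrow> Ck_on k UNIV f"
  by (cases k) (auto intro!: Ck_on_SucI[where f' = "\<lambda>x. f"] Ck_on_const bounded_linear_imp_has_derivative
      linear_continuous_on simp del: Ck_on.simps(2))

lemma Ck_on_add: "Ck_on k UNIV f \<Longrightarrow> Ck_on k UNIV g \<Longrightarrow> Ck_on k UNIV (\<lambda>x. f x + g x)"
proof (induction k arbitrary: f g)
  case (Suc k)
  show ?case
    by (rule Ck_on_SucI[OF has_derivative_add[OF Ck_on_Suc_derivative(1)[OF Suc.prems(1)] Ck_on_Suc_derivative(1)[OF Suc.prems(2)]]])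
      (intro Suc.IH Ck_on_Suc_derivative(2) Suc.prems)
qed (auto intro: continuous_intros)

lemma Ck_on_linear_compose:
  assumes "bounded_linear h"
  shows "Ck_on k UNIV f \<Longrightarrow> Ck_on k UNIV (\<lambda>x. h (f x))"
proof (induction k arbitrary: f)
  case 0 then show ?case by (auto intro: bounded_linear.continuous_on[OF assms])
next
  case (Suc k)
  show ?case
    by (rule Ck_on_SucI[OF bounded_linear.has_derivative[OF assms Ck_on_Suc_derivative(1)[OF Suc.prems]]])
      (intro Suc.IH Ck_on_Suc_derivative(2) Suc.prems)
qed

lemma Ck_on_bilinear:
  assumes "bounded_bilinear h"
  shows "Ck_on k UNIV f \<Longrightarrow> Ck_on k UNIV g \<Longrightarrow> Ck_on k UNIV (\<lambda>x. h (f x) (g x))"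
proof (induction k arbitrary: f g)
  case 0 then show ?case by (auto intro: bounded_bilinear.continuous_on[OF assms])
next
  case (Suc k)
  show ?case
    by (rule Ck_on_SucI[OF bounded_bilinear.FDERIV[OF assms Ck_on_Suc_derivative(1)[OF Suc.prems(1)] Ck_on_Suc_derivative(1)[OF Suc.prems(2)]]])
      (intro Suc.IH Ck_on_Suc_derivative(2) Suc.prems Ck_on_add Ck_on_decrease)
qed

lemmas Ck_on_mult = Ck_on_bilinear[OF bounded_bilinear_mult]

lemma Ck_on_compose_linear:
  assumes "bounded_linear A"
  shows "Ck_on k UNIV f \<Longrightarrow> Ck_on k UNIV (\<lambda>x. f (A x))"
proof (induction k arbitrary: f)
  case 0 then show ?case
    using linear_continuous_on[OF assms, of UNIV] by (auto intro: continuous_on_compose2)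
next
  case (Suc k)
  show ?case
  proof (rule Ck_on_SucI)
    show "((\<lambda>x. f (A x)) has_derivative (\<lambda>v. frechet_derivative f (at (A x)) (A v))) (at x)" for x
      by (rule has_derivative_compose[OF bounded_linear_imp_has_derivative[OF assms] Ck_on_Suc_derivative(1)[OF Suc.prems]])
    show "Ck_on k UNIV (\<lambda>x. frechet_derivative f (at (A x)) (A v))" for v
      by (intro Suc.IH Ck_on_Suc_derivative(2) Suc.prems)
  qed
qed

lemma Ck_on_exp:
  fixes f :: "'a::euclidean_space \<Rightarrow> real"
  shows "Ck_on k UNIV f \<Longrightarrow> Ck_on k UNIV (\<lambda>x. exp (f x))"
proof (induction k arbitrary: f)
  case 0 then show ?case by (auto intro: continuous_intros)
next
  case (Suc k)
  show ?case
    by (rule Ck_on_SucI[OF has_derivative_exp[OF Ck_on_Suc_derivative(1)[OF Suc.prems]]])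
      (intro Suc.IH Suc.prems Ck_on_Suc_derivative(2)[OF Suc.prems] Ck_on_mult Ck_on_decrease[OF Suc.prems])
qed

lemma Ck_on_prod:
  fixes f :: "'i \<Rightarrow> 'a::euclidean_space \<Rightarrow> real"
  assumes "\<And>i. i \<in> I \<Longrightarrow> Ck_on k UNIV (f i)"
  shows "Ck_on k UNIV (\<lambda>x. \<Prod>i\<in>I. f i x)"
  using assms by (induction I rule: infinite_finite_induct) (auto intro!: Ck_on_const Ck_on_mult)

text \<open>The family is closed under differentiation up to linear combinations, which makes
  smoothness of \<open>exp (-1/t)\<close> provable by induction on the order.\<close>

definition bump :: "nat \<Rightarrow> real \<Rightarrow> real" where
  "bump n t = (if t > 0 then exp (- inverse t) * inverse t ^ n else 0)"

lemma tendsto_bump_0: "(bump n \<longlongrightarrow> 0) (at 0)"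
proof -
  have "((\<lambda>t. (inverse t) ^ n / exp (inverse t)) \<longlongrightarrow> (0::real)) (at_right 0)"
    by (rule filterlim_compose[OF tendsto_power_div_exp_0 filterlim_inverse_at_top_right])
  then have "(bump n \<longlongrightarrow> 0) (at_right 0)"
    by (rule Lim_transform_eventually)
      (auto simp: eventually_at_right_field bump_def exp_minus divide_inverse mult.commute intro!: exI[of _ 1])
  moreover have "((\<lambda>t. 0) \<longlongrightarrow> (0::real)) (at_left 0)" by simp
  then have "(bump n \<longlongrightarrow> 0) (at_left 0)"
    by (rule Lim_transform_eventually) (auto simp: eventually_at_left_field bump_def intro!: exI[of _ "-1"])
  ultimately show ?thesis by (simp add: filterlim_split_at)
qed

lemma DERIV_bump: "(bump n has_real_derivative bump (n + 2) t - real n * bump (n + 1) t) (at t)"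
proof -
  consider "t > 0" | "t < 0" | "t = 0" by linarith
  then show ?thesis
  proof cases
    case 1
    have inv: "(inverse has_real_derivative - (inverse t * inverse t)) (at t)"
      using 1 by (auto intro!: derivative_eq_intros simp: power2_eq_square)
    have P: "((\<lambda>t. inverse t ^ n) has_real_derivative - (real n * inverse t ^ (n + 1))) (at t)"
    proof (induction n)
      case (Suc n)
      show ?case using DERIV_mult[OF inv Suc] by (simp add: algebra_simps)
    qed simp
    have E: "((\<lambda>t. exp (- inverse t)) has_real_derivative exp (- inverse t) * (inverse t * inverse t)) (at t)"
      using DERIV_fun_exp[OF DERIV_minus[OF inv]] by simp
    have "((\<lambda>t. exp (- inverse t) * inverse t ^ n) has_real_derivative bump (n + 2) t - real n * bump (n + 1) t) (at t)"
      using DERIV_mult[OF E P] 1 by (simp add: bump_def algebra_simps)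
    then show ?thesis
      by (rule has_field_derivative_transform_within_open[of _ _ _ "{0<..}"]) (use 1 in \<open>auto simp: bump_def\<close>)
  next
    case 2
    have "((\<lambda>t. 0) has_real_derivative bump (n + 2) t - real n * bump (n + 1) t) (at t)"
      using 2 by (auto simp: bump_def)
    then show ?thesis
      by (rule has_field_derivative_transform_within_open[of _ _ _ "{..<0}"]) (use 2 in \<open>auto simp: bump_def\<close>)
  next
    case 3
    \<comment> \<open>The difference quotient at 0 is the next member of the family, so
      differentiability there reduces to its limit.\<close>
    have "(bump n (0 + h) - bump n 0) / h = bump (n + 1) h" for h by (simp add: bump_def divide_inverse)
    then have "((\<lambda>h. (bump n (0 + h) - bump n 0) / h) \<longlongrightarrow> 0) (at 0)" using tendsto_bump_0[of "n+1"] by simp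
    moreover have "bump (n + 2) t - real n * bump (n + 1) t = 0" using 3 by (simp add: bump_def)
    ultimately show ?thesis using 3 unfolding has_field_derivative_iff by simp
  qed
qed

lemma Ck_on_bump:
  fixes f :: "'a::euclidean_space \<Rightarrow> real"
  shows "Ck_on k UNIV f \<Longrightarrow> Ck_on k UNIV (\<lambda>x. bump n (f x))"
proof (induction k arbitrary: n)
  case 0
  have "continuous_on UNIV (bump n)"
    using DERIV_bump DERIV_isCont by (intro continuous_at_imp_continuous_on) blast
  then show ?case using 0 by (auto intro: continuous_on_compose2)
next
  case (Suc k)
  show ?case
  proof (rule Ck_on_SucI)
    show "((\<lambda>x. bump n (f x)) has_derivative (\<lambda>v. (bump (n + 2) (f x) + (- real n) * bump (n + 1) (f x)) * frechet_derivative f (at x) v)) (at x)" for x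
      using has_derivative_compose[OF Ck_on_Suc_derivative(1)[OF Suc.prems] DERIV_bump[unfolded has_field_derivative_def]]
      by simp
    show "Ck_on k UNIV (\<lambda>x. (bump (n + 2) (f x) + (- real n) * bump (n + 1) (f x)) * frechet_derivative f (at x) v)" for v
      by (intro Ck_on_mult Ck_on_add Ck_on_const Suc.IH Ck_on_decrease[OF Suc.prems] Ck_on_Suc_derivative(2)[OF Suc.prems])
  qed
qed

text \<open>A product of one-dimensional bumps rather than a radial one: the set of positivity is
  then exactly an open box, and open boxes form an intersection-stable generator of the Borel
  sets.\<close>

definition box_bump :: "'a::euclidean_space \<Rightarrow> 'a \<Rightarrow> 'a \<Rightarrow> real" where
  "box_bump a b x = (\<Prod>i\<in>Basis. bump 0 (x \<bullet> i - a \<bullet> i) * bump 0 (b \<bullet> i - x \<bullet> i))"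

lemma box_bump_pos_iff: "box_bump a b x > 0 \<longleftrightarrow> x \<in> box a b"
proof -
  have "box_bump a b x \<noteq> 0 \<longleftrightarrow> x \<in> box a b"
    by (auto simp: box_bump_def bump_def mem_box)
  moreover have "box_bump a b x \<ge> 0" by (auto simp: box_bump_def bump_def intro!: prod_nonneg)
  ultimately show ?thesis by linarith
qed

lemma box_bump_nonneg: "box_bump a b x \<ge> 0"
  by (auto simp: box_bump_def bump_def intro!: prod_nonneg)

lemma Ck_on_box_bump: "Ck_on k UNIV (box_bump a b)"
proof -
  have 1: "Ck_on k UNIV (\<lambda>x::'a. x \<bullet> i + c)" for i c
    by (intro Ck_on_add Ck_on_const Ck_on_bounded_linear bounded_linear_inner_left)
  have 2: "Ck_on k UNIV (\<lambda>x::'a. c + (- 1) * (x \<bullet> i))" for i c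
    by (intro Ck_on_add Ck_on_mult Ck_on_const Ck_on_bounded_linear bounded_linear_inner_left)
  have "Ck_on k UNIV (\<lambda>x::'a. \<Prod>i\<in>Basis. bump 0 (x \<bullet> i + (- (a \<bullet> i))) * bump 0 (b \<bullet> i + (-1) * (x \<bullet> i)))"
    by (intro Ck_on_prod Ck_on_mult Ck_on_bump 1 2)
  then show ?thesis by (simp add: box_bump_def[abs_def])
qed

text \<open>The source of all integration by parts here. Translation invariance gives every
  difference quotient of f in direction v the integral 0, and dominated convergence passes this on
  to the derivative; no coordinates or iterated integrals enter.\<close>

lemma integral_directional_derivative_compact_support:
  fixes f :: "'a::euclidean_space \<Rightarrow> 'b::euclidean_space"
  assumes f: "\<And>x. (f has_derivative f' x) (at x)" and f': "continuous_on UNIV (\<lambda>x. f' x v)"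
    and K: "compact K" "\<And>x. x \<notin> K \<Longrightarrow> f x = 0"
  shows "integrable lebesgue (\<lambda>x. f' x v)" and "(LINT x|lebesgue. f' x v) = 0"
proof -
  have cf: "continuous_on UNIV f" using f has_derivative_continuous continuous_at_imp_continuous_on by blast
  have f'0: "f' x v = 0" if "x \<notin> K" for x
  proof -
    have "((\<lambda>x. 0) has_derivative f' x) (at x)"
      using has_derivative_transform_within_open[OF f, of "- K" x "\<lambda>_. 0"] K that
      by (auto simp: compact_imp_closed open_Compl)
    then have "f' x = (\<lambda>v. 0)" using has_derivative_unique[of "\<lambda>x. 0"] has_derivative_const by blast
    then show ?thesis by simp
  qed
  obtain R where "\<And>x. x \<in> K \<Longrightarrow> norm x \<le> R" using compact_imp_bounded[OF K(1)] by (auto simp: bounded_iff)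
  then have R: "K \<subseteq> cball 0 R" by auto
  obtain M where M: "\<And>x. x \<in> K \<Longrightarrow> norm (f' x v) \<le> M" "M > 0"
    using compact_imp_bounded[OF compact_continuous_image[OF continuous_on_subset[OF f'] K(1)]]
    by (auto simp: bounded_pos)
  have M': "norm (f' x v) \<le> M" for x using M f'0[of x] by (cases "x \<in> K") auto
  have int0: "integrable lborel g" if "continuous_on UNIV g" "\<And>x. x \<notin> K \<Longrightarrow> g x = 0" for g :: "'a \<Rightarrow> 'b"
  proof -
    have "integrable lborel (\<lambda>x. indicator K x *\<^sub>R g x)"
      by (rule borel_integrable_compact[OF K(1)]) (use that continuous_on_subset in blast)
    also have "(\<lambda>x. indicator K x *\<^sub>R g x) = g" using that by (auto simp: indicator_def)
    finally show ?thesis .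
  qed
  have intf: "integrable lborel f" using int0[OF cf] K by blast
  have intf': "integrable lborel (\<lambda>x. f' x v)" using int0[OF f' f'0] by blast
  \<comment> \<open>The difference quotient with step 1 / (m + 1); steps of size at most 1 keep its
    support within distance |v| of the support of f.\<close>
  define q where "q m x = real (Suc m) *\<^sub>R (f (v /\<^sub>R real (Suc m) + x) - f x)" for m x
  have mf: "f \<in> borel_measurable borel" "(\<lambda>x. f' x v) \<in> borel_measurable borel"
    using cf f' by (auto intro: borel_measurable_continuous_onI)
  have trans: "integrable lborel (\<lambda>x. f (c + x))" "(LINT x|lborel. f (c + x)) = (LINT x|lborel. f x)" for c
  proof -
    have "integrable (distr lborel borel ((+) c)) f" using intf by (simp add: lborel_distr_plus)
    then show "integrable lborel (\<lambda>x. f (c + x))" using mf by (subst (asm) integrable_distr_eq) auto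
    show "(LINT x|lborel. f (c + x)) = (LINT x|lborel. f x)"
      using mf integral_distr[of "(+) c" lborel borel f] by (simp add: lborel_distr_plus)
  qed
  have "(\<lambda>m. LINT x|lborel. q m x) \<longlonglongrightarrow> (LINT x|lborel. f' x v)"
  proof (rule integral_dominated_convergence)
    \<comment> \<open>The majorant: by the mean value inequality a quotient never exceeds the
      maximum \<open>M\<close> of the derivative, and off the enlarged ball both points of the
      quotient miss \<open>K\<close>.\<close>
    show "integrable lborel (\<lambda>x. indicator (cball 0 (R + norm v)) x * M)"
      using borel_integrable_compact[OF compact_cball, of 0 "R + norm v" "\<lambda>x. M"] by simp
    show "AE x in lborel. (\<lambda>m. q m x) \<longlonglongrightarrow> f' x v"
    proof (rule AE_I2)
      fix x
      have l: "(\<lambda>m. v /\<^sub>R real (Suc m)) \<longlonglongrightarrow> 0"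
        using tendsto_scaleR[OF LIMSEQ_inverse_real_of_nat tendsto_const[of v]] by simp
      have D: "linear (f' x)" using f has_derivative_linear by blast
      show "(\<lambda>m. q m x) \<longlonglongrightarrow> f' x v"
      proof (cases "v = 0")
        case True
        then show ?thesis by (simp add: q_def linear_0[OF D])
      next
        case False
        have "((\<lambda>h. norm (f (x + h) - f x - f' x h) / norm h) \<longlongrightarrow> 0) (at 0)"
          using f[of x] by (simp add: has_derivative_at)
        moreover have "filterlim (\<lambda>m. v /\<^sub>R real (Suc m)) (at 0) sequentially"
          using l False by (auto simp: filterlim_at)
        ultimately have "(\<lambda>m. norm (f (x + v /\<^sub>R real (Suc m)) - f x - f' x (v /\<^sub>R real (Suc m))) / norm (v /\<^sub>R real (Suc m))) \<longlonglongrightarrow> 0"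
          by (rule filterlim_compose)
        then have "(\<lambda>m. norm v * (norm (f (x + v /\<^sub>R real (Suc m)) - f x - f' x (v /\<^sub>R real (Suc m))) / norm (v /\<^sub>R real (Suc m)))) \<longlonglongrightarrow> norm v * 0"
          by (rule tendsto_mult[OF tendsto_const])
        moreover have "norm v * (norm (f (x + v /\<^sub>R real (Suc m)) - f x - f' x (v /\<^sub>R real (Suc m))) / norm (v /\<^sub>R real (Suc m))) = norm (q m x - f' x v)" for m
        proof -
          have "q m x - f' x v = real (Suc m) *\<^sub>R (f (x + v /\<^sub>R real (Suc m)) - f x - f' x (v /\<^sub>R real (Suc m)))"
            unfolding q_def linear_scale[OF D] scaleR_right_diff_distrib by (simp add: add.commute)
          then have "norm (q m x - f' x v) = real (Suc m) * norm (f (x + v /\<^sub>R real (Suc m)) - f x - f' x (v /\<^sub>R real (Suc m)))"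
            by (simp only: norm_scaleR abs_of_nat)
          moreover have "norm (v /\<^sub>R real (Suc m)) = norm v / real (Suc m)"
            by (simp only: norm_scaleR abs_inverse abs_of_nat divide_inverse mult.commute)
          ultimately show ?thesis using False by (simp add: field_simps)
        qed
        ultimately show ?thesis by (simp add: tendsto_norm_zero_iff LIM_zero_iff)
      qed
    qed
    show "AE x in lborel. norm (q m x) \<le> indicator (cball 0 (R + norm v)) x * M" for m
    proof (rule AE_I2)
      fix x
      let ?s = "inverse (real (Suc m))"
      have s: "?s > 0" "?s \<le> 1" by (auto simp: field_simps)
      show "norm (q m x) \<le> indicator (cball 0 (R + norm v)) x * M"
      proof (cases "x \<in> cball 0 (R + norm v)")
        case True
        have "\<exists>t\<in>{0<..<?s}. norm (f (x + ?s *\<^sub>R v) - f (x + 0 *\<^sub>R v)) \<le> norm ((?s - 0) *\<^sub>R f' (x + t *\<^sub>R v) v)"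
        proof (rule mvt_general[OF s(1), of "\<lambda>t. f (x + t *\<^sub>R v)" "\<lambda>t h. h *\<^sub>R f' (x + t *\<^sub>R v) v"])
          show "continuous_on {0..?s} (\<lambda>t. f (x + t *\<^sub>R v))"
            by (intro continuous_on_compose2[OF cf] continuous_intros) auto
          fix t
          have "((\<lambda>t. x + t *\<^sub>R v) has_derivative (\<lambda>h. h *\<^sub>R v)) (at t)"
            by (auto intro!: derivative_eq_intros)
          from has_derivative_compose[OF this f]
          show "((\<lambda>t. f (x + t *\<^sub>R v)) has_derivative (\<lambda>h. h *\<^sub>R f' (x + t *\<^sub>R v) v)) (at t)"
            by (simp add: linear_scale[OF has_derivative_linear[OF f]])
        qed
        then obtain t where "norm (f (x + ?s *\<^sub>R v) - f x) \<le> ?s * norm (f' (x + t *\<^sub>R v) v)"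
          using s by auto
        also have "\<dots> \<le> ?s * M" using M' s by (intro mult_left_mono) auto
        finally have "norm (f (?s *\<^sub>R v + x) - f x) \<le> ?s * M" by (simp add: add.commute)
        then have "real (Suc m) * norm (f (?s *\<^sub>R v + x) - f x) \<le> real (Suc m) * (?s * M)"
          by (intro mult_left_mono) auto
        also have "\<dots> = M" by (simp del: of_nat_Suc)
        finally have "norm (q m x) \<le> M" unfolding q_def norm_scaleR abs_of_nat .
        then show ?thesis using True by simp
      next
        case False
        have "norm (?s *\<^sub>R v) \<le> norm v" using s by (simp add: mult_left_le_one_le del: of_nat_Suc)
        then have "norm x \<le> norm (?s *\<^sub>R v + x) + norm v" using norm_triangle_ineq4[of "?s *\<^sub>R v + x" "?s *\<^sub>R v"]
          by (simp del: of_nat_Suc)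
        moreover have "norm x > R + norm v" using False by (simp add: dist_norm)
        ultimately have "?s *\<^sub>R v + x \<notin> cball 0 R" "x \<notin> cball 0 R"
          using norm_ge_zero[of v] unfolding mem_cball_0 by linarith+
        then have "f (?s *\<^sub>R v + x) = 0" "f x = 0" using R K by blast+
        then show ?thesis using M by (simp add: q_def indicator_def del: of_nat_Suc)
      qed
    qed
  qed (use mf in \<open>auto simp: q_def[abs_def]\<close>)
  moreover have "(LINT x|lborel. q m x) = 0" for m
    unfolding q_def using trans[of "v /\<^sub>R real (Suc m)"] intf by simp
  ultimately have "(LINT x|lborel. f' x v) = 0" by (simp add: LIMSEQ_const_iff)
  then show "integrable lebesgue (\<lambda>x. f' x v)" "(LINT x|lebesgue. f' x v) = 0"
    using intf' mf by (auto simp: integral_completion integrable_completion)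
qed

section \<open>Square integrable functions and test functions\<close>

text \<open>The measure is a parameter because the Cauchy-Schwarz inequality is applied twice over:
  to Lebesgue measure on the configuration space and to \<open>lborel\<close> in the dilation
  parameter.\<close>

definition square_integrable :: "'a measure \<Rightarrow> ('a \<Rightarrow> complex) \<Rightarrow> bool" where
  "square_integrable M f \<longleftrightarrow> f \<in> borel_measurable M \<and> integrable M (\<lambda>x. (cmod (f x))\<^sup>2)"

definition sqnorm :: "'a measure \<Rightarrow> ('a \<Rightarrow> complex) \<Rightarrow> real" where
  "sqnorm M f = (LINT x|M. (cmod (f x))\<^sup>2)"

lemma sqnorm_nonneg [simp]: "0 \<le> sqnorm M f"
  unfolding sqnorm_def by (rule integral_nonneg_AE) auto

lemma square_integrable_measurable [measurable_dest]: "square_integrable M f \<Longrightarrow> f \<in> borel_measurable M"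
  by (simp add: square_integrable_def)

lemma square_integrable_bound:
  assumes f: "square_integrable M f" and g: "g \<in> borel_measurable M"
    and le: "AE x in M. cmod (g x) \<le> c * cmod (f x)"
  shows "square_integrable M g" "sqnorm M g \<le> c\<^sup>2 * sqnorm M f"
proof -
  have i: "integrable M (\<lambda>x. c\<^sup>2 * (cmod (f x))\<^sup>2)" using f by (simp add: square_integrable_def)
  have le': "AE x in M. (cmod (g x))\<^sup>2 \<le> c\<^sup>2 * (cmod (f x))\<^sup>2"
    using le by eventually_elim (auto simp flip: power_mult_distrib intro!: power_mono)
  have ig: "integrable M (\<lambda>x. (cmod (g x))\<^sup>2)"
    by (rule Bochner_Integration.integrable_bound[OF i]) (use g le' in auto)
  then show "square_integrable M g" using g by (simp add: square_integrable_def)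
  have "sqnorm M g \<le> (LINT x|M. c\<^sup>2 * (cmod (f x))\<^sup>2)"
    unfolding sqnorm_def by (rule integral_mono_AE[OF ig i le'])
  then show "sqnorm M g \<le> c\<^sup>2 * sqnorm M f" by (simp add: sqnorm_def)
qed

lemma square_integrable_zero [simp]: "square_integrable M (\<lambda>x. 0)"
  by (simp add: square_integrable_def)

lemma square_integrable_mult_bounded:
  assumes "square_integrable M f" "h \<in> borel_measurable M" "\<And>x. cmod (h x) \<le> B"
  shows "square_integrable M (\<lambda>x. h x * f x)" "sqnorm M (\<lambda>x. h x * f x) \<le> B\<^sup>2 * sqnorm M f"
proof -
  have m: "(\<lambda>x. h x * f x) \<in> borel_measurable M" using assms square_integrable_measurable by auto
  have le: "AE x in M. cmod (h x * f x) \<le> B * cmod (f x)"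
    using assms(3) by (auto simp: norm_mult intro!: mult_right_mono)
  show "square_integrable M (\<lambda>x. h x * f x)" "sqnorm M (\<lambda>x. h x * f x) \<le> B\<^sup>2 * sqnorm M f"
    using square_integrable_bound[OF assms(1) m le] by auto
qed

lemma square_integrable_cmult:
  assumes "square_integrable M f"
  shows "square_integrable M (\<lambda>x. c * f x)"
  using square_integrable_mult_bounded(1)[OF assms, of "\<lambda>x. c" "cmod c"] by simp

lemma sqnorm_cmult: "sqnorm M (\<lambda>x. c * f x) = (cmod c)\<^sup>2 * sqnorm M f"
  by (simp add: sqnorm_def norm_mult power_mult_distrib)

lemma cmod_add_sq_le: "(cmod (a + b))\<^sup>2 \<le> 2 * (cmod a)\<^sup>2 + 2 * (cmod b)\<^sup>2"
proof -
  have "(cmod (a + b))\<^sup>2 \<le> (cmod a + cmod b)\<^sup>2" by (intro power_mono norm_triangle_ineq) simp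
  moreover have "0 \<le> (cmod a - cmod b)\<^sup>2" by simp
  ultimately show ?thesis by (simp add: power2_eq_square algebra_simps)
qed

lemma square_integrable_add:
  assumes f: "square_integrable M f" and g: "square_integrable M g"
  shows "square_integrable M (\<lambda>x. f x + g x)" "sqnorm M (\<lambda>x. f x + g x) \<le> 2 * sqnorm M f + 2 * sqnorm M g"
proof -
  note [measurable] = square_integrable_measurable[OF f] square_integrable_measurable[OF g]
  have i: "integrable M (\<lambda>x. 2 * (cmod (f x))\<^sup>2 + 2 * (cmod (g x))\<^sup>2)"
    using f g by (simp add: square_integrable_def)
  have ig: "integrable M (\<lambda>x. (cmod (f x + g x))\<^sup>2)"
    by (rule Bochner_Integration.integrable_bound[OF i]) (auto intro: cmod_add_sq_le)
  then show "square_integrable M (\<lambda>x. f x + g x)" by (simp add: square_integrable_def)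
  have "sqnorm M (\<lambda>x. f x + g x) \<le> (LINT x|M. 2 * (cmod (f x))\<^sup>2 + 2 * (cmod (g x))\<^sup>2)"
    unfolding sqnorm_def by (intro integral_mono ig i cmod_add_sq_le)
  then show "sqnorm M (\<lambda>x. f x + g x) \<le> 2 * sqnorm M f + 2 * sqnorm M g"
    using f g by (simp add: sqnorm_def square_integrable_def)
qed

lemma sqnorm_minus [simp]: "sqnorm M (\<lambda>x. - f x) = sqnorm M f"
  by (simp add: sqnorm_def)

lemma square_integrable_minus: "square_integrable M f \<Longrightarrow> square_integrable M (\<lambda>x. - f x)"
  by (simp add: square_integrable_def)

lemma square_integrable_diff:
  assumes f: "square_integrable M f" and g: "square_integrable M g"
  shows "square_integrable M (\<lambda>x. f x - g x)" "sqnorm M (\<lambda>x. f x - g x) \<le> 2 * sqnorm M f + 2 * sqnorm M g"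
  using square_integrable_add[OF f square_integrable_minus[OF g]] by simp_all

lemma borel_measurable_cnj [measurable]: "cnj \<in> borel_measurable borel"
  by (intro borel_measurable_continuous_onI continuous_intros)

lemma square_integrable_mult_integrable:
  assumes f: "square_integrable M f" and g: "square_integrable M g"
  shows "integrable M (\<lambda>x. cmod (f x) * cmod (g x))" "integrable M (\<lambda>x. f x * cnj (g x))" "integrable M (\<lambda>x. f x * g x)"
proof -
  note [measurable] = square_integrable_measurable[OF f] square_integrable_measurable[OF g]
  have i: "integrable M (\<lambda>x. (cmod (f x))\<^sup>2 + (cmod (g x))\<^sup>2)" using f g by (simp add: square_integrable_def)
  have le: "cmod a * cmod b \<le> (cmod a)\<^sup>2 + (cmod b)\<^sup>2" for a b
  proof -
    have "0 \<le> cmod a * cmod b" by simp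
    moreover have "2 * (cmod a * cmod b) \<le> (cmod a)\<^sup>2 + (cmod b)\<^sup>2"
      using sum_squares_bound[of "cmod a" "cmod b"] by (simp add: mult.assoc)
    ultimately show ?thesis by linarith
  qed
  show "integrable M (\<lambda>x. cmod (f x) * cmod (g x))"
    by (rule Bochner_Integration.integrable_bound[OF i]) (auto intro: le)
  show "integrable M (\<lambda>x. f x * cnj (g x))"
    by (rule Bochner_Integration.integrable_bound[OF i]) (auto simp: norm_mult intro: le)
  show "integrable M (\<lambda>x. f x * g x)"
    by (rule Bochner_Integration.integrable_bound[OF i]) (auto simp: norm_mult intro: le)
qed

lemma integral_cmod_mult_le:
  assumes f: "square_integrable M f" and g: "square_integrable M g"
  shows "(LINT x|M. cmod (f x) * cmod (g x)) \<le> sqrt (sqnorm M f) * sqrt (sqnorm M g)"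
proof -
  define P where "P = (LINT x|M. cmod (f x) * cmod (g x))"
  note i = square_integrable_mult_integrable(1)[OF f g]
  have fi: "integrable M (\<lambda>x. (cmod (f x))\<^sup>2)" and gi: "integrable M (\<lambda>x. (cmod (g x))\<^sup>2)"
    using f g by (auto simp: square_integrable_def)
  have q: "0 \<le> sqnorm M f - 2 * t * P + t\<^sup>2 * sqnorm M g" for t
  proof -
    have "0 \<le> (LINT x|M. (cmod (f x) - t * cmod (g x))\<^sup>2)" by (rule integral_nonneg_AE) auto
    also have "(\<lambda>x. (cmod (f x) - t * cmod (g x))\<^sup>2) =
       (\<lambda>x. (cmod (f x))\<^sup>2 - (2 * t) * (cmod (f x) * cmod (g x)) + t\<^sup>2 * (cmod (g x))\<^sup>2)"
      by (auto simp: power2_eq_square algebra_simps)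
    also have "(LINT x|M. (cmod (f x))\<^sup>2 - (2 * t) * (cmod (f x) * cmod (g x)) + t\<^sup>2 * (cmod (g x))\<^sup>2)
       = sqnorm M f - 2 * t * P + t\<^sup>2 * sqnorm M g"
      using i fi gi by (simp add: sqnorm_def P_def)
    finally show ?thesis .
  qed
  have "P\<^sup>2 \<le> sqnorm M f * sqnorm M g"
  proof (cases "sqnorm M g = 0")
    case True
    have "P = 0"
    proof (rule ccontr)
      assume "P \<noteq> 0"
      \<comment> \<open>With vanishing quadratic coefficient the polynomial is affine in t, and at
        this t it equals -1.\<close>
      then show False using q[of "(sqnorm M f + 1) / (2 * P)"] True by simp
    qed
    then show ?thesis using True by simp
  next
    case False
    then have "sqnorm M g > 0" using sqnorm_nonneg[of M g] by linarith
    \<comment> \<open>The minimizer of the quadratic polynomial.\<close>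
    then show ?thesis using q[of "P / sqnorm M g"] by (simp add: field_simps power2_eq_square)
  qed
  then have "P \<le> sqrt (sqnorm M f * sqnorm M g)" by (rule real_le_rsqrt)
  then show ?thesis by (simp add: P_def real_sqrt_mult)
qed

lemma cmod_integral_mult_le:
  assumes f: "square_integrable M f" and g: "square_integrable M g"
  shows "cmod (LINT x|M. f x * cnj (g x)) \<le> sqrt (sqnorm M f) * sqrt (sqnorm M g)"
proof -
  have "cmod (LINT x|M. f x * cnj (g x)) \<le> (LINT x|M. cmod (f x * cnj (g x)))" by (rule integral_norm_bound)
  also have "\<dots> = (LINT x|M. cmod (f x) * cmod (g x))" by (simp add: norm_mult)
  also have "\<dots> \<le> sqrt (sqnorm M f) * sqrt (sqnorm M g)" by (rule integral_cmod_mult_le[OF f g])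
  finally show ?thesis .
qed

lemma complex_of_real_sqnorm: "complex_of_real (sqnorm M f) = (LINT x|M. f x * cnj (f x))"
  unfolding sqnorm_def integral_complex_of_real[symmetric] by (intro Bochner_Integration.integral_cong) (simp_all only: complex_norm_square)

lemma sqnorm_cong_AE:
  assumes "f \<in> borel_measurable M" "g \<in> borel_measurable M" "AE x in M. f x = g x"
  shows "sqnorm M f = sqnorm M g"
  unfolding sqnorm_def by (rule integral_cong_AE) (use assms in auto)

lemma sqnorm_eq_0_iff:
  assumes "square_integrable M f"
  shows "sqnorm M f = 0 \<longleftrightarrow> (AE x in M. f x = 0)"
  using integral_nonneg_eq_0_iff_AE[of M "\<lambda>x. (cmod (f x))\<^sup>2"] assms by (simp add: sqnorm_def square_integrable_def)

text \<open>Square integrability of the terms and of the limit is part of the notion, so the limit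
  rules below can be chained without separate integrability conditions.\<close>

definition l2_tendsto :: "'a measure \<Rightarrow> (nat \<Rightarrow> 'a \<Rightarrow> complex) \<Rightarrow> ('a \<Rightarrow> complex) \<Rightarrow> bool" where
  "l2_tendsto M F f \<longleftrightarrow> (\<forall>n. square_integrable M (F n)) \<and> square_integrable M f \<and>
     (\<lambda>n. sqnorm M (\<lambda>x. F n x - f x)) \<longlonglongrightarrow> 0"

lemma l2_tendsto_add:
  assumes "l2_tendsto M F f" "l2_tendsto M G g"
  shows "l2_tendsto M (\<lambda>n x. F n x + G n x) (\<lambda>x. f x + g x)"
proof -
  have s: "square_integrable M (F n)" "square_integrable M f" "square_integrable M (G n)" "square_integrable M g" for n
    using assms by (auto simp: l2_tendsto_def)
  have "(\<lambda>n. 2 * sqnorm M (\<lambda>x. F n x - f x) + 2 * sqnorm M (\<lambda>x. G n x - g x)) \<longlonglongrightarrow> 2 * 0 + 2 * 0"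
    using assms by (intro tendsto_intros) (auto simp: l2_tendsto_def)
  then have l: "(\<lambda>n. 2 * sqnorm M (\<lambda>x. F n x - f x) + 2 * sqnorm M (\<lambda>x. G n x - g x)) \<longlonglongrightarrow> 0" by simp
  have "(\<lambda>n. sqnorm M (\<lambda>x. (F n x + G n x) - (f x + g x))) \<longlonglongrightarrow> 0"
  proof (rule Lim_null_comparison[OF _ l])
    show "\<forall>\<^sub>F n in sequentially. norm (sqnorm M (\<lambda>x. (F n x + G n x) - (f x + g x))) \<le>
      2 * sqnorm M (\<lambda>x. F n x - f x) + 2 * sqnorm M (\<lambda>x. G n x - g x)"
      using square_integrable_add(2)[OF square_integrable_diff(1)[OF s(1,2)] square_integrable_diff(1)[OF s(3,4)]]
      by (auto simp: algebra_simps intro!: always_eventually)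
  qed
  then show ?thesis using s by (auto simp: l2_tendsto_def intro: square_integrable_add)
qed

lemma l2_tendsto_mult_bounded:
  assumes "l2_tendsto M F f" "h \<in> borel_measurable M" "\<And>x. cmod (h x) \<le> B"
  shows "l2_tendsto M (\<lambda>n x. h x * F n x) (\<lambda>x. h x * f x)"
proof -
  have s: "square_integrable M (F n)" "square_integrable M f" for n
    using assms by (auto simp: l2_tendsto_def)
  have "(\<lambda>n. B\<^sup>2 * sqnorm M (\<lambda>x. F n x - f x)) \<longlonglongrightarrow> B\<^sup>2 * 0"
    using assms by (intro tendsto_intros) (auto simp: l2_tendsto_def)
  then have l: "(\<lambda>n. B\<^sup>2 * sqnorm M (\<lambda>x. F n x - f x)) \<longlonglongrightarrow> 0" by simp
  have "(\<lambda>n. sqnorm M (\<lambda>x. h x * F n x - h x * f x)) \<longlonglongrightarrow> 0"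
  proof (rule Lim_null_comparison[OF _ l])
    show "\<forall>\<^sub>F n in sequentially. norm (sqnorm M (\<lambda>x. h x * F n x - h x * f x)) \<le> B\<^sup>2 * sqnorm M (\<lambda>x. F n x - f x)"
      using square_integrable_mult_bounded(2)[OF square_integrable_diff(1)[OF s] assms(2,3)]
      by (auto simp: algebra_simps intro!: always_eventually)
  qed
  then show ?thesis using s assms(2,3) by (auto simp: l2_tendsto_def intro: square_integrable_mult_bounded)
qed

lemma l2_tendsto_cmult: "l2_tendsto M F f \<Longrightarrow> l2_tendsto M (\<lambda>n x. c * F n x) (\<lambda>x. c * f x)"
  by (rule l2_tendsto_mult_bounded[where B = "cmod c"]) auto

lemma l2_tendsto_diff:
  assumes "l2_tendsto M F f" "l2_tendsto M G g"
  shows "l2_tendsto M (\<lambda>n x. F n x - G n x) (\<lambda>x. f x - g x)"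
  using l2_tendsto_add[OF assms(1) l2_tendsto_cmult[OF assms(2), of "-1"]] by simp

lemma l2_tendsto_inner:
  assumes "l2_tendsto M F f" "l2_tendsto M G g"
  shows "(\<lambda>n. LINT x|M. F n x * cnj (G n x)) \<longlonglongrightarrow> (LINT x|M. f x * cnj (g x))"
proof -
  have s: "square_integrable M (F n)" "square_integrable M f" "square_integrable M (G n)" "square_integrable M g" for n
    using assms by (auto simp: l2_tendsto_def)
  let ?a = "\<lambda>n. sqrt (sqnorm M (\<lambda>x. F n x - f x))" and ?b = "\<lambda>n. sqrt (sqnorm M (\<lambda>x. G n x - g x))"
  let ?A = "sqrt (sqnorm M f)" and ?B = "sqrt (sqnorm M g)"
  have "(\<lambda>n. ?a n * ?b n + ?a n * ?B + ?A * ?b n) \<longlonglongrightarrow> sqrt 0 * sqrt 0 + sqrt 0 * ?B + ?A * sqrt 0"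
    using assms by (intro tendsto_intros) (auto simp: l2_tendsto_def)
  then have l: "(\<lambda>n. ?a n * ?b n + ?a n * ?B + ?A * ?b n) \<longlonglongrightarrow> 0" by simp
  show ?thesis
  proof (rule LIM_zero_cancel, rule Lim_null_comparison[OF always_eventually l], rule allI)
    fix n
    note d = square_integrable_diff(1)[OF s(1,2), of n] square_integrable_diff(1)[OF s(3,4), of n]
    have "(LINT x|M. F n x * cnj (G n x)) - (LINT x|M. f x * cnj (g x)) =
       (LINT x|M. F n x * cnj (G n x) - f x * cnj (g x))"
      using s by (simp add: square_integrable_mult_integrable)
    also have "\<dots> = (LINT x|M. (F n x - f x) * cnj (G n x - g x) + (F n x - f x) * cnj (g x) + f x * cnj (G n x - g x))"
      by (intro Bochner_Integration.integral_cong) (auto simp: algebra_simps)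
    also have "\<dots> = (LINT x|M. (F n x - f x) * cnj (G n x - g x)) + (LINT x|M. (F n x - f x) * cnj (g x)) + (LINT x|M. f x * cnj (G n x - g x))"
      using s d by (simp only: square_integrable_mult_integrable Bochner_Integration.integral_add Bochner_Integration.integrable_add)
    finally have "norm ((LINT x|M. F n x * cnj (G n x)) - (LINT x|M. f x * cnj (g x))) \<le>
      cmod (LINT x|M. (F n x - f x) * cnj (G n x - g x)) + cmod (LINT x|M. (F n x - f x) * cnj (g x)) + cmod (LINT x|M. f x * cnj (G n x - g x))"
      by (simp only:) (meson norm_triangle_ineq norm_triangle_mono order_refl)
    also have "\<dots> \<le> ?a n * ?b n + ?a n * ?B + ?A * ?b n"
      by (intro add_mono cmod_integral_mult_le d s)
    finally show "norm ((LINT x|M. F n x * cnj (G n x)) - (LINT x|M. f x * cnj (g x))) \<le> ?a n * ?b n + ?a n * ?B + ?A * ?b n" .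
  qed
qed

lemma l2_tendsto_const: "square_integrable M f \<Longrightarrow> l2_tendsto M (\<lambda>n. f) f"
  by (simp add: l2_tendsto_def sqnorm_def)

lemma l2_tendsto_sqnorm:
  assumes "l2_tendsto M F f"
  shows "(\<lambda>n. sqnorm M (F n)) \<longlonglongrightarrow> sqnorm M f"
  using tendsto_Re[OF l2_tendsto_inner[OF assms assms]] unfolding complex_of_real_sqnorm[symmetric] by simp

lemma square_integrable_continuous_compact_support:
  fixes f :: "'a::euclidean_space \<Rightarrow> complex"
  assumes "continuous_on UNIV f" "compact K" "\<And>x. x \<notin> K \<Longrightarrow> f x = 0"
  shows "square_integrable lebesgue f"
proof -
  have m: "f \<in> borel_measurable borel" using assms(1) by (rule borel_measurable_continuous_onI)
  have "integrable lborel (\<lambda>x. indicator K x *\<^sub>R (cmod (f x))\<^sup>2)"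
    by (rule borel_integrable_compact[OF assms(2)]) (intro continuous_intros continuous_on_subset[OF assms(1)] subset_UNIV)
  also have "(\<lambda>x. indicator K x *\<^sub>R (cmod (f x))\<^sup>2) = (\<lambda>x. (cmod (f x))\<^sup>2)"
    using assms(3) by (auto simp: indicator_def fun_eq_iff)
  finally show ?thesis using m by (auto simp: square_integrable_def integrable_completion measurable_completion)
qed

section \<open>Test functions and the fundamental lemma of the calculus of variations\<close>

lemma test_functionsI:
  assumes "\<And>k. Ck_on k UNIV \<phi>" "{x. \<phi> x \<noteq> 0} \<subseteq> K" "compact K" "K \<subseteq> \<Omega>"
  shows "\<phi> \<in> test_functions \<Omega>"
proof -
  have "closure {x. \<phi> x \<noteq> 0} \<subseteq> K" using assms(2,3) by (simp add: closure_minimal compact_imp_closed)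
  moreover have "bounded {x. \<phi> x \<noteq> 0}" using assms(2,3) bounded_subset compact_imp_bounded by metis
  ultimately show ?thesis using assms(1,4) by (auto simp: test_functions_def smooth_on_def)
qed

lemma test_functions_smooth:
  assumes "\<phi> \<in> test_functions \<Omega>" shows "Ck_on k UNIV \<phi>"
  using assms by (auto simp: test_functions_def smooth_on_def)

lemma test_functions_outside:
  assumes "\<phi> \<in> test_functions \<Omega>"
  shows "x \<notin> closure {x. \<phi> x \<noteq> 0} \<Longrightarrow> \<phi> x = 0" and "compact (closure {x. \<phi> x \<noteq> 0})"
    and "x \<notin> \<Omega> \<Longrightarrow> \<phi> x = 0"
  using assms closure_subset[of "{x. \<phi> x \<noteq> 0}"] by (auto simp: test_functions_def)

lemma test_functions_derivative:
  assumes "\<phi> \<in> test_functions \<Omega>"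
  shows "(\<phi> has_derivative frechet_derivative \<phi> (at x)) (at x)"
  using Ck_on_Suc_derivative(1)[OF test_functions_smooth[OF assms, of "Suc 0"]] .

lemma test_functions_derivative_test:
  assumes "\<phi> \<in> test_functions \<Omega>"
  shows "(\<lambda>x. frechet_derivative \<phi> (at x) v) \<in> test_functions \<Omega>"
proof -
  have "Ck_on k UNIV (\<lambda>x. frechet_derivative \<phi> (at x) v)" for k
    using Ck_on_Suc_derivative(2)[OF test_functions_smooth[OF assms, of "Suc k"]] .
  moreover have "{x. frechet_derivative \<phi> (at x) v \<noteq> 0} \<subseteq> closure {x. \<phi> x \<noteq> 0}"
  proof (rule ccontr)
    assume "\<not> {x. frechet_derivative \<phi> (at x) v \<noteq> 0} \<subseteq> closure {x. \<phi> x \<noteq> 0}"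
    then obtain x where x: "frechet_derivative \<phi> (at x) v \<noteq> 0" "x \<notin> closure {x. \<phi> x \<noteq> 0}" by blast
    have "((\<lambda>x. 0) has_derivative frechet_derivative \<phi> (at x)) (at x)"
    proof (rule has_derivative_transform_within_open[OF test_functions_derivative[OF assms]])
      show "open (- closure {x. \<phi> x \<noteq> 0})" by (rule open_Compl[OF closed_closure])
      show "x \<in> - closure {x. \<phi> x \<noteq> 0}" using x(2) by simp
      show "\<phi> y = 0" if "y \<in> - closure {x. \<phi> x \<noteq> 0}" for y
        using test_functions_outside(1)[OF assms] that by blast
    qed
    then have "frechet_derivative \<phi> (at x) = (\<lambda>v. 0)" by (rule has_derivative_unique) simp
    then show False using x by simp
  qed
  ultimately show ?thesis
    by (rule test_functionsI) (use assms in \<open>auto simp: test_functions_def\<close>)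
qed

lemma test_functions_square_integrable:
  assumes "\<phi> \<in> test_functions \<Omega>" shows "square_integrable lebesgue \<phi>"
  using square_integrable_continuous_compact_support[OF Ck_on_continuous[OF test_functions_smooth[OF assms, of 0]] test_functions_outside(2,1)[OF assms]] .

lemma test_functions_mult_smooth:
  fixes \<theta> :: "'a::euclidean_space \<Rightarrow> complex"
  assumes "\<phi> \<in> test_functions \<Omega>" and "\<And>k. Ck_on k UNIV \<theta>"
  shows "(\<lambda>x. \<theta> x * \<phi> x) \<in> test_functions \<Omega>"
proof (rule test_functionsI)
  show "Ck_on k UNIV (\<lambda>x. \<theta> x * \<phi> x)" for k
    by (intro Ck_on_mult assms(2) test_functions_smooth[OF assms(1)])
  show "{x. \<theta> x * \<phi> x \<noteq> 0} \<subseteq> closure {x. \<phi> x \<noteq> 0}" using closure_subset[of "{x. \<phi> x \<noteq> 0}"] by auto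
qed (use assms in \<open>auto simp: test_functions_def\<close>)

text \<open>As n grows these functions increase to the indicator of \<open>box a b\<close>: the
  exponent tends to minus infinity exactly where the bump is positive.\<close>

lemma box_approximation_test:
  assumes "cbox a b \<subseteq> \<Omega>"
  shows "(\<lambda>x. complex_of_real (1 - exp (- real n * box_bump a b x))) \<in> test_functions \<Omega>"
proof -
  have k: "Ck_on k UNIV (\<lambda>x. complex_of_real (1 + (-1) * exp ((- real n) * box_bump a b x)))" for k
    by (intro Ck_on_linear_compose[OF bounded_linear_of_real] Ck_on_add Ck_on_mult Ck_on_const Ck_on_exp Ck_on_box_bump)
  show ?thesis
  proof (rule test_functionsI[OF _ _ compact_cbox assms])
    show "{x. complex_of_real (1 - exp (- real n * box_bump a b x)) \<noteq> 0} \<subseteq> cbox a b"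
    proof
      fix x assume "x \<in> {x. complex_of_real (1 - exp (- real n * box_bump a b x)) \<noteq> 0}"
      then have "box_bump a b x \<noteq> 0" by auto
      then show "x \<in> cbox a b" using box_bump_pos_iff[of a b x] box_bump_nonneg[of a b x] box_subset_cbox[of a b] by force
    qed
  qed (use k in simp)
qed

text \<open>Orthogonality passes from the smooth approximations to indicators of open boxes by
  dominated convergence, then to Borel subsets of a box by the pi-lambda theorem, and then to
  Lebesgue subsets. Hence f vanishes almost everywhere on each closed box in \<Omega>, and countably
  many such boxes cover \<Omega>.\<close>

lemma AE_zero_of_orthogonal_test_functions:
  fixes f :: "'a::euclidean_space \<Rightarrow> complex"
  assumes op: "open \<Omega>" and f: "square_integrable lebesgue f"
    and orth: "\<And>\<phi>. \<phi> \<in> test_functions \<Omega> \<Longrightarrow> (LINT x|lebesgue. f x * \<phi> x) = 0"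
  shows "AE x in lebesgue. x \<in> \<Omega> \<longrightarrow> f x = 0"
proof -
  have fm [measurable]: "f \<in> borel_measurable lebesgue" using f by (rule square_integrable_measurable)
  have ind: "integrable lebesgue (\<lambda>x. indicator (cbox a b) x *\<^sub>R f x)" for a b
  proof -
    have "square_integrable lebesgue (\<lambda>x. complex_of_real (indicator (cbox a b) x))"
    proof -
      have "integrable lborel (indicator (cbox a b) :: 'a \<Rightarrow> real)"
        using borel_integrable_compact[OF compact_cbox, of a b "\<lambda>x. 1 :: real"] by simp
      then have "integrable lebesgue (indicator (cbox a b) :: 'a \<Rightarrow> real)" by (subst integrable_completion) auto
      moreover have "(\<lambda>x. (cmod (complex_of_real (indicator (cbox a b) x)))\<^sup>2) = (indicator (cbox a b) :: 'a \<Rightarrow> real)"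
        by (auto simp: indicator_def)
      ultimately show ?thesis unfolding square_integrable_def by (simp only:) measurable
    qed
    from square_integrable_mult_integrable(3)[OF this f] show ?thesis by (simp add: scaleR_conv_of_real)
  qed
  have box0: "(LINT x|lebesgue. indicator (box a b) x *\<^sub>R f x) = 0" if sub: "cbox a b \<subseteq> \<Omega>" for a b
  proof -
    let ?\<phi> = "\<lambda>n x. complex_of_real (1 - exp (- real n * box_bump a b x))"
    have "(\<lambda>n. LINT x|lebesgue. f x * ?\<phi> n x) \<longlonglongrightarrow> (LINT x|lebesgue. indicator (box a b) x *\<^sub>R f x)"
    proof (rule integral_dominated_convergence)
      show "integrable lebesgue (\<lambda>x. norm (indicator (cbox a b) x *\<^sub>R f x))" using ind by (rule integrable_norm)
      show "(\<lambda>x. f x * ?\<phi> n x) \<in> borel_measurable lebesgue" for n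
        using square_integrable_measurable[OF test_functions_square_integrable[OF box_approximation_test[OF sub]], of n] by measurable
      show "(\<lambda>x. indicator (box a b) x *\<^sub>R f x) \<in> borel_measurable lebesgue"
        by (intro borel_measurable_scaleR borel_measurable_indicator fm) auto
      show "AE x in lebesgue. (\<lambda>n. f x * ?\<phi> n x) \<longlonglongrightarrow> indicator (box a b) x *\<^sub>R f x"
      proof (rule AE_I2)
        fix x
        show "(\<lambda>n. f x * ?\<phi> n x) \<longlonglongrightarrow> indicator (box a b) x *\<^sub>R f x"
        proof (cases "x \<in> box a b")
          case True
          then have P: "box_bump a b x > 0" by (simp add: box_bump_pos_iff)
          have "(\<lambda>n. exp (- box_bump a b x) ^ n) \<longlonglongrightarrow> 0" using P by (intro LIMSEQ_power_zero) auto
          then have "(\<lambda>n. exp (- real n * box_bump a b x)) \<longlonglongrightarrow> 0"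
            by (simp add: exp_of_nat_mult[symmetric])
          then have "(\<lambda>n. f x * ?\<phi> n x) \<longlonglongrightarrow> f x * complex_of_real (1 - 0)" by (intro tendsto_intros)
          then show ?thesis using True by simp
        next
          case False
          then have "box_bump a b x = 0" using box_bump_pos_iff[of a b x] box_bump_nonneg[of a b x] by auto
          then show ?thesis using False by simp
        qed
      qed
      show "AE x in lebesgue. norm (f x * ?\<phi> n x) \<le> norm (indicator (cbox a b) x *\<^sub>R f x)" for n
      proof (rule AE_I2)
        fix x
        have P: "box_bump a b x \<ge> 0" by (rule box_bump_nonneg)
        show "norm (f x * ?\<phi> n x) \<le> norm (indicator (cbox a b) x *\<^sub>R f x)"
        proof (cases "x \<in> cbox a b")
          case True
          have e: "exp (- real n * box_bump a b x) \<le> 1" using P by simp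
          have "cmod (?\<phi> n x) = 1 - exp (- real n * box_bump a b x)"
            using e unfolding norm_of_real by (simp only: abs_of_nonneg diff_ge_0_iff_ge)
          then have "cmod (?\<phi> n x) \<le> 1" by simp
          then show ?thesis using True mult_left_mono[of "cmod (?\<phi> n x)" 1 "cmod (f x)"] by (simp add: norm_mult)
        next
          case False
          then have "x \<notin> box a b" using box_subset_cbox by blast
          then have "box_bump a b x = 0" using box_bump_pos_iff[of a b x] P by auto
          then show ?thesis using False by simp
        qed
      qed
    qed
    then show ?thesis using orth[OF box_approximation_test[OF sub]] by (simp add: LIMSEQ_const_iff)
  qed
  have borel0: "(LINT x|lebesgue. indicator (S \<inter> box a b) x *\<^sub>R f x) = 0" if sub: "cbox a b \<subseteq> \<Omega>" and S: "S \<in> sets borel" for a b S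
  proof -
    have indS: "integrable lebesgue (\<lambda>x. indicator (A \<inter> box a b) x *\<^sub>R f x)" if "A \<in> sets borel" for A
    proof (rule Bochner_Integration.integrable_bound[OF ind[of a b]])
      show "(\<lambda>x. indicator (A \<inter> box a b) x *\<^sub>R f x) \<in> borel_measurable lebesgue"
        using that by (intro borel_measurable_scaleR borel_measurable_indicator fm) auto
    qed (use box_subset_cbox[of a b] in \<open>auto simp: indicator_def\<close>)
    \<comment> \<open>The pi-lambda theorem is used relative to the fixed \<open>box a b\<close>,
      since f is orthogonal only to functions supported in \<Omega>; intersecting a generator with
      this box gives again a box of the kind treated before.\<close>
    have Int: "Int_stable (range (\<lambda>(a::'a, b). box a b))" by (auto simp: Int_stable_def box_Int_box)
    have S': "S \<in> sigma_sets UNIV (range (\<lambda>(a::'a, b). box a b))" using S by (simp add: borel_eq_box)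
    have sb: "A \<in> sets borel" if "A \<in> sigma_sets UNIV (range (\<lambda>(a::'a, b). box a b))" for A
      using that by (simp add: borel_eq_box)
    have PU: "range (\<lambda>(a::'a, b). box a b) \<subseteq> Pow UNIV" by simp
    show ?thesis using Int PU S'
    proof (induction rule: sigma_sets_induct_disjoint)
      case (basic A)
      then obtain c d where A: "A = box c d" by auto
      let ?l = "\<Sum>i\<in>Basis. max (c\<bullet>i) (a\<bullet>i) *\<^sub>R i" and ?u = "\<Sum>i\<in>Basis. min (d\<bullet>i) (b\<bullet>i) *\<^sub>R i"
      have "cbox ?l ?u \<subseteq> cbox a b" by (auto simp: mem_box)
      then show ?case unfolding A box_Int_box using box0 sub by blast
    next
      case empty then show ?case by simp
    next
      case (compl A)
      have "(\<lambda>x. indicator ((UNIV - A) \<inter> box a b) x *\<^sub>R f x) = (\<lambda>x. indicator (UNIV \<inter> box a b) x *\<^sub>R f x - indicator (A \<inter> box a b) x *\<^sub>R f x)"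
        by (auto simp: indicator_def)
      then have "(LINT x|lebesgue. indicator ((UNIV - A) \<inter> box a b) x *\<^sub>R f x) =
          (LINT x|lebesgue. indicator (UNIV \<inter> box a b) x *\<^sub>R f x) - (LINT x|lebesgue. indicator (A \<inter> box a b) x *\<^sub>R f x)"
        using indS[of UNIV] indS[OF sb[OF compl(1)]] by simp
      then show ?case using compl(2) box0[OF sub] by simp
    next
      case (union A)
      have "(LINT x:(\<Union>i. A i \<inter> box a b)|lebesgue. f x) = (\<Sum>i. (LINT x:(A i \<inter> box a b)|lebesgue. f x))"
      proof (rule lebesgue_integral_countable_add)
        have "A i \<in> sets borel" for i using sb union(2) by blast
        then have Ai: "A i \<in> sets lebesgue" for i by simp
        show "A i \<inter> box a b \<in> sets lebesgue" for i by (intro sets.Int Ai) simp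
        show "i \<noteq> j \<Longrightarrow> A i \<inter> box a b \<inter> (A j \<inter> box a b) = {}" for i j
          using union(1) by (auto simp: disjoint_family_on_def)
        have "(\<Union>i. A i) \<in> sets borel" by (rule sets.countable_UN) (use sb union(2) in blast)
        from indS[OF this] show "set_integrable lebesgue (\<Union>i. A i \<inter> box a b) f" by (simp add: set_integrable_def)
      qed
      then show ?case using union(3) by (simp add: set_lebesgue_integral_def)
    qed
  qed
  have cb: "AE x in lebesgue. x \<in> cbox a b \<longrightarrow> f x = 0" if sub: "cbox a b \<subseteq> \<Omega>" for a b
  proof -
    let ?M = "lebesgue_on (cbox a b)"
    interpret finite_measure ?M by (rule finite_measure_lebesgue_on) simp
    have "AE x in ?M. f x = 0"
    proof (rule density_zero)
      show "integrable ?M f" using ind[of a b] by (simp add: integrable_restrict_space)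
      fix A assume "A \<in> sets ?M"
      then have A: "A \<in> sets lebesgue" "A \<subseteq> cbox a b" by (auto simp: sets_restrict_space)
      \<comment> \<open>A Lebesgue set differs from a Borel set by a null set, and the boundary of a
        box is null. So the integral over \<open>A\<close> equals the one over the Borel part within
        the open box.\<close>
      obtain S N N' where S: "A = S \<union> N" "N \<subseteq> N'" "N' \<in> null_sets lborel" "S \<in> sets lborel"
        using sets_completionE[OF A(1)] .
      have N': "N' \<in> null_sets lebesgue" using S(3) by (rule null_sets_completionI)
      have fr: "cbox a b - box a b \<in> null_sets lebesgue"
        using negligible_frontier_interval[of a b] by (simp add: negligible_iff_null_sets)
      have "set_lebesgue_integral ?M A f = (LINT x|lebesgue. indicator (cbox a b) x *\<^sub>R (indicator A x *\<^sub>R f x))"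
        unfolding set_lebesgue_integral_def by (subst integral_restrict_space) auto
      also have "\<dots> = (LINT x|lebesgue. indicator (S \<inter> box a b) x *\<^sub>R f x)"
      proof (rule integral_cong_AE)
        show "AE x in lebesgue. indicator (cbox a b) x *\<^sub>R (indicator A x *\<^sub>R f x) = indicator (S \<inter> box a b) x *\<^sub>R f x"
          using AE_not_in[OF N'] AE_not_in[OF fr]
          by eventually_elim (use S(1,2) A(2) box_subset_cbox[of a b] in \<open>auto simp: indicator_def\<close>)
        have S': "S \<in> sets lebesgue" using S(4) by simp
        show "(\<lambda>x. indicator (cbox a b) x *\<^sub>R (indicator A x *\<^sub>R f x)) \<in> borel_measurable lebesgue"
          by (intro borel_measurable_scaleR borel_measurable_indicator fm A(1)) simp
        show "(\<lambda>x. indicator (S \<inter> box a b) x *\<^sub>R f x) \<in> borel_measurable lebesgue"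
          by (intro borel_measurable_scaleR borel_measurable_indicator fm sets.Int S') simp
      qed
      also have "\<dots> = 0" using borel0[OF sub] S(4) by simp
      finally show "set_lebesgue_integral ?M A f = 0" .
    qed
    then show ?thesis by (simp add: AE_restrict_space_iff)
  qed
  obtain \<D> where D: "countable \<D>" "\<D> \<subseteq> Pow \<Omega>" "\<And>X. X \<in> \<D> \<Longrightarrow> \<exists>a b. X = cbox a b" "\<Union>\<D> = \<Omega>"
    using open_countable_Union_open_cbox[OF op] by metis
  have "AE x in lebesgue. \<forall>X\<in>\<D>. x \<in> X \<longrightarrow> f x = 0"
  proof (subst AE_ball_countable[OF D(1)], rule ballI)
    fix X assume X: "X \<in> \<D>"
    then obtain a b where "X = cbox a b" using D(3) by blast
    then show "AE x in lebesgue. x \<in> X \<longrightarrow> f x = 0" using cb[of a b] X D(2) by auto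
  qed
  then show ?thesis by eventually_elim (use D(4) in blast)
qed

section \<open>Weak derivatives and the space \<open>H10\<close>\<close>

text \<open>Moves functions on \<Omega> to the whole space, so that set integrals become plain
  integrals and a dilation acts on all functions of one type.\<close>

definition zero_extend :: "'a set \<Rightarrow> ('a \<Rightarrow> complex) \<Rightarrow> 'a \<Rightarrow> complex" where
  "zero_extend \<Omega> u x = indicator \<Omega> x *\<^sub>R u x"

lemma zero_extend_diff:
  "zero_extend \<Omega> (\<lambda>x. u x - v x) = (\<lambda>x. zero_extend \<Omega> u x - zero_extend \<Omega> v x)"
  by (auto simp: zero_extend_def indicator_def fun_eq_iff)

lemma L2_iff_square_integrable: "u \<in> L2 \<Omega> \<longleftrightarrow> square_integrable lebesgue (zero_extend \<Omega> u)"
proof -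
  have "(\<lambda>x. (cmod (zero_extend \<Omega> u x))\<^sup>2) = (\<lambda>x. indicator \<Omega> x *\<^sub>R (cmod (u x))\<^sup>2)"
    by (auto simp: zero_extend_def indicator_def)
  then show ?thesis
    by (simp add: L2_def square_integrable_def set_borel_measurable_def set_integrable_def zero_extend_def[abs_def])
qed

lemma L2_norm_eq: "L2_norm \<Omega> u = sqrt (sqnorm lebesgue (zero_extend \<Omega> u))"
proof -
  have "(\<lambda>x. (cmod (zero_extend \<Omega> u x))\<^sup>2) = (\<lambda>x. indicator \<Omega> x *\<^sub>R (cmod (u x))\<^sup>2)"
    by (auto simp: zero_extend_def indicator_def)
  then show ?thesis by (simp add: L2_norm_def sqnorm_def set_lebesgue_integral_def)
qed

lemma L2_inner_eq: "L2_inner \<Omega> u v = (LINT x|lebesgue. zero_extend \<Omega> u x * cnj (zero_extend \<Omega> v x))"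
  unfolding L2_inner_def set_lebesgue_integral_def
  by (intro Bochner_Integration.integral_cong) (auto simp: zero_extend_def indicator_def)

lemma has_weak_partial_iff:
  "has_weak_partial \<Omega> b u g \<longleftrightarrow> square_integrable lebesgue (zero_extend \<Omega> g) \<and>
    (\<forall>\<phi>\<in>test_functions \<Omega>. (LINT x|lebesgue. zero_extend \<Omega> u x * frechet_derivative \<phi> (at x) b)
       = - (LINT x|lebesgue. zero_extend \<Omega> g x * \<phi> x))"
  unfolding has_weak_partial_def L2_iff_square_integrable set_lebesgue_integral_def
  by (simp add: zero_extend_def)

lemma zero_extend_test: "\<phi> \<in> test_functions \<Omega> \<Longrightarrow> zero_extend \<Omega> \<phi> = \<phi>"
  using test_functions_outside(3)[of \<phi> \<Omega>] by (auto simp: zero_extend_def indicator_def fun_eq_iff)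

lemma weak_partial_unique:
  assumes op: "open \<Omega>" and g: "has_weak_partial \<Omega> b u g" and h: "has_weak_partial \<Omega> b u h"
  shows "AE x in lebesgue. zero_extend \<Omega> g x = zero_extend \<Omega> h x"
proof -
  let ?g = "zero_extend \<Omega> g" and ?h = "zero_extend \<Omega> h"
  have s: "square_integrable lebesgue ?g" "square_integrable lebesgue ?h"
    using g h by (auto simp: has_weak_partial_iff)
  have "AE x in lebesgue. x \<in> \<Omega> \<longrightarrow> ?g x - ?h x = 0"
  proof (rule AE_zero_of_orthogonal_test_functions[OF op square_integrable_diff(1)[OF s]])
    fix \<phi> assume \<phi>: "\<phi> \<in> test_functions \<Omega>"
    have "(LINT x|lebesgue. (?g x - ?h x) * \<phi> x) = (LINT x|lebesgue. ?g x * \<phi> x - ?h x * \<phi> x)"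
      by (simp add: left_diff_distrib)
    also have "\<dots> = (LINT x|lebesgue. ?g x * \<phi> x) - (LINT x|lebesgue. ?h x * \<phi> x)"
      by (intro Bochner_Integration.integral_diff square_integrable_mult_integrable s test_functions_square_integrable[OF \<phi>])
    also have "\<dots> = 0" using g h \<phi> unfolding has_weak_partial_iff
      by (metis (no_types, lifting) cancel_comm_monoid_add_class.diff_cancel minus_minus)
    finally show "(LINT x|lebesgue. (?g x - ?h x) * \<phi> x) = 0" .
  qed
  then show ?thesis by eventually_elim (auto simp: zero_extend_def indicator_def)
qed

lemma weak_partial_eq_AE:
  assumes "open \<Omega>" "has_weak_partial \<Omega> b u g"
  shows "AE x in lebesgue. zero_extend \<Omega> (weak_partial \<Omega> b u) x = zero_extend \<Omega> g x"
    and "has_weak_partial \<Omega> b u (weak_partial \<Omega> b u)"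
proof -
  show "has_weak_partial \<Omega> b u (weak_partial \<Omega> b u)"
    unfolding weak_partial_def by (rule someI[of "has_weak_partial \<Omega> b u", OF assms(2)])
  then show "AE x in lebesgue. zero_extend \<Omega> (weak_partial \<Omega> b u) x = zero_extend \<Omega> g x"
    by (rule weak_partial_unique[OF assms(1) _ assms(2)])
qed

lemma has_weak_partial_diff:
  assumes u: "square_integrable lebesgue (zero_extend \<Omega> u)"
    and v: "square_integrable lebesgue (zero_extend \<Omega> v)"
    and g: "has_weak_partial \<Omega> b u g" and h: "has_weak_partial \<Omega> b v h"
  shows "has_weak_partial \<Omega> b (\<lambda>x. u x - v x) (\<lambda>x. g x - h x)"
proof -
  have s: "square_integrable lebesgue (zero_extend \<Omega> g)" "square_integrable lebesgue (zero_extend \<Omega> h)"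
    using g h by (auto simp: has_weak_partial_iff)
  have "(LINT x|lebesgue. (zero_extend \<Omega> u x - zero_extend \<Omega> v x) * frechet_derivative \<phi> (at x) b) =
    - (LINT x|lebesgue. (zero_extend \<Omega> g x - zero_extend \<Omega> h x) * \<phi> x)" if \<phi>: "\<phi> \<in> test_functions \<Omega>" for \<phi>
  proof -
    have sq: "square_integrable lebesgue \<phi>" "square_integrable lebesgue (\<lambda>x. frechet_derivative \<phi> (at x) b)"
      using \<phi> test_functions_derivative_test[OF \<phi>] by (auto intro: test_functions_square_integrable)
    have "(LINT x|lebesgue. zero_extend \<Omega> u x * frechet_derivative \<phi> (at x) b) = - (LINT x|lebesgue. zero_extend \<Omega> g x * \<phi> x)"
      "(LINT x|lebesgue. zero_extend \<Omega> v x * frechet_derivative \<phi> (at x) b) = - (LINT x|lebesgue. zero_extend \<Omega> h x * \<phi> x)"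
      using g h \<phi> by (auto simp: has_weak_partial_iff)
    then show ?thesis using u v s sq
      by (simp add: left_diff_distrib square_integrable_mult_integrable)
  qed
  then show ?thesis using s by (simp add: has_weak_partial_iff zero_extend_diff square_integrable_diff)
qed

lemma square_integrable_continuous_mult_test:
  assumes c: "continuous_on UNIV c" and \<phi>: "\<phi> \<in> test_functions \<Omega>"
  shows "square_integrable lebesgue (\<lambda>x. c x * \<phi> x)"
proof (rule square_integrable_continuous_compact_support)
  show "continuous_on UNIV (\<lambda>x. c x * \<phi> x)"
    by (intro continuous_intros c Ck_on_continuous[OF test_functions_smooth[OF \<phi>, of 0]])
  show "compact (closure {x. \<phi> x \<noteq> 0})" by (rule test_functions_outside(2)[OF \<phi>])
  show "c x * \<phi> x = 0" if "x \<notin> closure {x. \<phi> x \<noteq> 0}" for x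
    using test_functions_outside(1)[OF \<phi> that] by simp
qed

text \<open>The coefficient \<open>c\<close> need not be bounded here, as the product has compact
  support. It serves three times: as the constant 1 for weak derivatives, as a derivative of the
  Gaussian for the commutator, and as a component of a regularized unit field for the Coulomb
  bound.\<close>

lemma test_functions_integration_by_parts:
  fixes c :: "'a::euclidean_space \<Rightarrow> complex"
  assumes \<phi>: "\<phi> \<in> test_functions \<Omega>" and \<psi>: "\<psi> \<in> test_functions \<Omega>"
    and c: "\<And>x. (c has_derivative c' x) (at x)" "continuous_on UNIV (\<lambda>x. c' x b)"
  shows "(LINT x|lebesgue. c x * \<phi> x * cnj (frechet_derivative \<psi> (at x) b)) =
    - (LINT x|lebesgue. (c x * frechet_derivative \<phi> (at x) b + c' x b * \<phi> x) * cnj (\<psi> x))"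
proof -
  let ?d = "\<lambda>\<phi> x. frechet_derivative \<phi> (at x) b"
  have cc: "continuous_on UNIV c" using c(1) has_derivative_continuous continuous_at_imp_continuous_on by blast
  have ct: "continuous_on UNIV \<phi>" "continuous_on UNIV \<psi>" "continuous_on UNIV (?d \<phi>)" "continuous_on UNIV (?d \<psi>)"
    using \<phi> \<psi> test_functions_derivative_test[OF \<phi>] test_functions_derivative_test[OF \<psi>]
    by (auto intro!: Ck_on_continuous[OF test_functions_smooth[where k = 0]])
  let ?f' = "\<lambda>x v. (c x * \<phi> x) * cnj (frechet_derivative \<psi> (at x) v) +
     (c x * frechet_derivative \<phi> (at x) v + c' x v * \<phi> x) * cnj (\<psi> x)"
  have der: "((\<lambda>x. c x * \<phi> x * cnj (\<psi> x)) has_derivative ?f' x) (at x)" for x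
    by (rule has_derivative_mult[OF has_derivative_mult[OF c(1) test_functions_derivative[OF \<phi>]]
        bounded_linear.has_derivative[OF bounded_linear_cnj test_functions_derivative[OF \<psi>]]])
  have cf': "continuous_on UNIV (\<lambda>x. ?f' x b)" by (intro continuous_intros cc c(2) ct)
  have z: "(LINT x|lebesgue. ?f' x b) = 0"
  proof (rule integral_directional_derivative_compact_support(2)[where f' = ?f' and f = "\<lambda>x. c x * \<phi> x * cnj (\<psi> x)"])
    show "compact (closure {x. \<phi> x \<noteq> 0})" by (rule test_functions_outside(2)[OF \<phi>])
    show "c x * \<phi> x * cnj (\<psi> x) = 0" if "x \<notin> closure {x. \<phi> x \<noteq> 0}" for x
      using test_functions_outside(1)[OF \<phi> that] by simp
  qed (rule der cf')+
  have i1: "square_integrable lebesgue (\<lambda>x. c x * \<phi> x)"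
    by (rule square_integrable_continuous_mult_test[OF cc \<phi>])
  have i2: "square_integrable lebesgue (\<lambda>x. c x * ?d \<phi> x + c' x b * \<phi> x)"
    by (intro square_integrable_add(1) square_integrable_continuous_mult_test[OF cc test_functions_derivative_test[OF \<phi>]]
      square_integrable_continuous_mult_test[OF c(2) \<phi>])
  have "(LINT x|lebesgue. (c x * \<phi> x) * cnj (?d \<psi> x)) + (LINT x|lebesgue. (c x * ?d \<phi> x + c' x b * \<phi> x) * cnj (\<psi> x)) = 0"
    using z square_integrable_mult_integrable(2)[OF i1 test_functions_square_integrable[OF test_functions_derivative_test[OF \<psi>]]]
      square_integrable_mult_integrable(2)[OF i2 test_functions_square_integrable[OF \<psi>]] by simp
  then show ?thesis by (simp add: add_eq_0_iff)
qed

lemma test_functions_cnj: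
  assumes "\<phi> \<in> test_functions \<Omega>"
  shows "(\<lambda>x. cnj (\<phi> x)) \<in> test_functions \<Omega>"
    and "frechet_derivative (\<lambda>x. cnj (\<phi> x)) (at x) v = cnj (frechet_derivative \<phi> (at x) v)"
proof -
  show "(\<lambda>x. cnj (\<phi> x)) \<in> test_functions \<Omega>"
    using assms Ck_on_linear_compose[OF bounded_linear_cnj, of _ \<phi>] by (auto simp: test_functions_def smooth_on_def)
  have "frechet_derivative (\<lambda>x. cnj (\<phi> x)) (at x) = (\<lambda>v. cnj (frechet_derivative \<phi> (at x) v))"
    by (rule frechet_derivative_at[symmetric, OF bounded_linear.has_derivative[OF bounded_linear_cnj test_functions_derivative[OF assms]]])
  then show "frechet_derivative (\<lambda>x. cnj (\<phi> x)) (at x) v = cnj (frechet_derivative \<phi> (at x) v)" by simp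
qed

lemma has_weak_partial_test:
  assumes \<phi>: "\<phi> \<in> test_functions \<Omega>"
  shows "has_weak_partial \<Omega> b \<phi> (\<lambda>x. frechet_derivative \<phi> (at x) b)"
  unfolding has_weak_partial_iff zero_extend_test[OF \<phi>] zero_extend_test[OF test_functions_derivative_test[OF \<phi>]]
proof (intro conjI ballI)
  show "square_integrable lebesgue (\<lambda>x. frechet_derivative \<phi> (at x) b)"
    by (rule test_functions_square_integrable[OF test_functions_derivative_test[OF \<phi>]])
  fix \<psi> assume \<psi>: "\<psi> \<in> test_functions \<Omega>"
  show "(LINT x|lebesgue. \<phi> x * frechet_derivative \<psi> (at x) b) = - (LINT x|lebesgue. frechet_derivative \<phi> (at x) b * \<psi> x)"
    using test_functions_integration_by_parts[OF \<phi> test_functions_cnj(1)[OF \<psi>] has_derivative_const[of 1], of b]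
    by (simp add: test_functions_cnj(2)[OF \<psi>])
qed

text \<open>\<open>u\<close> and the family \<open>G\<close> are defined on the whole space: \<open>u\<close> is an element of \<open>H10 \<Omega>\<close>
  extended by zero and \<open>G\<close> consists of its weak partial derivatives.\<close>

definition h10_pair :: "'a::euclidean_space set \<Rightarrow> ('a \<Rightarrow> complex) \<Rightarrow> ('a \<Rightarrow> 'a \<Rightarrow> complex) \<Rightarrow> bool" where
  "h10_pair \<Omega> u G \<longleftrightarrow> (\<exists>\<phi>. (\<forall>n. \<phi> n \<in> test_functions \<Omega>) \<and> l2_tendsto lebesgue \<phi> u \<and>
     (\<forall>b\<in>Basis. l2_tendsto lebesgue (\<lambda>n x. frechet_derivative (\<phi> n) (at x) b) (G b)))"

lemma h10_pair_square_integrable: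
  assumes "h10_pair \<Omega> u G"
  shows "square_integrable lebesgue u" "b \<in> Basis \<Longrightarrow> square_integrable lebesgue (G b)"
  using assms by (auto simp: h10_pair_def l2_tendsto_def)

text \<open>The norm in \<open>H10\<close> contains \<open>weak_partial\<close> of the difference u
  - \<phi> n, which is an unrelated choice for every n. Uniqueness of weak derivatives identifies it
  almost everywhere with the difference of the derivatives, which is what \<open>h10_pair\<close>
  speaks of.\<close>

lemma h10_pair_H10:
  assumes op: "open \<Omega>" and u: "u \<in> H10 \<Omega>"
  shows "h10_pair \<Omega> (zero_extend \<Omega> u) (\<lambda>b. zero_extend \<Omega> (weak_partial \<Omega> b u))"
proof -
  obtain \<phi> where \<phi>: "\<And>n. \<phi> n \<in> test_functions \<Omega>"
    and lim: "(\<lambda>n. H1_norm \<Omega> (\<lambda>x. u x - \<phi> n x)) \<longlonglongrightarrow> 0"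
    using u unfolding H10_def by auto
  have H1: "u \<in> H1 \<Omega>" using u by (simp add: H10_def)
  then have su: "square_integrable lebesgue (zero_extend \<Omega> u)" by (simp add: H1_def L2_iff_square_integrable)
  have w: "has_weak_partial \<Omega> b u (weak_partial \<Omega> b u)" if "b \<in> Basis" for b
    using H1 that weak_partial_eq_AE(2)[OF op] by (auto simp: H1_def)
  have sw: "square_integrable lebesgue (zero_extend \<Omega> (weak_partial \<Omega> b u))" if "b \<in> Basis" for b
    using w[OF that] by (simp add: has_weak_partial_iff)
  \<comment> \<open>The squared distance is a sum of nonnegative terms, so it majorizes the error of
    the function and that of each derivative.\<close>
  define N where "N n = (H1_norm \<Omega> (\<lambda>x. u x - \<phi> n x))\<^sup>2" for n
  have N0: "N \<longlonglongrightarrow> 0" using tendsto_power[OF lim, of 2] by (simp add: N_def[abs_def])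
  have sp: "square_integrable lebesgue (\<phi> n)" "square_integrable lebesgue (\<lambda>x. frechet_derivative (\<phi> n) (at x) b)" for n b
    using \<phi> test_functions_derivative_test[OF \<phi>] by (auto intro: test_functions_square_integrable)
  have Neq: "N n = sqnorm lebesgue (zero_extend \<Omega> (\<lambda>x. u x - \<phi> n x)) +
     (\<Sum>b\<in>Basis. sqnorm lebesgue (zero_extend \<Omega> (weak_partial \<Omega> b (\<lambda>x. u x - \<phi> n x))))" for n
    unfolding N_def H1_norm_def L2_norm_eq by (simp add: sum_nonneg)
  have e0: "sqnorm lebesgue (zero_extend \<Omega> (\<lambda>x. u x - \<phi> n x)) = sqnorm lebesgue (\<lambda>x. \<phi> n x - zero_extend \<Omega> u x)" for n
    using zero_extend_test[OF \<phi>[of n]] by (simp add: sqnorm_def zero_extend_diff norm_minus_commute)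
  have eb: "sqnorm lebesgue (zero_extend \<Omega> (weak_partial \<Omega> b (\<lambda>x. u x - \<phi> n x))) =
     sqnorm lebesgue (\<lambda>x. frechet_derivative (\<phi> n) (at x) b - zero_extend \<Omega> (weak_partial \<Omega> b u) x)" if b: "b \<in> Basis" for b n
  proof -
    have "has_weak_partial \<Omega> b (\<lambda>x. u x - \<phi> n x) (\<lambda>x. weak_partial \<Omega> b u x - frechet_derivative (\<phi> n) (at x) b)"
      by (rule has_weak_partial_diff[OF su _ w[OF b] has_weak_partial_test[OF \<phi>]])
        (simp add: zero_extend_test[OF \<phi>] sp)
    from weak_partial_eq_AE[OF op this]
    have 1: "AE x in lebesgue. zero_extend \<Omega> (weak_partial \<Omega> b (\<lambda>x. u x - \<phi> n x)) x = zero_extend \<Omega> (weak_partial \<Omega> b u) x - frechet_derivative (\<phi> n) (at x) b"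
      and 2: "square_integrable lebesgue (zero_extend \<Omega> (weak_partial \<Omega> b (\<lambda>x. u x - \<phi> n x)))"
      using zero_extend_test[OF test_functions_derivative_test[OF \<phi>[of n], of b]]
      by (auto simp: zero_extend_diff has_weak_partial_iff)
    have "sqnorm lebesgue (zero_extend \<Omega> (weak_partial \<Omega> b (\<lambda>x. u x - \<phi> n x))) =
      sqnorm lebesgue (\<lambda>x. zero_extend \<Omega> (weak_partial \<Omega> b u) x - frechet_derivative (\<phi> n) (at x) b)"
      by (rule sqnorm_cong_AE[OF square_integrable_measurable[OF 2] square_integrable_measurable[OF square_integrable_diff(1)[OF sw[OF b] sp(2)]] 1])
    also have "\<dots> = sqnorm lebesgue (\<lambda>x. frechet_derivative (\<phi> n) (at x) b - zero_extend \<Omega> (weak_partial \<Omega> b u) x)"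
      by (simp add: sqnorm_def norm_minus_commute)
    finally show ?thesis .
  qed
  have le0: "sqnorm lebesgue (\<lambda>x. \<phi> n x - zero_extend \<Omega> u x) \<le> N n" for n
    unfolding Neq e0 by (simp add: sum_nonneg)
  have leb: "sqnorm lebesgue (\<lambda>x. frechet_derivative (\<phi> n) (at x) b - zero_extend \<Omega> (weak_partial \<Omega> b u) x) \<le> N n" if b: "b \<in> Basis" for b n
    unfolding eb[OF b, symmetric] Neq
    by (rule add_increasing[OF sqnorm_nonneg], rule member_le_sum) (use b in auto)
  show ?thesis unfolding h10_pair_def
  proof (intro exI[of _ \<phi>] conjI allI ballI)
    show "l2_tendsto lebesgue \<phi> (zero_extend \<Omega> u)" unfolding l2_tendsto_def
      using sp su Lim_null_comparison[OF always_eventually N0, of "\<lambda>n. sqnorm lebesgue (\<lambda>x. \<phi> n x - zero_extend \<Omega> u x)"] le0 by simp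
    fix b :: 'a assume b: "b \<in> Basis"
    show "l2_tendsto lebesgue (\<lambda>n x. frechet_derivative (\<phi> n) (at x) b) (zero_extend \<Omega> (weak_partial \<Omega> b u))" unfolding l2_tendsto_def
      using sp sw[OF b] Lim_null_comparison[OF always_eventually N0, of "\<lambda>n. sqnorm lebesgue (\<lambda>x. frechet_derivative (\<phi> n) (at x) b - zero_extend \<Omega> (weak_partial \<Omega> b u) x)"] leb[OF b] by simp
  qed (rule \<phi>)
qed

text \<open>Multiplication by the indicator of the complement is continuous in L2 and annihilates
  every term of the sequence, hence also the limit.\<close>

lemma l2_tendsto_AE_zero_outside:
  assumes op: "open \<Omega>" and F: "l2_tendsto lebesgue F f" and z: "\<And>n x. x \<notin> \<Omega> \<Longrightarrow> F n x = 0"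
  shows "AE x in lebesgue. zero_extend \<Omega> f x = f x"
proof -
  have "- \<Omega> \<in> sets lebesgue" using op by (simp add: borel_closed closed_Compl)
  then have m: "(\<lambda>x. complex_of_real (indicator (- \<Omega>) x)) \<in> borel_measurable lebesgue"
    by (intro measurable_compose[OF borel_measurable_indicator borel_measurable_of_real])
  have l: "l2_tendsto lebesgue (\<lambda>n x. complex_of_real (indicator (- \<Omega>) x) * F n x) (\<lambda>x. complex_of_real (indicator (- \<Omega>) x) * f x)"
    by (rule l2_tendsto_mult_bounded[OF F m, of 1]) (auto simp: indicator_def)
  have z': "(\<lambda>x. complex_of_real (indicator (- \<Omega>) x) * F n x) = (\<lambda>x. 0)" for n using z by (auto simp: indicator_def fun_eq_iff)
  have "sqnorm lebesgue (\<lambda>x::'a. 0) = 0" by (simp add: sqnorm_def)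
  then have "sqnorm lebesgue (\<lambda>x. complex_of_real (indicator (- \<Omega>) x) * f x) = 0"
    using l2_tendsto_sqnorm[OF l] unfolding z' by (simp only: LIMSEQ_const_iff)
  moreover have "square_integrable lebesgue (\<lambda>x. complex_of_real (indicator (- \<Omega>) x) * f x)" using l by (simp add: l2_tendsto_def)
  ultimately have "AE x in lebesgue. complex_of_real (indicator (- \<Omega>) x) * f x = 0" by (simp only: sqnorm_eq_0_iff)
  then show ?thesis by eventually_elim (auto simp: zero_extend_def indicator_def split: if_splits)
qed

lemma h10_pair_AE:
  assumes op: "open \<Omega>" and p: "h10_pair \<Omega> u G"
  shows "AE x in lebesgue. zero_extend \<Omega> u x = u x" "b \<in> Basis \<Longrightarrow> AE x in lebesgue. zero_extend \<Omega> (G b) x = G b x"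
proof -
  obtain \<phi> where \<phi>: "\<And>n. \<phi> n \<in> test_functions \<Omega>" and lu: "l2_tendsto lebesgue \<phi> u"
    and lG: "\<And>b. b \<in> Basis \<Longrightarrow> l2_tendsto lebesgue (\<lambda>n x. frechet_derivative (\<phi> n) (at x) b) (G b)"
    using p unfolding h10_pair_def by auto
  show "AE x in lebesgue. zero_extend \<Omega> u x = u x"
    by (rule l2_tendsto_AE_zero_outside[OF op lu]) (rule test_functions_outside(3)[OF \<phi>])
  show "AE x in lebesgue. zero_extend \<Omega> (G b) x = G b x" if "b \<in> Basis"
    by (rule l2_tendsto_AE_zero_outside[OF op lG[OF that]])
      (rule test_functions_outside(3)[OF test_functions_derivative_test[OF \<phi>]])
qed

lemma square_integrable_zero_extend:
  assumes "open \<Omega>" "square_integrable lebesgue f"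
  shows "square_integrable lebesgue (zero_extend \<Omega> f)"
proof (rule square_integrable_bound(1)[OF assms(2), of _ 1])
  have "\<Omega> \<in> sets lebesgue" using assms by simp
  then show "zero_extend \<Omega> f \<in> borel_measurable lebesgue"
    using square_integrable_measurable[OF assms(2)] unfolding zero_extend_def[abs_def]
    by (intro borel_measurable_scaleR borel_measurable_indicator)
qed (auto simp: zero_extend_def indicator_def)

text \<open>The converse passage: every pair built by dilating, truncating or subtracting is a
  legitimate element of the form domain, and its second component agrees with the derivatives that
  occur in the form.\<close>

lemma H10_h10_pair:
  assumes op: "open \<Omega>" and p: "h10_pair \<Omega> u G"
  shows "u \<in> H10 \<Omega>" "b \<in> Basis \<Longrightarrow> AE x in lebesgue. zero_extend \<Omega> (weak_partial \<Omega> b u) x = G b x"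
proof -
  obtain \<phi> where \<phi>: "\<And>n. \<phi> n \<in> test_functions \<Omega>" and lu: "l2_tendsto lebesgue \<phi> u"
    and lG: "\<And>b. b \<in> Basis \<Longrightarrow> l2_tendsto lebesgue (\<lambda>n x. frechet_derivative (\<phi> n) (at x) b) (G b)"
    using p unfolding h10_pair_def by auto
  have su: "square_integrable lebesgue u" and sG: "\<And>b. b \<in> Basis \<Longrightarrow> square_integrable lebesgue (G b)"
    using h10_pair_square_integrable[OF p] by auto
  have szu: "square_integrable lebesgue (zero_extend \<Omega> u)" using square_integrable_zero_extend[OF op su] .
  have AEu: "AE x in lebesgue. zero_extend \<Omega> u x = u x" using h10_pair_AE(1)[OF op p] .
  \<comment> \<open>Both sides of the weak identity are inner products with a fixed square
    integrable function, so the identity passes from \<phi> n to its L2 limit.\<close>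
  have w: "has_weak_partial \<Omega> b u (G b)" if b: "b \<in> Basis" for b
    unfolding has_weak_partial_iff
  proof (intro conjI ballI)
    show szG: "square_integrable lebesgue (zero_extend \<Omega> (G b))"
      using square_integrable_zero_extend[OF op sG[OF b]] .
    fix \<psi> assume \<psi>: "\<psi> \<in> test_functions \<Omega>"
    let ?\<psi>' = "\<lambda>x. frechet_derivative \<psi> (at x) b"
    have s\<psi>: "square_integrable lebesgue (\<lambda>x. cnj (\<psi> x))" "square_integrable lebesgue (\<lambda>x. cnj (?\<psi>' x))"
      by (rule test_functions_square_integrable[OF test_functions_cnj(1)[OF \<psi>]]
        test_functions_square_integrable[OF test_functions_cnj(1)[OF test_functions_derivative_test[OF \<psi>]]])+
    have m: "\<psi> \<in> borel_measurable lebesgue" "?\<psi>' \<in> borel_measurable lebesgue"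
      by (rule square_integrable_measurable[OF test_functions_square_integrable[OF \<psi>]]
        square_integrable_measurable[OF test_functions_square_integrable[OF test_functions_derivative_test[OF \<psi>]]])+
    have "(\<lambda>n. LINT x|lebesgue. \<phi> n x * ?\<psi>' x) \<longlonglongrightarrow> (LINT x|lebesgue. u x * ?\<psi>' x)"
      using l2_tendsto_inner[OF lu l2_tendsto_const[OF s\<psi>(2)]] by simp
    moreover have "(\<lambda>n. - (LINT x|lebesgue. frechet_derivative (\<phi> n) (at x) b * \<psi> x)) \<longlonglongrightarrow> - (LINT x|lebesgue. G b x * \<psi> x)"
      using tendsto_minus[OF l2_tendsto_inner[OF lG[OF b] l2_tendsto_const[OF s\<psi>(1)]]] by simp
    moreover have "(LINT x|lebesgue. \<phi> n x * ?\<psi>' x) = - (LINT x|lebesgue. frechet_derivative (\<phi> n) (at x) b * \<psi> x)" for n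
      using has_weak_partial_test[OF \<phi>[of n], of b] \<psi> zero_extend_test[OF \<phi>[of n]] zero_extend_test[OF test_functions_derivative_test[OF \<phi>[of n], of b]]
      by (simp add: has_weak_partial_iff)
    ultimately have "(LINT x|lebesgue. u x * ?\<psi>' x) = - (LINT x|lebesgue. G b x * \<psi> x)"
      using LIMSEQ_unique by simp
    moreover have "(LINT x|lebesgue. zero_extend \<Omega> u x * ?\<psi>' x) = (LINT x|lebesgue. u x * ?\<psi>' x)"
      by (rule integral_cong_AE) (use AEu m square_integrable_measurable[OF su] square_integrable_measurable[OF szu] in auto)
    moreover have "(LINT x|lebesgue. zero_extend \<Omega> (G b) x * \<psi> x) = (LINT x|lebesgue. G b x * \<psi> x)"
      by (rule integral_cong_AE) (use h10_pair_AE(2)[OF op p b] m square_integrable_measurable[OF sG[OF b]] square_integrable_measurable[OF szG] in auto)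
    ultimately show "(LINT x|lebesgue. zero_extend \<Omega> u x * ?\<psi>' x) = - (LINT x|lebesgue. zero_extend \<Omega> (G b) x * \<psi> x)" by simp
  qed
  show AEG: "AE x in lebesgue. zero_extend \<Omega> (weak_partial \<Omega> b u) x = G b x" if b: "b \<in> Basis" for b
    using weak_partial_eq_AE(1)[OF op w[OF b]] h10_pair_AE(2)[OF op p b] by eventually_elim simp
  have eqn: "(\<lambda>n. H1_norm \<Omega> (\<lambda>x. u x - \<phi> n x)) =
    (\<lambda>n. sqrt (sqnorm lebesgue (\<lambda>x. \<phi> n x - u x) + (\<Sum>b\<in>Basis. sqnorm lebesgue (\<lambda>x. frechet_derivative (\<phi> n) (at x) b - G b x))))"
  proof
    fix n
    have sp: "square_integrable lebesgue (\<phi> n)" "square_integrable lebesgue (\<lambda>x. frechet_derivative (\<phi> n) (at x) b)" for b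
      using \<phi> test_functions_derivative_test[OF \<phi>] by (auto intro: test_functions_square_integrable)
    have "sqnorm lebesgue (zero_extend \<Omega> (\<lambda>x. u x - \<phi> n x)) = sqnorm lebesgue (\<lambda>x. u x - \<phi> n x)"
    proof (rule sqnorm_cong_AE)
      show "AE x in lebesgue. zero_extend \<Omega> (\<lambda>x. u x - \<phi> n x) x = u x - \<phi> n x"
        using AEu by eventually_elim (simp add: zero_extend_diff zero_extend_test[OF \<phi>])
      show "zero_extend \<Omega> (\<lambda>x. u x - \<phi> n x) \<in> borel_measurable lebesgue" "(\<lambda>x. u x - \<phi> n x) \<in> borel_measurable lebesgue"
        by (intro square_integrable_measurable square_integrable_zero_extend op square_integrable_diff su sp)+
    qed
    then have 1: "sqnorm lebesgue (zero_extend \<Omega> (\<lambda>x. u x - \<phi> n x)) = sqnorm lebesgue (\<lambda>x. \<phi> n x - u x)"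
      by (simp add: sqnorm_def norm_minus_commute)
    have 2: "sqnorm lebesgue (zero_extend \<Omega> (weak_partial \<Omega> b (\<lambda>x. u x - \<phi> n x))) = sqnorm lebesgue (\<lambda>x. frechet_derivative (\<phi> n) (at x) b - G b x)"
      if b: "b \<in> Basis" for b
    proof -
      have wd: "has_weak_partial \<Omega> b (\<lambda>x. u x - \<phi> n x) (\<lambda>x. G b x - frechet_derivative (\<phi> n) (at x) b)"
        by (rule has_weak_partial_diff[OF szu _ w[OF b] has_weak_partial_test[OF \<phi>]])
          (simp add: zero_extend_test[OF \<phi>] sp)
      have "sqnorm lebesgue (zero_extend \<Omega> (weak_partial \<Omega> b (\<lambda>x. u x - \<phi> n x))) = sqnorm lebesgue (\<lambda>x. G b x - frechet_derivative (\<phi> n) (at x) b)"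
      proof (rule sqnorm_cong_AE)
        show "AE x in lebesgue. zero_extend \<Omega> (weak_partial \<Omega> b (\<lambda>x. u x - \<phi> n x)) x = G b x - frechet_derivative (\<phi> n) (at x) b"
          using weak_partial_eq_AE(1)[OF op wd] h10_pair_AE(2)[OF op p b]
          by eventually_elim (simp add: zero_extend_diff zero_extend_test[OF test_functions_derivative_test[OF \<phi>]])
        show "zero_extend \<Omega> (weak_partial \<Omega> b (\<lambda>x. u x - \<phi> n x)) \<in> borel_measurable lebesgue"
          using weak_partial_eq_AE(2)[OF op wd] by (auto simp: has_weak_partial_iff intro: square_integrable_measurable)
        show "(\<lambda>x. G b x - frechet_derivative (\<phi> n) (at x) b) \<in> borel_measurable lebesgue"
          by (intro square_integrable_measurable square_integrable_diff sG[OF b] sp)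
      qed
      then show ?thesis by (simp add: sqnorm_def norm_minus_commute)
    qed
    show "H1_norm \<Omega> (\<lambda>x. u x - \<phi> n x) = sqrt (sqnorm lebesgue (\<lambda>x. \<phi> n x - u x) + (\<Sum>b\<in>Basis. sqnorm lebesgue (\<lambda>x. frechet_derivative (\<phi> n) (at x) b - G b x)))"
      unfolding H1_norm_def L2_norm_eq by (simp add: 1 2)
  qed
  have "(\<lambda>n. sqrt (sqnorm lebesgue (\<lambda>x. \<phi> n x - u x) + (\<Sum>b\<in>Basis. sqnorm lebesgue (\<lambda>x. frechet_derivative (\<phi> n) (at x) b - G b x))))
     \<longlonglongrightarrow> sqrt (0 + (\<Sum>b\<in>(Basis::'a set). 0))"
    using lu lG by (intro tendsto_intros) (auto simp: l2_tendsto_def)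
  then have "(\<lambda>n. H1_norm \<Omega> (\<lambda>x. u x - \<phi> n x)) \<longlonglongrightarrow> 0" unfolding eqn by simp
  moreover have "u \<in> H1 \<Omega>" using szu w by (auto simp: H1_def L2_iff_square_integrable)
  ultimately show "u \<in> H10 \<Omega>" using \<phi> by (auto simp: H10_def)
qed

section \<open>Dilations\<close>

lemma l2_tendsto_dominated:
  assumes m: "\<And>n. F n \<in> borel_measurable M" "f \<in> borel_measurable M" and s: "square_integrable M s"
    and le: "\<And>n. AE x in M. cmod (F n x) \<le> cmod (s x)" and lim: "AE x in M. (\<lambda>n. F n x) \<longlonglongrightarrow> f x"
  shows "l2_tendsto M F f"
proof -
  have le1: "AE x in M. cmod (F n x) \<le> 1 * cmod (s x)" for n using le[of n] by simp
  have all: "AE x in M. \<forall>n. cmod (F n x) \<le> cmod (s x)" using le by (simp add: AE_all_countable)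
  have fle: "AE x in M. cmod (f x) \<le> 1 * cmod (s x)"
    using all lim
  proof eventually_elim
    case (elim x)
    then show ?case using LIMSEQ_le_const2[OF tendsto_norm[OF elim(2)], of "cmod (s x)"] by auto
  qed
  have sf: "square_integrable M f" by (rule square_integrable_bound(1)[OF s m(2) fle])
  have sF: "square_integrable M (F n)" for n by (rule square_integrable_bound(1)[OF s m(1) le1])
  have "(\<lambda>n. LINT x|M. (cmod (F n x - f x))\<^sup>2) \<longlonglongrightarrow> (LINT x|M. 0)"
  proof (rule integral_dominated_convergence)
    show "integrable M (\<lambda>x. 4 * (cmod (s x))\<^sup>2)" using s by (simp add: square_integrable_def)
    show "AE x in M. (\<lambda>n. (cmod (F n x - f x))\<^sup>2) \<longlonglongrightarrow> 0"
      using lim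
    proof eventually_elim
      case (elim x)
      have "(\<lambda>n. (cmod (F n x - f x))\<^sup>2) \<longlonglongrightarrow> (cmod (f x - f x))\<^sup>2"
        by (intro tendsto_intros elim)
      then show ?case by simp
    qed
    show "AE x in M. norm ((cmod (F n x - f x))\<^sup>2) \<le> 4 * (cmod (s x))\<^sup>2" for n
      using le[of n] fle
    proof eventually_elim
      case (elim x)
      have "cmod (F n x - f x) \<le> 2 * cmod (s x)" using elim norm_triangle_ineq4[of "F n x" "f x"] by simp
      then have "(cmod (F n x - f x))\<^sup>2 \<le> (2 * cmod (s x))\<^sup>2" by (intro power_mono) auto
      then show ?case by (simp add: power_mult_distrib)
    qed
  qed (use m in auto)
  then show ?thesis using sf sF by (simp add: l2_tendsto_def sqnorm_def)
qed

lemma l2_tendsto_sum: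
  assumes "\<And>i. i \<in> I \<Longrightarrow> l2_tendsto M (F i) (f i)"
  shows "l2_tendsto M (\<lambda>n x. \<Sum>i\<in>I. F i n x) (\<lambda>x. \<Sum>i\<in>I. f i x)"
  using assms by (induction I rule: infinite_finite_induct) (auto intro: l2_tendsto_const l2_tendsto_add)

section \<open>Scaling of Lebesgue measure and the unitary dilation\<close>

lemma lebesgue_scaling_density:
  assumes "c > 0"
  shows "(lebesgue :: 'a::euclidean_space measure) =
    density (distr lebesgue lebesgue ((*\<^sub>R) c)) (\<lambda>_. ennreal (c ^ DIM('a)))"
proof -
  have "(\<lambda>x::'a. 0 + (\<Sum>j\<in>Basis. (c * (x \<bullet> j)) *\<^sub>R j)) = (*\<^sub>R) c"
    unfolding scaleR_scaleR[symmetric] scaleR_sum_right[symmetric] euclidean_representation by auto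
  then show ?thesis using lebesgue_affine_euclidean[of "\<lambda>_::'a. c" 0] assms by (simp add: prod_constant)
qed

text \<open>Formulated for Lebesgue measurable integrands, because elements of \<open>L2\<close> are
  known to be measurable only in that sense. It is read off from Lebesgue measure being a multiple
  of its image under scaling.\<close>

lemma lebesgue_integral_scaling:
  fixes f :: "'a::euclidean_space \<Rightarrow> 'b::{banach, second_countable_topology}"
  assumes f: "f \<in> borel_measurable lebesgue" and l: "l > 0"
  shows "(LINT x|lebesgue. inverse (l ^ DIM('a)) *\<^sub>R f (x /\<^sub>R l)) = (LINT x|lebesgue. f x)"
    and "(\<lambda>x. f (x /\<^sub>R l)) \<in> borel_measurable lebesgue"
    and "integrable lebesgue f \<longleftrightarrow> integrable lebesgue (\<lambda>x. inverse (l ^ DIM('a)) *\<^sub>R f (x /\<^sub>R l))"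
proof -
  let ?T = "(*\<^sub>R) (inverse l) :: 'a \<Rightarrow> 'a"
  have T: "?T \<in> lebesgue \<rightarrow>\<^sub>M lebesgue" by (rule lebesgue_measurable_scaling)
  show m: "(\<lambda>x. f (x /\<^sub>R l)) \<in> borel_measurable lebesgue"
    using measurable_compose[OF T f] by simp
  have d: "(lebesgue :: 'a measure) = density (distr lebesgue lebesgue ?T) (\<lambda>_. ennreal (inverse (l ^ DIM('a))))"
    using lebesgue_scaling_density[of "inverse l"] l by (simp add: power_inverse)
  have fd: "f \<in> borel_measurable (distr lebesgue lebesgue ?T)" using f by simp
  have p: "0 \<le> inverse (l ^ DIM('a))" using l by simp
  have "(LINT x|lebesgue. f x) = (LINT x|density (distr lebesgue lebesgue ?T) (\<lambda>_. ennreal (inverse (l ^ DIM('a)))). f x)"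
    using d by simp
  also have "\<dots> = (LINT x|distr lebesgue lebesgue ?T. inverse (l ^ DIM('a)) *\<^sub>R f x)"
    by (rule integral_density[OF fd]) (use p in auto)
  also have "\<dots> = (LINT x|lebesgue. inverse (l ^ DIM('a)) *\<^sub>R f (x /\<^sub>R l))"
    by (rule integral_distr[OF T]) (use f in auto)
  finally show "(LINT x|lebesgue. inverse (l ^ DIM('a)) *\<^sub>R f (x /\<^sub>R l)) = (LINT x|lebesgue. f x)" ..
  have "integrable lebesgue f \<longleftrightarrow> integrable (density (distr lebesgue lebesgue ?T) (\<lambda>_. ennreal (inverse (l ^ DIM('a))))) f"
    using d by simp
  also have "\<dots> \<longleftrightarrow> integrable (distr lebesgue lebesgue ?T) (\<lambda>x. inverse (l ^ DIM('a)) *\<^sub>R f x)"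
    by (rule integrable_density[OF fd]) (use p in auto)
  also have "\<dots> \<longleftrightarrow> integrable lebesgue (\<lambda>x. inverse (l ^ DIM('a)) *\<^sub>R f (x /\<^sub>R l))"
    by (rule integrable_distr_eq[OF T]) (use f in auto)
  finally show "integrable lebesgue f \<longleftrightarrow> integrable lebesgue (\<lambda>x. inverse (l ^ DIM('a)) *\<^sub>R f (x /\<^sub>R l))" .
qed

definition dil :: "real \<Rightarrow> ('a::euclidean_space \<Rightarrow> complex) \<Rightarrow> 'a \<Rightarrow> complex" where
  "dil l f x = complex_of_real (l powr (- (DIM('a) / 2))) * f (x /\<^sub>R l)"

lemma cmod_dil_sq:
  fixes f :: "'a::euclidean_space \<Rightarrow> complex"
  assumes "l > 0"
  shows "(cmod (dil l f x))\<^sup>2 = inverse (l ^ DIM('a)) * (cmod (f (x /\<^sub>R l)))\<^sup>2"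
proof -
  have "(l powr (- (DIM('a) / 2)))\<^sup>2 = l powr (- real DIM('a))"
    using assms by (simp add: power2_eq_square flip: powr_add)
  also have "\<dots> = inverse (l ^ DIM('a))" using assms by (simp add: powr_minus powr_realpow)
  finally show ?thesis by (simp only: dil_def norm_mult norm_of_real power_mult_distrib power2_abs)
qed

lemma dil_square_integrable:
  fixes f :: "'a::euclidean_space \<Rightarrow> complex"
  assumes f: "square_integrable lebesgue f" and l: "l > 0"
  shows "square_integrable lebesgue (dil l f)" "sqnorm lebesgue (dil l f) = sqnorm lebesgue f"
proof -
  have m: "(\<lambda>x. (cmod (f x))\<^sup>2) \<in> borel_measurable lebesgue" using square_integrable_measurable[OF f] by measurable
  have md: "dil l f \<in> borel_measurable lebesgue"
    unfolding dil_def[abs_def] using lebesgue_integral_scaling(2)[OF square_integrable_measurable[OF f] l] by simp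
  show "square_integrable lebesgue (dil l f)" "sqnorm lebesgue (dil l f) = sqnorm lebesgue f"
    using lebesgue_integral_scaling(1,3)[OF m l] f md
    by (simp_all add: square_integrable_def sqnorm_def cmod_dil_sq[OF l])
qed

lemma dil_diff: "dil l (\<lambda>x. f x - g x) = (\<lambda>x. dil l f x - dil l g x)"
  by (simp add: dil_def fun_eq_iff algebra_simps)

lemma l2_tendsto_dil:
  assumes F: "l2_tendsto lebesgue F f" and l: "l > 0"
  shows "l2_tendsto lebesgue (\<lambda>n. dil l (F n)) (dil l f)"
proof -
  have s: "square_integrable lebesgue (F n)" "square_integrable lebesgue f" for n using F by (auto simp: l2_tendsto_def)
  have "sqnorm lebesgue (\<lambda>x. dil l (F n) x - dil l f x) = sqnorm lebesgue (\<lambda>x. F n x - f x)" for n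
    using dil_square_integrable(2)[OF square_integrable_diff(1)[OF s] l, of n] by (simp add: dil_diff)
  then show ?thesis using F dil_square_integrable(1)[OF s(1) l] dil_square_integrable(1)[OF s(2) l] by (auto simp: l2_tendsto_def)
qed

lemma dil_test_functions:
  fixes \<Omega> :: "'a::euclidean_space set"
  assumes \<phi>: "\<phi> \<in> test_functions \<Omega>" and l: "l > 0" and \<Omega>: "\<And>x. x \<in> \<Omega> \<Longrightarrow> l *\<^sub>R x \<in> \<Omega>"
  shows "dil l \<phi> \<in> test_functions \<Omega>"
    and "frechet_derivative (dil l \<phi>) (at x) v = complex_of_real (inverse l) * dil l (\<lambda>x. frechet_derivative \<phi> (at x) v) x"
proof -
  let ?K = "closure {x. \<phi> x \<noteq> 0}"
  have bl: "bounded_linear (\<lambda>x::'a. x /\<^sub>R l)" by (rule bounded_linear_scaleR_right)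
  show "dil l \<phi> \<in> test_functions \<Omega>"
  proof (rule test_functionsI)
    show "Ck_on k UNIV (dil l \<phi>)" for k
      unfolding dil_def[abs_def] by (intro Ck_on_mult Ck_on_const Ck_on_compose_linear[OF bl] test_functions_smooth[OF \<phi>])
    show "{x. dil l \<phi> x \<noteq> 0} \<subseteq> (*\<^sub>R) l ` ?K"
    proof
      fix x assume "x \<in> {x. dil l \<phi> x \<noteq> 0}"
      then have "\<phi> (x /\<^sub>R l) \<noteq> 0" by (simp add: dil_def)
      then have "x /\<^sub>R l \<in> ?K" using closure_subset[of "{x. \<phi> x \<noteq> 0}"] by auto
      then have "l *\<^sub>R (x /\<^sub>R l) \<in> (*\<^sub>R) l ` ?K" by (rule imageI)
      then show "x \<in> (*\<^sub>R) l ` ?K" using l by simp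
    qed
    show "compact ((*\<^sub>R) l ` ?K)" by (rule compact_scaling[OF test_functions_outside(2)[OF \<phi>]])
    show "(*\<^sub>R) l ` ?K \<subseteq> \<Omega>" using \<phi> \<Omega> by (auto simp: test_functions_def)
  qed
  let ?c = "complex_of_real (l powr (- (DIM('a) / 2)))"
  have "((\<lambda>x. \<phi> (x /\<^sub>R l)) has_derivative (\<lambda>v. frechet_derivative \<phi> (at (x /\<^sub>R l)) (v /\<^sub>R l))) (at x)"
    by (rule has_derivative_compose[OF bounded_linear_imp_has_derivative[OF bl] test_functions_derivative[OF \<phi>]])
  from has_derivative_mult_right[OF this, of ?c]
  have d: "(dil l \<phi> has_derivative (\<lambda>v. ?c * frechet_derivative \<phi> (at (x /\<^sub>R l)) (v /\<^sub>R l))) (at x)"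
    by (simp add: dil_def[abs_def])
  have lin: "linear (frechet_derivative \<phi> (at (x /\<^sub>R l)))"
    using test_functions_derivative[OF \<phi>] has_derivative_linear by blast
  show "frechet_derivative (dil l \<phi>) (at x) v = complex_of_real (inverse l) * dil l (\<lambda>x. frechet_derivative \<phi> (at x) v) x"
    unfolding frechet_derivative_at[OF d, symmetric] linear_scale[OF lin] dil_def scaleR_conv_of_real by simp
qed

section \<open>Operations on admissible pairs: differences, dilations, multipliers, integration by
  parts\<close>

lemma h10_pair_diff:
  assumes "h10_pair \<Omega> u G" "h10_pair \<Omega> v H"
  shows "h10_pair \<Omega> (\<lambda>x. u x - v x) (\<lambda>b x. G b x - H b x)"
proof -
  obtain \<phi> where \<phi>: "\<And>n. \<phi> n \<in> test_functions \<Omega>" "l2_tendsto lebesgue \<phi> u"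
    "\<And>b. b \<in> Basis \<Longrightarrow> l2_tendsto lebesgue (\<lambda>n x. frechet_derivative (\<phi> n) (at x) b) (G b)"
    using assms(1) unfolding h10_pair_def by auto
  obtain \<psi> where \<psi>: "\<And>n. \<psi> n \<in> test_functions \<Omega>" "l2_tendsto lebesgue \<psi> v"
    "\<And>b. b \<in> Basis \<Longrightarrow> l2_tendsto lebesgue (\<lambda>n x. frechet_derivative (\<psi> n) (at x) b) (H b)"
    using assms(2) unfolding h10_pair_def by auto
  have fd: "frechet_derivative (\<lambda>x. \<phi> n x - \<psi> n x) (at x) b = frechet_derivative (\<phi> n) (at x) b - frechet_derivative (\<psi> n) (at x) b" for n x b
    unfolding frechet_derivative_at[OF has_derivative_diff[OF test_functions_derivative[OF \<phi>(1)] test_functions_derivative[OF \<psi>(1)]], symmetric] ..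
  have t: "(\<lambda>x. \<phi> n x - \<psi> n x) \<in> test_functions \<Omega>" for n
  proof (rule test_functionsI)
    show "Ck_on k UNIV (\<lambda>x. \<phi> n x - \<psi> n x)" for k
      using Ck_on_add[OF test_functions_smooth[OF \<phi>(1)[of n], of k] Ck_on_mult[OF Ck_on_const[of k "-1"] test_functions_smooth[OF \<psi>(1)[of n], of k]]] by simp
    show "compact (closure {x. \<phi> n x \<noteq> 0} \<union> closure {x. \<psi> n x \<noteq> 0})"
      using test_functions_outside(2)[OF \<phi>(1)] test_functions_outside(2)[OF \<psi>(1)] by (rule compact_Un)
    show "{x. \<phi> n x - \<psi> n x \<noteq> 0} \<subseteq> closure {x. \<phi> n x \<noteq> 0} \<union> closure {x. \<psi> n x \<noteq> 0}"
    proof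
      fix x assume "x \<in> {x. \<phi> n x - \<psi> n x \<noteq> 0}"
      then have "\<phi> n x \<noteq> 0 \<or> \<psi> n x \<noteq> 0" by auto
      then show "x \<in> closure {x. \<phi> n x \<noteq> 0} \<union> closure {x. \<psi> n x \<noteq> 0}"
        using closure_subset[of "{x. \<phi> n x \<noteq> 0}"] closure_subset[of "{x. \<psi> n x \<noteq> 0}"] by blast
    qed
    show "closure {x. \<phi> n x \<noteq> 0} \<union> closure {x. \<psi> n x \<noteq> 0} \<subseteq> \<Omega>"
      using \<phi>(1)[of n] \<psi>(1)[of n] by (auto simp: test_functions_def)
  qed
  show ?thesis unfolding h10_pair_def
    by (rule exI[of _ "\<lambda>n x. \<phi> n x - \<psi> n x"]) (use \<phi> \<psi> t in \<open>simp add: fd l2_tendsto_diff\<close>)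
qed

lemma h10_pair_dil:
  fixes \<Omega> :: "'a::euclidean_space set"
  assumes "h10_pair \<Omega> u G" and l: "l > 0" and \<Omega>: "\<And>x. x \<in> \<Omega> \<Longrightarrow> l *\<^sub>R x \<in> \<Omega>"
  shows "h10_pair \<Omega> (dil l u) (\<lambda>b x. complex_of_real (inverse l) * dil l (G b) x)"
proof -
  obtain \<phi> where \<phi>: "\<And>n. \<phi> n \<in> test_functions \<Omega>" "l2_tendsto lebesgue \<phi> u"
    "\<And>b. b \<in> Basis \<Longrightarrow> l2_tendsto lebesgue (\<lambda>n x. frechet_derivative (\<phi> n) (at x) b) (G b)"
    using assms(1) unfolding h10_pair_def by auto
  show ?thesis unfolding h10_pair_def
    by (rule exI[of _ "\<lambda>n. dil l (\<phi> n)"])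
      (use \<phi> in \<open>simp add: dil_test_functions[OF \<phi>(1) l \<Omega>] l2_tendsto_dil[OF _ l] l2_tendsto_cmult del: of_real_inverse\<close>)
qed

lemma h10_pair_mult:
  fixes \<theta> :: "'a::euclidean_space \<Rightarrow> complex"
  assumes u: "h10_pair \<Omega> u G" and \<theta>: "\<And>k. Ck_on k UNIV \<theta>" and d: "\<And>x. (\<theta> has_derivative \<theta>' x) (at x)"
    and B: "\<And>x. cmod (\<theta> x) \<le> B" "\<And>x b. b \<in> Basis \<Longrightarrow> cmod (\<theta>' x b) \<le> B"
  shows "h10_pair \<Omega> (\<lambda>x. \<theta> x * u x) (\<lambda>b x. \<theta> x * G b x + \<theta>' x b * u x)"
proof -
  obtain \<phi> where \<phi>: "\<And>n. \<phi> n \<in> test_functions \<Omega>" "l2_tendsto lebesgue \<phi> u"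
    "\<And>b. b \<in> Basis \<Longrightarrow> l2_tendsto lebesgue (\<lambda>n x. frechet_derivative (\<phi> n) (at x) b) (G b)"
    using u unfolding h10_pair_def by auto
  have c: "continuous_on UNIV \<theta>" using Ck_on_continuous[OF \<theta>] .
  have \<theta>': "\<theta>' x = frechet_derivative \<theta> (at x)" for x by (rule frechet_derivative_at[OF d])
  have c': "continuous_on UNIV (\<lambda>x. \<theta>' x b)" for b
    unfolding \<theta>' by (rule Ck_on_continuous[OF Ck_on_Suc_derivative(2)[OF \<theta>[of "Suc 0"]]])
  have m: "\<theta> \<in> borel_measurable lebesgue" "(\<lambda>x. \<theta>' x b) \<in> borel_measurable lebesgue" for b
    using c c' by (auto intro!: measurable_completion borel_measurable_continuous_onI)
  have fd: "frechet_derivative (\<lambda>x. \<theta> x * \<phi> n x) (at x) b = \<theta> x * frechet_derivative (\<phi> n) (at x) b + \<theta>' x b * \<phi> n x" for n x b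
    unfolding frechet_derivative_at[OF has_derivative_mult[OF d test_functions_derivative[OF \<phi>(1)]], symmetric] ..
  have "l2_tendsto lebesgue (\<lambda>n x. \<theta> x * \<phi> n x) (\<lambda>x. \<theta> x * u x)"
    by (rule l2_tendsto_mult_bounded[OF \<phi>(2) m(1) B(1)])
  moreover have "l2_tendsto lebesgue (\<lambda>n x. \<theta> x * frechet_derivative (\<phi> n) (at x) b + \<theta>' x b * \<phi> n x) (\<lambda>x. \<theta> x * G b x + \<theta>' x b * u x)" if b: "b \<in> Basis" for b
    by (rule l2_tendsto_add[OF l2_tendsto_mult_bounded[OF \<phi>(3)[OF b] m(1) B(1)] l2_tendsto_mult_bounded[OF \<phi>(2) m(2) B(2)[OF b]]])
  ultimately show ?thesis unfolding h10_pair_def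
    using test_functions_mult_smooth[OF \<phi>(1) \<theta>] by (intro exI[of _ "\<lambda>n x. \<theta> x * \<phi> n x"]) (simp add: fd)
qed

lemma h10_pair_integration_by_parts:
  fixes c :: "'a::euclidean_space \<Rightarrow> complex"
  assumes u: "h10_pair \<Omega> u G" and v: "h10_pair \<Omega> v H" and b: "b \<in> Basis"
    and c: "\<And>x. (c has_derivative c' x) (at x)" "continuous_on UNIV (\<lambda>x. c' x b)"
    and B: "\<And>x. cmod (c x) \<le> B" "\<And>x. cmod (c' x b) \<le> B"
  shows "(LINT x|lebesgue. c x * u x * cnj (H b x)) = - (LINT x|lebesgue. (c x * G b x + c' x b * u x) * cnj (v x))"
proof -
  obtain \<phi> where \<phi>: "\<And>n. \<phi> n \<in> test_functions \<Omega>" "l2_tendsto lebesgue \<phi> u"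
    "l2_tendsto lebesgue (\<lambda>n x. frechet_derivative (\<phi> n) (at x) b) (G b)"
    using u b unfolding h10_pair_def by auto
  obtain \<psi> where \<psi>: "\<And>n. \<psi> n \<in> test_functions \<Omega>" "l2_tendsto lebesgue \<psi> v"
    "l2_tendsto lebesgue (\<lambda>n x. frechet_derivative (\<psi> n) (at x) b) (H b)"
    using v b unfolding h10_pair_def by auto
  have "continuous_on UNIV c" using c(1) has_derivative_continuous continuous_at_imp_continuous_on by blast
  then have m: "c \<in> borel_measurable lebesgue" "(\<lambda>x. c' x b) \<in> borel_measurable lebesgue"
    using c(2) by (auto intro!: measurable_completion borel_measurable_continuous_onI)
  have "(\<lambda>n. LINT x|lebesgue. c x * \<phi> n x * cnj (frechet_derivative (\<psi> n) (at x) b)) \<longlonglongrightarrow> (LINT x|lebesgue. c x * u x * cnj (H b x))"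
    by (rule l2_tendsto_inner[OF l2_tendsto_mult_bounded[OF \<phi>(2) m(1) B(1)] \<psi>(3)])
  moreover have "(\<lambda>n. - (LINT x|lebesgue. (c x * frechet_derivative (\<phi> n) (at x) b + c' x b * \<phi> n x) * cnj (\<psi> n x)))
    \<longlonglongrightarrow> - (LINT x|lebesgue. (c x * G b x + c' x b * u x) * cnj (v x))"
    by (rule tendsto_minus[OF l2_tendsto_inner[OF l2_tendsto_add[OF l2_tendsto_mult_bounded[OF \<phi>(3) m(1) B(1)] l2_tendsto_mult_bounded[OF \<phi>(2) m(2) B(2)]] \<psi>(2)]])
  ultimately show ?thesis
    unfolding test_functions_integration_by_parts[OF \<phi>(1) \<psi>(1) c] by (rule LIMSEQ_unique)
qed

section \<open>The dilations as a Lipschitz curve in L2\<close>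

lemma nn_integral_sqnorm:
  assumes "square_integrable lebesgue f"
  shows "(\<integral>\<^sup>+x. ennreal ((cmod (f x))\<^sup>2) \<partial>lborel) = ennreal (sqnorm lebesgue f)"
proof -
  have "(\<integral>\<^sup>+x. ennreal ((cmod (f x))\<^sup>2) \<partial>lborel) = (\<integral>\<^sup>+x. ennreal ((cmod (f x))\<^sup>2) \<partial>lebesgue)"
    by (rule nn_integral_completion[symmetric])
  also have "\<dots> = ennreal (sqnorm lebesgue f)"
    unfolding sqnorm_def using assms by (intro nn_integral_eq_integral) (auto simp: square_integrable_def)
  finally show ?thesis .
qed

text \<open>N / 2 + x . grad, where N is the dimension of the whole space: up to sign the
  infinitesimal generator of the unitary dilations, with N / 2 coming from the normalizing power of
  the dilation parameter.\<close>

definition dil_generator :: "('a::euclidean_space \<Rightarrow> complex) \<Rightarrow> ('a \<Rightarrow> 'a \<Rightarrow> complex) \<Rightarrow> 'a \<Rightarrow> complex" where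
  "dil_generator u G x = complex_of_real (DIM('a) / 2) * u x + (\<Sum>b\<in>Basis. complex_of_real (x \<bullet> b) * G b x)"

lemma dil_derivative:
  fixes \<psi> :: "'a::euclidean_space \<Rightarrow> complex"
  assumes \<psi>: "\<psi> \<in> test_functions \<Omega>" and s: "s > 0"
  shows "((\<lambda>s. dil s \<psi> x) has_vector_derivative
    - (inverse s *\<^sub>R dil s (dil_generator \<psi> (\<lambda>b x. frechet_derivative \<psi> (at x) b)) x)) (at s)"
proof -
  let ?p = "- (real DIM('a) / 2)" and ?y = "x /\<^sub>R s"
  let ?D = "frechet_derivative \<psi> (at ?y)"
  have lin: "linear ?D" using test_functions_derivative[OF \<psi>] has_derivative_linear by blast
  have "((\<lambda>s. inverse s *\<^sub>R x) has_derivative (\<lambda>h. (- (inverse s * h * inverse s)) *\<^sub>R x)) (at s)"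
    using s by (auto intro!: derivative_eq_intros)
  from has_derivative_compose[OF this test_functions_derivative[OF \<psi>]]
  have 1: "((\<lambda>s. \<psi> (x /\<^sub>R s)) has_derivative (\<lambda>h. ?D ((- (inverse s * h * inverse s)) *\<^sub>R x))) (at s)" .
  have "?D ((- (inverse s * h * inverse s)) *\<^sub>R x) = h *\<^sub>R (- (inverse s *\<^sub>R ?D ?y))" for h
    using linear_scale[OF lin, of "- (inverse s * h)" ?y] by (simp add: mult.commute linear_scale[OF lin])
  with 1 have 2: "((\<lambda>s. \<psi> (x /\<^sub>R s)) has_vector_derivative (- (inverse s *\<^sub>R ?D ?y))) (at s)"
    by (simp add: has_vector_derivative_def)
  have "((\<lambda>s. s powr ?p) has_real_derivative ?p * s powr (?p - 1)) (at s)"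
    using s by (intro has_real_derivative_powr) auto
  then have "((\<lambda>s. complex_of_real (s powr ?p)) has_vector_derivative complex_of_real (?p * s powr (?p - 1))) (at s)"
    by (intro has_vector_derivative_of_real) (simp add: has_real_derivative_iff_has_vector_derivative)
  from has_vector_derivative_mult[OF this 2]
  have 3: "((\<lambda>s. dil s \<psi> x) has_vector_derivative
      complex_of_real (s powr ?p) * (- (inverse s *\<^sub>R ?D ?y)) + complex_of_real (?p * s powr (?p - 1)) * \<psi> ?y) (at s)"
    by (simp add: dil_def)
  have pw: "s powr (?p - 1) = s powr ?p * inverse s"
    using powr_diff[of s ?p 1] powr_one[of s] s by (simp only: divide_inverse less_imp_le)
  have "?D ?y = ?D (\<Sum>b\<in>Basis. (?y \<bullet> b) *\<^sub>R b)" by (simp only: euclidean_representation)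
  also have "\<dots> = (\<Sum>b\<in>Basis. complex_of_real (?y \<bullet> b) * ?D b)"
    by (simp only: linear_sum[OF lin] linear_scale[OF lin] scaleR_conv_of_real)
  finally have Dy: "?D ?y = (\<Sum>b\<in>Basis. complex_of_real (?y \<bullet> b) * ?D b)" .
  have "complex_of_real (s powr ?p) * (- (inverse s *\<^sub>R ?D ?y)) + complex_of_real (?p * s powr (?p - 1)) * \<psi> ?y =
    - (inverse s *\<^sub>R dil s (dil_generator \<psi> (\<lambda>b x. frechet_derivative \<psi> (at x) b)) x)"
    unfolding dil_def dil_generator_def Dy[symmetric] pw scaleR_conv_of_real by (simp add: algebra_simps)
  with 3 show ?thesis by simp
qed

text \<open>Pointwise, D \<psi> - \<psi> is the integral over s in [1, l] of -(1/s) times the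
  dilated generator. Cauchy-Schwarz in s yields one factor l - 1; exchanging the integrals and the
  isometry of each dilation yield the other, with 1/s <= 1.\<close>

lemma dil_lipschitz_test:
  fixes \<psi> :: "'a::euclidean_space \<Rightarrow> complex"
  assumes \<psi>: "\<psi> \<in> test_functions \<Omega>" and l: "l \<ge> 1"
  shows "sqnorm lebesgue (\<lambda>x. dil l \<psi> x - \<psi> x) \<le>
    (l - 1)\<^sup>2 * sqnorm lebesgue (dil_generator \<psi> (\<lambda>b x. frechet_derivative \<psi> (at x) b))"
proof -
  define m where "m = dil_generator \<psi> (\<lambda>b x. frechet_derivative \<psi> (at x) b)"
  have c\<psi>: "continuous_on UNIV \<psi>" "continuous_on UNIV (\<lambda>x. frechet_derivative \<psi> (at x) b)" for b
    using Ck_on_continuous[OF test_functions_smooth[OF \<psi>, of 0]]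
      Ck_on_continuous[OF test_functions_smooth[OF test_functions_derivative_test[OF \<psi>], of 0]] by auto
  have cm: "continuous_on UNIV m" unfolding m_def dil_generator_def[abs_def] by (intro continuous_intros c\<psi>)
  have sm: "square_integrable lebesgue m"
  proof (rule square_integrable_continuous_compact_support[OF cm])
    show "compact (closure {x. \<psi> x \<noteq> 0} \<union> (\<Union>b\<in>Basis. closure {x. frechet_derivative \<psi> (at x) b \<noteq> 0}))"
      using test_functions_outside(2)[OF \<psi>] test_functions_outside(2)[OF test_functions_derivative_test[OF \<psi>]]
      by (intro compact_Un compact_UN) auto
    fix x assume x: "x \<notin> closure {x. \<psi> x \<noteq> 0} \<union> (\<Union>b\<in>Basis. closure {x. frechet_derivative \<psi> (at x) b \<noteq> 0})"
    have "\<psi> x = 0" using x test_functions_outside(1)[OF \<psi>] by blast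
    moreover have "frechet_derivative \<psi> (at x) b = 0" if "b \<in> Basis" for b
      using x that test_functions_outside(1)[OF test_functions_derivative_test[OF \<psi>], of x b] by blast
    ultimately show "m x = 0" by (simp add: m_def dil_generator_def)
  qed
  define k where "k s x = indicator {1..l} s * (cmod (dil s m x))\<^sup>2" for s x
  have mm: "m \<in> borel_measurable borel" and m\<psi>: "\<psi> \<in> borel_measurable borel"
    using cm c\<psi> by (auto intro: borel_measurable_continuous_onI)
  have point: "ennreal ((cmod (dil l \<psi> x - \<psi> x))\<^sup>2) \<le> ennreal (l - 1) * (\<integral>\<^sup>+s. ennreal (k s x) \<partial>lborel)" for x
  proof -
    let ?D = "\<lambda>s. - (inverse s *\<^sub>R dil s m x)"
    \<comment> \<open>The integral over [1, l] is written as an inner product of \<open>f\<close>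
      with the indicator \<open>g\<close>, whose squared norm is l - 1.\<close>
    define f where "f s = indicator {1..l} s *\<^sub>R ?D s" for s
    define g where "g s = complex_of_real (indicator {1..l} s)" for s :: real
    have cD: "continuous_on {1..l} ?D"
      unfolding dil_def by (intro continuous_intros continuous_on_compose2[OF cm]) auto
    have fm: "f \<in> borel_measurable borel" unfolding f_def
      by (rule borel_measurable_continuous_on_indicator[OF _ cD]) simp
    have fsq: "(\<lambda>s. (cmod (f s))\<^sup>2) = (\<lambda>s. indicator {1..l} s *\<^sub>R (cmod (?D s))\<^sup>2)"
      by (auto simp: f_def indicator_def fun_eq_iff)
    have "integrable lborel (\<lambda>s. indicator {1..l} s *\<^sub>R (cmod (?D s))\<^sup>2)"
      by (rule borel_integrable_compact) (intro compact_Icc, intro continuous_intros cD)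
    then have f: "square_integrable lborel f" using fm unfolding square_integrable_def fsq by simp
    have "(\<lambda>s. (cmod (g s))\<^sup>2) = indicator {1..l}" by (auto simp: g_def indicator_def fun_eq_iff)
    then have g: "square_integrable lborel g" "sqnorm lborel g = l - 1"
      using l by (auto simp: square_integrable_def sqnorm_def g_def[abs_def])
    have "(LINT s|lborel. f s * cnj (g s)) = (LINT s|lborel. indicator {1..l} s *\<^sub>R ?D s)"
      by (intro Bochner_Integration.integral_cong) (auto simp: f_def g_def indicator_def)
    also have "\<dots> = dil l \<psi> x - dil 1 \<psi> x"
    proof (rule integral_FTC_atLeastAtMost[OF l _ cD])
      show "((\<lambda>s. dil s \<psi> x) has_vector_derivative ?D s) (at s within {1..l})" if "1 \<le> s" "s \<le> l" for s
        unfolding m_def by (rule has_vector_derivative_at_within[OF dil_derivative[OF \<psi>]]) (use that in auto)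
    qed
    finally have FTC: "dil l \<psi> x - \<psi> x = (LINT s|lborel. f s * cnj (g s))" by (simp add: dil_def)
    have "cmod (dil l \<psi> x - \<psi> x) \<le> sqrt (sqnorm lborel f) * sqrt (l - 1)"
      unfolding FTC using cmod_integral_mult_le[OF f g(1)] by (simp add: g(2))
    then have "(cmod (dil l \<psi> x - \<psi> x))\<^sup>2 \<le> (sqrt (sqnorm lborel f) * sqrt (l - 1))\<^sup>2" by (intro power_mono) auto
    also have "\<dots> = (l - 1) * sqnorm lborel f" using l by (simp add: power_mult_distrib)
    finally have "ennreal ((cmod (dil l \<psi> x - \<psi> x))\<^sup>2) \<le> ennreal ((l - 1) * sqnorm lborel f)" by (rule ennreal_leI)
    also have "\<dots> = ennreal (l - 1) * ennreal (sqnorm lborel f)" using l by (simp add: ennreal_mult)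
    also have "ennreal (sqnorm lborel f) = (\<integral>\<^sup>+s. ennreal ((cmod (f s))\<^sup>2) \<partial>lborel)"
      unfolding sqnorm_def using f by (intro nn_integral_eq_integral[symmetric]) (auto simp: square_integrable_def)
    also have "\<dots> \<le> (\<integral>\<^sup>+s. ennreal (k s x) \<partial>lborel)"
    proof (intro nn_integral_mono ennreal_leI)
      fix s
      have "cmod (?D s) \<le> cmod (dil s m x)" if "s \<in> {1..l}"
      proof -
        have "\<bar>inverse s\<bar> \<le> 1" using that by (simp add: inverse_le_1_iff)
        then show ?thesis by (simp add: mult_left_le_one_le)
      qed
      then show "(cmod (f s))\<^sup>2 \<le> k s x" by (auto simp: f_def k_def indicator_def intro: power_mono)
    qed
    finally show ?thesis by (simp add: mult_left_mono)
  qed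
  \<comment> \<open>Joint measurability is obtained from Borel measurability of the continuous
    generator; this is why the exchange of integrals is carried out over
    \<open>lborel\<close>.\<close>
  have km: "(\<lambda>(x, s). ennreal (k s x)) \<in> borel_measurable (lborel \<Otimes>\<^sub>M lborel)"
  proof -
    note [measurable] = mm
    show ?thesis unfolding k_def dil_def by measurable
  qed
  have sl: "square_integrable lebesgue (\<lambda>x. dil l \<psi> x - \<psi> x)"
    by (intro square_integrable_diff dil_square_integrable test_functions_square_integrable[OF \<psi>]) (use l in auto)
  have "ennreal (sqnorm lebesgue (\<lambda>x. dil l \<psi> x - \<psi> x)) = (\<integral>\<^sup>+x. ennreal ((cmod (dil l \<psi> x - \<psi> x))\<^sup>2) \<partial>lborel)"
    by (rule nn_integral_sqnorm[OF sl, symmetric])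
  also have "\<dots> \<le> (\<integral>\<^sup>+x. ennreal (l - 1) * (\<integral>\<^sup>+s. ennreal (k s x) \<partial>lborel) \<partial>lborel)"
    by (intro nn_integral_mono point)
  also have "\<dots> = ennreal (l - 1) * (\<integral>\<^sup>+x. (\<integral>\<^sup>+s. ennreal (k s x) \<partial>lborel) \<partial>lborel)"
    by (rule nn_integral_cmult) (use lborel.borel_measurable_nn_integral[OF km] in simp)
  also have "(\<integral>\<^sup>+x. (\<integral>\<^sup>+s. ennreal (k s x) \<partial>lborel) \<partial>lborel) = (\<integral>\<^sup>+s. (\<integral>\<^sup>+x. ennreal (k s x) \<partial>lborel) \<partial>lborel)"
    using lborel_pair.Fubini'[OF km] by simp
  also have "\<dots> = (\<integral>\<^sup>+s. ennreal (sqnorm lebesgue m) * indicator {1..l} s \<partial>lborel)"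
  proof (intro nn_integral_cong)
    fix s :: real
    show "(\<integral>\<^sup>+x. ennreal (k s x) \<partial>lborel) = ennreal (sqnorm lebesgue m) * indicator {1..l} s"
    proof (cases "s \<in> {1..l}")
      case True
      then have "s > 0" by auto
      from nn_integral_sqnorm[OF dil_square_integrable(1)[OF sm this]] dil_square_integrable(2)[OF sm this]
      show ?thesis using True by (simp add: k_def)
    next
      case False
      then show ?thesis by (simp add: k_def)
    qed
  qed
  also have "\<dots> = ennreal (sqnorm lebesgue m) * ennreal (l - 1)"
    using l by (simp add: nn_integral_cmult_indicator)
  also have "ennreal (l - 1) * (ennreal (sqnorm lebesgue m) * ennreal (l - 1)) = ennreal ((l - 1)\<^sup>2 * sqnorm lebesgue m)"
    using l by (simp add: ennreal_mult power2_eq_square mult_ac)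
  finally show ?thesis using l unfolding m_def by (subst (asm) ennreal_le_iff) auto
qed

section \<open>Gaussian truncation\<close>

definition gauss :: "real \<Rightarrow> 'a::euclidean_space \<Rightarrow> complex" where
  "gauss s x = complex_of_real (exp (- (s\<^sup>2 * (x \<bullet> x))))"

definition gauss_deriv :: "real \<Rightarrow> 'a::euclidean_space \<Rightarrow> 'a \<Rightarrow> complex" where
  "gauss_deriv s x v = complex_of_real (- (2 * s\<^sup>2 * (x \<bullet> v)) * exp (- (s\<^sup>2 * (x \<bullet> x))))"

text \<open>The derivative of \<open>gauss_deriv s x b\<close> in direction v; the sum of its
  diagonal values over the basis is the Laplacian of the Gaussian.\<close>

definition gauss_deriv2 :: "real \<Rightarrow> 'a::euclidean_space \<Rightarrow> 'a \<Rightarrow> 'a \<Rightarrow> complex" where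
  "gauss_deriv2 s x b v = complex_of_real
     ((- (2 * s\<^sup>2 * (v \<bullet> b)) + 4 * (s\<^sup>2)\<^sup>2 * (x \<bullet> b) * (x \<bullet> v)) * exp (- (s\<^sup>2 * (x \<bullet> x))))"

lemma gauss_smooth: "Ck_on k UNIV (gauss s :: 'a::euclidean_space \<Rightarrow> complex)"
proof -
  have "Ck_on k UNIV (\<lambda>x::'a. complex_of_real (exp ((- (s\<^sup>2)) * (x \<bullet> x))))"
    by (intro Ck_on_linear_compose[OF bounded_linear_of_real] Ck_on_exp Ck_on_mult Ck_on_const
        Ck_on_bilinear[OF bounded_bilinear_inner] Ck_on_bounded_linear bounded_linear_ident)
  then show ?thesis by (simp add: gauss_def[abs_def])
qed

lemma gauss_exp_has_derivative:
  "((\<lambda>x::'a::euclidean_space. exp (- (s\<^sup>2 * (x \<bullet> x)))) has_derivative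
     (\<lambda>v. - (2 * s\<^sup>2 * (x \<bullet> v)) * exp (- (s\<^sup>2 * (x \<bullet> x))))) (at x)"
  by (auto intro!: derivative_eq_intros simp: inner_commute algebra_simps)

lemma gauss_has_derivative: "(gauss s has_derivative gauss_deriv s x) (at x)"
  using bounded_linear.has_derivative[OF bounded_linear_of_real[where 'a = complex] gauss_exp_has_derivative[of s x]]
  by (simp add: gauss_def[abs_def] gauss_deriv_def[abs_def])

lemma gauss_deriv_has_derivative: "((\<lambda>x. gauss_deriv s x b) has_derivative gauss_deriv2 s x b) (at x)"
proof -
  have "((\<lambda>x. - (2 * s\<^sup>2 * (x \<bullet> b)) * exp (- (s\<^sup>2 * (x \<bullet> x)))) has_derivative
    (\<lambda>v. (- (2 * s\<^sup>2 * (v \<bullet> b)) + 4 * (s\<^sup>2)\<^sup>2 * (x \<bullet> b) * (x \<bullet> v)) * exp (- (s\<^sup>2 * (x \<bullet> x))))) (at x)"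
    by (rule has_derivative_eq_rhs[OF has_derivative_mult[OF _ gauss_exp_has_derivative[of s x]]])
      (auto intro!: derivative_eq_intros simp: algebra_simps power2_eq_square)
  from bounded_linear.has_derivative[OF bounded_linear_of_real[where 'a = complex] this]
  show ?thesis by (simp add: gauss_deriv_def gauss_deriv2_def[abs_def])
qed

lemma gauss_deriv2_continuous: "continuous_on UNIV (\<lambda>x. gauss_deriv2 s x b v)"
  unfolding gauss_deriv2_def by (intro continuous_intros)

lemma gauss_deriv_continuous: "continuous_on UNIV (\<lambda>x. gauss_deriv s x b)"
  unfolding gauss_deriv_def by (intro continuous_intros)

lemma gauss_continuous: "continuous_on UNIV (gauss s)"
  unfolding gauss_def[abs_def] by (intro continuous_intros)

lemma mult_exp_minus_le:
  fixes t :: real shows "t * exp (- t) \<le> 1" "\<bar>t\<bar> * exp (- (t\<^sup>2)) \<le> 1"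
proof -
  have "t \<le> exp t" using exp_ge_add_one_self[of t] by linarith
  then show "t * exp (- t) \<le> 1" by (simp add: exp_minus field_simps)
  have "2 * \<bar>t\<bar> * 1 \<le> \<bar>t\<bar>\<^sup>2 + 1\<^sup>2" by (rule sum_squares_bound)
  then have "\<bar>t\<bar> \<le> exp (t\<^sup>2)" using exp_ge_add_one_self[of "t\<^sup>2"] abs_ge_zero[of t]
    unfolding power2_abs power_one mult_1_right by linarith
  then show "\<bar>t\<bar> * exp (- (t\<^sup>2)) \<le> 1" by (simp add: exp_minus field_simps)
qed

text \<open>The Gaussian depends on s x only: each derivative gains a factor s and each factor x
  costs 1 / s. In particular x . grad of it is bounded uniformly in s. All constants come from r
  exp(-r^2) <= 1 and t exp(-t) <= 1 with r = s |x| and t = r^2.\<close>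

lemma gauss_bounds:
  fixes x :: "'a::euclidean_space"
  assumes s: "s > 0"
  shows "cmod (gauss s x) \<le> 1"
    and "b \<in> Basis \<Longrightarrow> s * \<bar>x \<bullet> b\<bar> * cmod (gauss s x) \<le> 1"
    and "b \<in> Basis \<Longrightarrow> cmod (gauss_deriv s x b) \<le> 2 * s"
    and "b \<in> Basis \<Longrightarrow> cmod (gauss_deriv2 s x b b) \<le> 6 * s\<^sup>2"
    and "cmod (\<Sum>b\<in>Basis. complex_of_real (x \<bullet> b) * gauss_deriv s x b) \<le> 2"
proof -
  let ?e = "exp (- (s\<^sup>2 * (x \<bullet> x)))"
  have e1: "?e \<le> 1" by simp
  show "cmod (gauss s x) \<le> 1" by (simp add: gauss_def)
  have t: "s\<^sup>2 * (x \<bullet> x) = (s * norm x)\<^sup>2" by (simp add: power_mult_distrib power2_norm_eq_inner)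
  have n: "s * norm x * ?e \<le> 1" using mult_exp_minus_le(2)[of "s * norm x"] s by (simp add: t)
  have n2: "s\<^sup>2 * (x \<bullet> x) * ?e \<le> 1" by (rule mult_exp_minus_le(1))
  {
    fix b :: 'a assume b: "b \<in> Basis"
    have xb: "\<bar>x \<bullet> b\<bar> \<le> norm x" using Basis_le_norm[OF b] .
    have "s * \<bar>x \<bullet> b\<bar> * ?e \<le> s * norm x * ?e" using xb s by (intro mult_right_mono mult_left_mono) auto
    then have sb: "s * \<bar>x \<bullet> b\<bar> * ?e \<le> 1" using n by linarith
    then show "s * \<bar>x \<bullet> b\<bar> * cmod (gauss s x) \<le> 1" by (simp add: gauss_def)
    have "cmod (gauss_deriv s x b) = 2 * s * (s * \<bar>x \<bullet> b\<bar> * ?e)"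
      using s by (simp only: gauss_deriv_def norm_of_real) (simp add: abs_mult power2_eq_square)
    also have "\<dots> \<le> 2 * s * 1" using sb s by (intro mult_left_mono) auto
    finally show "cmod (gauss_deriv s x b) \<le> 2 * s" by simp
    have "(x \<bullet> b)\<^sup>2 \<le> x \<bullet> x" using power_mono[OF xb, of 2] by (simp add: power2_norm_eq_inner)
    then have "s\<^sup>2 * (x \<bullet> b)\<^sup>2 * ?e \<le> s\<^sup>2 * (x \<bullet> x) * ?e" by (intro mult_right_mono mult_left_mono) auto
    then have q: "s\<^sup>2 * (x \<bullet> b)\<^sup>2 * ?e \<le> 1" using n2 by linarith
    have "cmod (gauss_deriv2 s x b b) = \<bar>- (2 * s\<^sup>2) * ?e + 4 * s\<^sup>2 * (s\<^sup>2 * (x \<bullet> b)\<^sup>2 * ?e)\<bar>"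
      unfolding gauss_deriv2_def norm_of_real using b by (simp add: power2_eq_square algebra_simps)
    also have "\<dots> \<le> \<bar>- (2 * s\<^sup>2) * ?e\<bar> + \<bar>4 * s\<^sup>2 * (s\<^sup>2 * (x \<bullet> b)\<^sup>2 * ?e)\<bar>" by (rule abs_triangle_ineq)
    also have "\<dots> = 2 * s\<^sup>2 * ?e + 4 * s\<^sup>2 * (s\<^sup>2 * (x \<bullet> b)\<^sup>2 * ?e)" by (simp add: abs_mult)
    also have "\<dots> \<le> 2 * s\<^sup>2 * 1 + 4 * s\<^sup>2 * 1" using e1 q by (intro add_mono mult_left_mono) auto
    finally show "cmod (gauss_deriv2 s x b b) \<le> 6 * s\<^sup>2" by simp
  }
  have "(\<Sum>b\<in>Basis. complex_of_real (x \<bullet> b) * gauss_deriv s x b) =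
      complex_of_real (\<Sum>b\<in>Basis. (x \<bullet> b) * (- (2 * s\<^sup>2 * (x \<bullet> b)) * ?e))"
    by (simp only: gauss_deriv_def of_real_sum of_real_mult)
  also have "(\<Sum>b\<in>Basis. (x \<bullet> b) * (- (2 * s\<^sup>2 * (x \<bullet> b)) * ?e)) = (\<Sum>b\<in>Basis. (- 2 * s\<^sup>2 * ?e) * ((x \<bullet> b) * (x \<bullet> b)))"
    by (intro sum.cong) (auto simp: algebra_simps)
  also have "\<dots> = (- 2 * s\<^sup>2 * ?e) * (x \<bullet> x)"
    by (simp only: sum_distrib_left[symmetric] euclidean_inner[of x x, symmetric])
  also have "\<dots> = - 2 * (s\<^sup>2 * (x \<bullet> x) * ?e)" by simp
  finally have "cmod (\<Sum>b\<in>Basis. complex_of_real (x \<bullet> b) * gauss_deriv s x b) = 2 * (s\<^sup>2 * (x \<bullet> x) * ?e)"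
    by (simp only: norm_of_real) (simp add: abs_mult)
  then show "cmod (\<Sum>b\<in>Basis. complex_of_real (x \<bullet> b) * gauss_deriv s x b) \<le> 2" using n2 by linarith
qed

lemma h10_pair_gauss:
  assumes "h10_pair \<Omega> u G" "s > 0"
  shows "h10_pair \<Omega> (\<lambda>x. gauss s x * u x) (\<lambda>b x. gauss s x * G b x + gauss_deriv s x b * u x)"
proof (rule h10_pair_mult[OF assms(1) gauss_smooth gauss_has_derivative, of _ "1 + 2 * s"])
  show "cmod (gauss s x) \<le> 1 + 2 * s" for x :: 'a using gauss_bounds(1)[OF assms(2), of x] assms(2) by linarith
  show "cmod (gauss_deriv s x b) \<le> 1 + 2 * s" if "b \<in> Basis" for x b :: 'a
    using gauss_bounds(3)[OF assms(2) that, of x] by linarith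
qed

text \<open>One square integrable majorant for u and all its derivatives at once, serving both in
  norm estimates and as dominating function; complex-valued so that \<open>square_integrable\<close>
  applies to it.\<close>

definition pair_modulus :: "('a::euclidean_space \<Rightarrow> complex) \<Rightarrow> ('a \<Rightarrow> 'a \<Rightarrow> complex) \<Rightarrow> 'a \<Rightarrow> complex" where
  "pair_modulus u G x = complex_of_real (cmod (u x) + (\<Sum>b\<in>Basis. cmod (G b x)))"

lemma square_integrable_cmod: "square_integrable M f \<Longrightarrow> square_integrable M (\<lambda>x. complex_of_real (cmod (f x)))"
  by (rule square_integrable_bound(1)[where c = 1]) (auto dest: square_integrable_measurable)

lemma square_integrable_sum:
  assumes "\<And>i. i \<in> I \<Longrightarrow> square_integrable M (f i)"
  shows "square_integrable M (\<lambda>x. \<Sum>i\<in>I. f i x)"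
  using assms by (induction I rule: infinite_finite_induct) (auto intro: square_integrable_add)

lemma pair_modulus_square_integrable:
  assumes "h10_pair \<Omega> u G" shows "square_integrable lebesgue (pair_modulus u G)"
  unfolding pair_modulus_def[abs_def] of_real_add of_real_sum
  by (intro square_integrable_add square_integrable_sum square_integrable_cmod h10_pair_square_integrable[OF assms])

lemma cmod_pair_modulus: "cmod (pair_modulus u G x) = cmod (u x) + (\<Sum>b\<in>Basis. cmod (G b x))"
  unfolding pair_modulus_def norm_of_real by (simp add: sum_nonneg)

text \<open>The Lipschitz estimate for test functions is applied to \<phi> n multiplied by the
  Gaussian and passed to the limit. The unbounded coefficient x of the generator is tamed by the
  Gaussian at the price 1 / s, so no decay of u beyond square integrability is used.\<close>

lemma dil_lipschitz_gauss:
  fixes u :: "'a::euclidean_space \<Rightarrow> complex"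
  assumes u: "h10_pair \<Omega> u G" and s: "0 < s" "s \<le> 1" and l: "l \<ge> 1"
  shows "sqnorm lebesgue (\<lambda>x. dil l (\<lambda>x. gauss s x * u x) x - gauss s x * u x) \<le>
    (l - 1)\<^sup>2 * (((DIM('a) / 2 + 2) / s)\<^sup>2 * sqnorm lebesgue (pair_modulus u G))"
proof -
  obtain \<phi> where \<phi>: "\<And>n. \<phi> n \<in> test_functions \<Omega>" "l2_tendsto lebesgue \<phi> u"
    "\<And>b. b \<in> Basis \<Longrightarrow> l2_tendsto lebesgue (\<lambda>n x. frechet_derivative (\<phi> n) (at x) b) (G b)"
    using u unfolding h10_pair_def by auto
  let ?N = "DIM('a) / 2"
  define \<psi> where "\<psi> n x = gauss s x * \<phi> n x" for n x
  have \<psi>: "\<psi> n \<in> test_functions \<Omega>" for n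
    unfolding \<psi>_def[abs_def] by (rule test_functions_mult_smooth[OF \<phi>(1) gauss_smooth])
  have fd: "frechet_derivative (\<psi> n) (at x) b = gauss s x * frechet_derivative (\<phi> n) (at x) b + gauss_deriv s x b * \<phi> n x" for n x b
    unfolding \<psi>_def[abs_def] frechet_derivative_at[OF has_derivative_mult[OF gauss_has_derivative test_functions_derivative[OF \<phi>(1)]], symmetric] ..
  \<comment> \<open>\<open>h0\<close> and \<open>h\<close> are the coefficients of \<phi> and of its
    partial derivatives in the generator applied to the product with the Gaussian. Both are bounded,
    so L2 limits may be taken term by term.\<close>
  define h0 where "h0 x = complex_of_real ?N * gauss s x + (\<Sum>b\<in>Basis. complex_of_real (x \<bullet> b) * gauss_deriv s x b)" for x :: 'a
  define h where "h b x = complex_of_real (x \<bullet> b) * gauss s x" for b x :: 'a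
  define m where "m x = h0 x * u x + (\<Sum>b\<in>Basis. h b x * G b x)" for x
  have gen: "dil_generator (\<psi> n) (\<lambda>b x. frechet_derivative (\<psi> n) (at x) b) x = h0 x * \<phi> n x + (\<Sum>b\<in>Basis. h b x * frechet_derivative (\<phi> n) (at x) b)" for n x
    unfolding dil_generator_def fd h0_def h_def \<psi>_def
    by (simp add: distrib_left distrib_right sum.distrib sum_distrib_left sum_distrib_right mult.assoc add_ac)
  have h0b: "cmod (h0 x) \<le> ?N + 2" for x
  proof -
    have "cmod (h0 x) \<le> cmod (complex_of_real ?N * gauss s x) + cmod (\<Sum>b\<in>Basis. complex_of_real (x \<bullet> b) * gauss_deriv s x b)"
      unfolding h0_def by (rule norm_triangle_ineq)
    also have "\<dots> \<le> ?N * 1 + 2"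
      using gauss_bounds(1)[OF s(1), of x] gauss_bounds(5)[OF s(1), of x]
      by (intro add_mono) (auto simp: norm_mult intro!: mult_left_mono)
    finally show ?thesis by simp
  qed
  have hb: "cmod (h b x) \<le> 1 / s" if "b \<in> Basis" for b x
    using gauss_bounds(2)[OF s(1) that, of x] s by (simp add: h_def norm_mult field_simps)
  have "continuous_on UNIV h0" unfolding h0_def by (intro continuous_intros gauss_continuous gauss_deriv_continuous)
  then have mh0: "h0 \<in> borel_measurable lebesgue" by (intro measurable_completion) (auto intro: borel_measurable_continuous_onI)
  have "continuous_on UNIV (h b)" for b unfolding h_def by (intro continuous_intros gauss_continuous)
  then have mh: "h b \<in> borel_measurable lebesgue" for b by (intro measurable_completion) (auto intro: borel_measurable_continuous_onI)
  have lm: "l2_tendsto lebesgue (\<lambda>n x. dil_generator (\<psi> n) (\<lambda>b x. frechet_derivative (\<psi> n) (at x) b) x) m"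
    unfolding gen m_def[abs_def]
    by (intro l2_tendsto_add l2_tendsto_sum l2_tendsto_mult_bounded[OF \<phi>(2) mh0 h0b] l2_tendsto_mult_bounded[OF \<phi>(3) mh hb])
  have mg: "gauss s \<in> borel_measurable lebesgue"
    by (intro measurable_completion) (auto intro: borel_measurable_continuous_onI gauss_continuous)
  have l\<psi>: "l2_tendsto lebesgue \<psi> (\<lambda>x. gauss s x * u x)"
    unfolding \<psi>_def[abs_def] by (rule l2_tendsto_mult_bounded[OF \<phi>(2) mg gauss_bounds(1)[OF s(1)]])
  have ld: "l2_tendsto lebesgue (\<lambda>n x. dil l (\<psi> n) x - \<psi> n x) (\<lambda>x. dil l (\<lambda>x. gauss s x * u x) x - gauss s x * u x)"
    using l by (intro l2_tendsto_diff l2_tendsto_dil l\<psi>) auto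
  have "sqnorm lebesgue (\<lambda>x. dil l (\<lambda>x. gauss s x * u x) x - gauss s x * u x) \<le> (l - 1)\<^sup>2 * sqnorm lebesgue m"
  proof (rule LIMSEQ_le[OF l2_tendsto_sqnorm[OF ld]])
    show "(\<lambda>n. (l - 1)\<^sup>2 * sqnorm lebesgue (dil_generator (\<psi> n) (\<lambda>b x. frechet_derivative (\<psi> n) (at x) b))) \<longlonglongrightarrow> (l - 1)\<^sup>2 * sqnorm lebesgue m"
      by (intro tendsto_intros l2_tendsto_sqnorm[OF lm])
  qed (use dil_lipschitz_test[OF \<psi> l] in blast)
  also have "sqnorm lebesgue m \<le> ((?N + 2) / s)\<^sup>2 * sqnorm lebesgue (pair_modulus u G)"
  proof (rule square_integrable_bound(2)[OF pair_modulus_square_integrable[OF u]])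
    show "m \<in> borel_measurable lebesgue" using lm by (auto simp: l2_tendsto_def intro: square_integrable_measurable)
    show "AE x in lebesgue. cmod (m x) \<le> (?N + 2) / s * cmod (pair_modulus u G x)"
    proof (rule AE_I2)
      fix x
      \<comment> \<open>Here s <= 1 lets the bounds N / 2 + 2 and 1 / s of the two kinds of
        coefficients merge into one constant.\<close>
      have b1: "?N + 2 \<le> (?N + 2) / s" using s by (simp add: le_divide_eq mult_left_le)
      have b2: "1 / s \<le> (?N + 2) / s" using s by (intro divide_right_mono) auto
      have "cmod (m x) \<le> cmod (h0 x * u x) + (\<Sum>b\<in>Basis. cmod (h b x * G b x))"
        unfolding m_def by (intro order_trans[OF norm_triangle_ineq] add_left_mono norm_sum)
      also have "\<dots> \<le> (?N + 2) / s * cmod (u x) + (\<Sum>b\<in>Basis. (?N + 2) / s * cmod (G b x))"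
      proof (intro add_mono sum_mono)
        show "cmod (h0 x * u x) \<le> (?N + 2) / s * cmod (u x)"
          using h0b[of x] b1 unfolding norm_mult by (intro mult_right_mono) auto
        show "cmod (h b x * G b x) \<le> (?N + 2) / s * cmod (G b x)" if "b \<in> Basis" for b
          using hb[OF that, of x] b2 unfolding norm_mult by (intro mult_right_mono) auto
      qed
      also have "\<dots> = (?N + 2) / s * cmod (pair_modulus u G x)"
        by (simp only: cmod_pair_modulus distrib_left sum_distrib_left)
      finally show "cmod (m x) \<le> (?N + 2) / s * cmod (pair_modulus u G x)" .
    qed
  qed
  then have "(l - 1)\<^sup>2 * sqnorm lebesgue m \<le> (l - 1)\<^sup>2 * (((?N + 2) / s)\<^sup>2 * sqnorm lebesgue (pair_modulus u G))"
    by (intro mult_left_mono) auto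
  finally show ?thesis .
qed

section \<open>The virial inequality for homogeneous potentials\<close>

text \<open>What the virial argument really uses: invariance under forward dilations, a potential
  homogeneous of degree -1 that is form-integrable, and semiboundedness. The weights
  \<open>a\<close> carry the masses, so particles of different mass are handled at once.\<close>

locale homogeneous_form =
  fixes \<Omega> :: "'a::euclidean_space set" and a :: "'a \<Rightarrow> real" and V :: "'a \<Rightarrow> real" and C :: real
  assumes dilation: "x \<in> \<Omega> \<Longrightarrow> l \<ge> 1 \<Longrightarrow> l *\<^sub>R x \<in> \<Omega>"
    and weight_nonneg: "b \<in> Basis \<Longrightarrow> a b \<ge> 0"
    and V_measurable: "V \<in> borel_measurable lebesgue"
    and V_homogeneous: "l > 0 \<Longrightarrow> V (x /\<^sub>R l) = l * V x"
    and V_integrable: "h10_pair \<Omega> u G \<Longrightarrow> integrable lebesgue (\<lambda>x. V x * (cmod (u x))\<^sup>2)"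
    and C_nonneg: "C \<ge> 0"
    and semibounded: "h10_pair \<Omega> u G \<Longrightarrow>
      - C * sqnorm lebesgue u \<le> (\<Sum>b\<in>Basis. a b * sqnorm lebesgue (G b)) + (LINT x|lebesgue. V x * (cmod (u x))\<^sup>2)"
begin

definition kin :: "('a \<Rightarrow> 'a \<Rightarrow> complex) \<Rightarrow> real" where
  "kin G = (\<Sum>b\<in>Basis. a b * sqnorm lebesgue (G b))"

definition pot :: "('a \<Rightarrow> complex) \<Rightarrow> real" where
  "pot u = (LINT x|lebesgue. V x * (cmod (u x))\<^sup>2)"

definition form :: "('a \<Rightarrow> complex) \<Rightarrow> ('a \<Rightarrow> 'a \<Rightarrow> complex) \<Rightarrow> ('a \<Rightarrow> complex) \<Rightarrow> ('a \<Rightarrow> 'a \<Rightarrow> complex) \<Rightarrow> complex" where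
  "form u G v H = (\<Sum>b\<in>Basis. complex_of_real (a b) * (LINT x|lebesgue. G b x * cnj (H b x))) +
     (LINT x|lebesgue. complex_of_real (V x) * u x * cnj (v x))"

lemma V_product_integrable:
  assumes u: "h10_pair \<Omega> u G" and v: "h10_pair \<Omega> v H"
  shows "integrable lebesgue (\<lambda>x. complex_of_real (V x) * u x * cnj (v x))"
proof (rule Bochner_Integration.integrable_bound)
  show "integrable lebesgue (\<lambda>x. norm (V x * (cmod (u x))\<^sup>2) + norm (V x * (cmod (v x))\<^sup>2))"
    by (intro Bochner_Integration.integrable_add integrable_norm V_integrable[OF u] V_integrable[OF v])
  note [measurable] = V_measurable square_integrable_measurable[OF h10_pair_square_integrable(1)[OF u]]
    square_integrable_measurable[OF h10_pair_square_integrable(1)[OF v]]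
  show "(\<lambda>x. complex_of_real (V x) * u x * cnj (v x)) \<in> borel_measurable lebesgue" by measurable
  show "AE x in lebesgue. norm (complex_of_real (V x) * u x * cnj (v x)) \<le>
    norm (norm (V x * (cmod (u x))\<^sup>2) + norm (V x * (cmod (v x))\<^sup>2))"
  proof (rule AE_I2)
    fix x
    have "0 \<le> cmod (u x) * cmod (v x)" by simp
    moreover have "2 * (cmod (u x) * cmod (v x)) \<le> (cmod (u x))\<^sup>2 + (cmod (v x))\<^sup>2"
      using sum_squares_bound[of "cmod (u x)" "cmod (v x)"] by (simp add: mult.assoc)
    ultimately have "cmod (u x) * cmod (v x) \<le> (cmod (u x))\<^sup>2 + (cmod (v x))\<^sup>2" by linarith
    then have "\<bar>V x\<bar> * (cmod (u x) * cmod (v x)) \<le> \<bar>V x\<bar> * ((cmod (u x))\<^sup>2 + (cmod (v x))\<^sup>2)"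
      by (rule mult_left_mono) simp
    then show "norm (complex_of_real (V x) * u x * cnj (v x)) \<le>
      norm (norm (V x * (cmod (u x))\<^sup>2) + norm (V x * (cmod (v x))\<^sup>2))"
      by (simp add: norm_mult abs_mult distrib_left mult.assoc)
  qed
qed

lemma form_diag:
  assumes "h10_pair \<Omega> u G"
  shows "form u G u G = complex_of_real (kin G + pot u)"
proof -
  have "(LINT x|lebesgue. complex_of_real (V x) * u x * cnj (u x)) = (LINT x|lebesgue. complex_of_real (V x * (cmod (u x))\<^sup>2))"
    by (intro Bochner_Integration.integral_cong) (simp_all only: mult.assoc complex_norm_square[symmetric] of_real_mult)
  also have "\<dots> = complex_of_real (pot u)" unfolding pot_def by (rule integral_complex_of_real)
  finally show ?thesis by (simp add: form_def kin_def complex_of_real_sqnorm)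
qed

text \<open>The cross term is taken between g and d - g rather than between g and d, because d - g
  is the function with which the equation for g gets tested.\<close>

lemma cmod_diff_sq: "(cmod (d - g))\<^sup>2 = (cmod d)\<^sup>2 - (cmod g)\<^sup>2 - 2 * Re (g * cnj (d - g))"
  unfolding cmod_power2 by (simp add: power2_eq_square algebra_simps)

lemma sqnorm_diff_eq:
  assumes d: "square_integrable M d" and g: "square_integrable M g"
  shows "sqnorm M (\<lambda>x. d x - g x) = sqnorm M d - sqnorm M g - 2 * Re (LINT x|M. g x * cnj (d x - g x))"
proof -
  have i: "integrable M (\<lambda>x. g x * cnj (d x - g x))"
    by (intro square_integrable_mult_integrable(2) g square_integrable_diff d)
  have ii: "integrable M (\<lambda>x. (cmod (d x))\<^sup>2)" "integrable M (\<lambda>x. (cmod (g x))\<^sup>2)"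
    using d g by (auto simp: square_integrable_def)
  have "sqnorm M (\<lambda>x. d x - g x) = (LINT x|M. (cmod (d x))\<^sup>2 - (cmod (g x))\<^sup>2 - 2 * Re (g x * cnj (d x - g x)))"
    unfolding sqnorm_def by (simp only: cmod_diff_sq)
  also have "\<dots> = sqnorm M d - sqnorm M g - 2 * (LINT x|M. Re (g x * cnj (d x - g x)))"
    unfolding sqnorm_def using ii integrable_Re[OF i]
    by (simp only: Bochner_Integration.integral_diff Bochner_Integration.integrable_diff Bochner_Integration.integral_mult_right_zero
        integrable_mult_right)
  finally show ?thesis using integral_Re[OF i] by simp
qed

lemma pot_diff_eq:
  assumes d: "h10_pair \<Omega> d D" and g: "h10_pair \<Omega> g G"
  shows "pot (\<lambda>x. d x - g x) = pot d - pot g - 2 * Re (LINT x|lebesgue. complex_of_real (V x) * g x * cnj (d x - g x))"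
proof -
  note i = V_product_integrable[OF g h10_pair_diff[OF d g]]
  have re: "Re (complex_of_real t * z) = t * Re z" for t z by simp
  have "pot (\<lambda>x. d x - g x) = (LINT x|lebesgue. V x * (cmod (d x))\<^sup>2 - V x * (cmod (g x))\<^sup>2 - 2 * Re (complex_of_real (V x) * g x * cnj (d x - g x)))"
    unfolding pot_def
  proof (intro Bochner_Integration.integral_cong refl)
    fix x
    have "Re (complex_of_real (V x) * g x * cnj (d x - g x)) = V x * Re (g x * cnj (d x - g x))"
      using re[of "V x" "g x * cnj (d x - g x)"] by (simp only: mult.assoc)
    then show "V x * (cmod (d x - g x))\<^sup>2 = V x * (cmod (d x))\<^sup>2 - V x * (cmod (g x))\<^sup>2 - 2 * Re (complex_of_real (V x) * g x * cnj (d x - g x))"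
      by (simp only: cmod_diff_sq right_diff_distrib mult.left_commute)
  qed
  also have "\<dots> = pot d - pot g - 2 * (LINT x|lebesgue. Re (complex_of_real (V x) * g x * cnj (d x - g x)))"
    unfolding pot_def using V_integrable[OF d] V_integrable[OF g] integrable_Re[OF i]
    by (simp only: Bochner_Integration.integral_diff Bochner_Integration.integrable_diff Bochner_Integration.integral_mult_right_zero
        integrable_mult_right)
  finally show ?thesis using integral_Re[OF i] by simp
qed

text \<open>When d is a dilate of g, scaling evaluates the first two brackets, and the last term is
  small because g nearly solves the eigenvalue equation.\<close>

lemma quadratic_diff_eq:
  assumes d: "h10_pair \<Omega> d D" and g: "h10_pair \<Omega> g G"
  shows "kin (\<lambda>b x. D b x - G b x) + pot (\<lambda>x. d x - g x) - E * sqnorm lebesgue (\<lambda>x. d x - g x) =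
     (kin D + pot d - E * sqnorm lebesgue d) - (kin G + pot g - E * sqnorm lebesgue g)
     - 2 * Re (form g G (\<lambda>x. d x - g x) (\<lambda>b x. D b x - G b x) - complex_of_real E * (LINT x|lebesgue. g x * cnj (d x - g x)))"
proof -
  define k where "k = Re (\<Sum>b\<in>Basis. complex_of_real (a b) * (LINT x|lebesgue. G b x * cnj (D b x - G b x)))"
  define p where "p = Re (LINT x|lebesgue. complex_of_real (V x) * g x * cnj (d x - g x))"
  define r where "r = Re (LINT x|lebesgue. g x * cnj (d x - g x))"
  have "kin (\<lambda>b x. D b x - G b x) = (\<Sum>b\<in>Basis. a b * (sqnorm lebesgue (D b) - sqnorm lebesgue (G b) - 2 * Re (LINT x|lebesgue. G b x * cnj (D b x - G b x))))"
    unfolding kin_def using h10_pair_square_integrable(2)[OF d] h10_pair_square_integrable(2)[OF g]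
    by (intro sum.cong) (auto simp: sqnorm_diff_eq)
  also have "\<dots> = kin D - kin G - 2 * Re (\<Sum>b\<in>Basis. complex_of_real (a b) * (LINT x|lebesgue. G b x * cnj (D b x - G b x)))"
    by (simp add: kin_def right_diff_distrib sum_subtractf sum_distrib_left mult.left_commute)
  finally have hk: "kin (\<lambda>b x. D b x - G b x) = kin D - kin G - 2 * k" unfolding k_def .
  note hp = pot_diff_eq[OF d g, folded p_def]
    and hr = sqnorm_diff_eq[OF h10_pair_square_integrable(1)[OF d] h10_pair_square_integrable(1)[OF g], folded r_def]
  have re: "Re (complex_of_real t * z) = t * Re z" for t z by simp
  have hR: "Re (form g G (\<lambda>x. d x - g x) (\<lambda>b x. D b x - G b x) - complex_of_real E * (LINT x|lebesgue. g x * cnj (d x - g x))) = k + p - E * r"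
    unfolding form_def k_def p_def r_def by (simp only: minus_complex.sel plus_complex.sel re)
  show ?thesis unfolding hk hp hr hR by (simp add: algebra_simps)
qed

text \<open>By homogeneity V x = V (x / l) / l. The factor 1 / l comes out, and the rest is a change
  of variables whose Jacobian the normalization of \<open>dil\<close> supplies.\<close>

lemma pot_dil:
  assumes u: "h10_pair \<Omega> u G" and l: "l > 0"
  shows "pot (dil l u) = inverse l * pot u"
proof -
  let ?F = "\<lambda>x. V x * (cmod (u x))\<^sup>2"
  have m: "?F \<in> borel_measurable lebesgue"
    using V_measurable square_integrable_measurable[OF h10_pair_square_integrable(1)[OF u]] by measurable
  have "pot (dil l u) = (LINT x|lebesgue. inverse l * (inverse (l ^ DIM('a)) *\<^sub>R ?F (x /\<^sub>R l)))"
    unfolding pot_def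
    by (intro Bochner_Integration.integral_cong refl)
      (simp only: cmod_dil_sq[OF l] V_homogeneous[OF l] real_scaleR_def, use l in \<open>simp add: field_simps\<close>)
  then show ?thesis using lebesgue_integral_scaling(1)[OF m l] by (simp only: pot_def Bochner_Integration.integral_mult_right_zero)
qed

lemma kin_dil:
  assumes u: "h10_pair \<Omega> u G" and l: "l > 0"
  shows "kin (\<lambda>b x. complex_of_real (inverse l) * dil l (G b) x) = (inverse l)\<^sup>2 * kin G"
  unfolding kin_def sum_distrib_left
  by (intro sum.cong refl) (simp add: sqnorm_cmult dil_square_integrable(2)[OF h10_pair_square_integrable(2)[OF u] l] norm_inverse power_inverse del: of_real_inverse)

text \<open>The commutator of the kinetic operator with the Gaussian, applied to u: the second-order
  operator contributes a first-order term and a zeroth-order term, the potential contributes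
  nothing.\<close>

definition commutator_term :: "real \<Rightarrow> ('a \<Rightarrow> complex) \<Rightarrow> ('a \<Rightarrow> 'a \<Rightarrow> complex) \<Rightarrow> 'a \<Rightarrow> complex" where
  "commutator_term s u G x =
     (\<Sum>b\<in>Basis. complex_of_real (- a b) * (2 * (gauss_deriv s x b * G b x) + gauss_deriv2 s x b b * u x))"

section \<open>The truncated eigenfunction as an approximate solution\<close>

context
  fixes u :: "'a \<Rightarrow> complex" and G :: "'a \<Rightarrow> 'a \<Rightarrow> complex" and E :: real and s :: real
  assumes u: "h10_pair \<Omega> u G"
    and sol: "\<And>v H. h10_pair \<Omega> v H \<Longrightarrow> form u G v H = complex_of_real E * (LINT x|lebesgue. u x * cnj (v x))"
    and s: "0 < s" "s \<le> 1"
begin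

lemma gauss_measurable [measurable]:
  "(gauss s :: 'a \<Rightarrow> complex) \<in> borel_measurable lebesgue" "(\<lambda>x::'a. gauss_deriv s x b) \<in> borel_measurable lebesgue"
  "(\<lambda>x::'a. gauss_deriv2 s x b c) \<in> borel_measurable lebesgue"
  by (intro measurable_completion; simp add: borel_measurable_continuous_onI gauss_continuous gauss_deriv_continuous gauss_deriv2_continuous)+

lemma gauss_products:
  fixes f :: "'a \<Rightarrow> complex"
  assumes f: "square_integrable lebesgue f" and b: "b \<in> Basis"
  shows "square_integrable lebesgue (\<lambda>x. gauss s x * f x)" "square_integrable lebesgue (\<lambda>x. gauss_deriv s x b * f x)"
    "square_integrable lebesgue (\<lambda>x. gauss_deriv2 s x b b * f x)"
  by (rule square_integrable_mult_bounded(1)[OF f gauss_measurable(1) gauss_bounds(1)[OF s(1)]]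
      square_integrable_mult_bounded(1)[OF f gauss_measurable(2) gauss_bounds(3)[OF s(1) b]]
      square_integrable_mult_bounded(1)[OF f gauss_measurable(3) gauss_bounds(4)[OF s(1) b]])+

lemma commutator_term_square_integrable: "square_integrable lebesgue (commutator_term s u G)"
  unfolding commutator_term_def[abs_def]
  by (intro square_integrable_sum square_integrable_cmult square_integrable_add gauss_products
      h10_pair_square_integrable[OF u])

text \<open>The equation for u is tested with the product of v and the Gaussian, which is again
  admissible. Shifting the real factor from v to u leaves as error the commutator, in a form that
  contains no derivative of v. Hence its pairing with v is controlled by the L2 norm of v
  alone.\<close>

lemma form_gauss:
  assumes v: "h10_pair \<Omega> v H"
  shows "form (\<lambda>x. gauss s x * u x) (\<lambda>b x. gauss s x * G b x + gauss_deriv s x b * u x) v H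
    - complex_of_real E * (LINT x|lebesgue. gauss s x * u x * cnj (v x)) = (LINT x|lebesgue. commutator_term s u G x * cnj (v x))"
proof -
  let ?v = "\<lambda>x. gauss s x * v x" and ?H = "\<lambda>b x. gauss s x * H b x + gauss_deriv s x b * v x"
  have real [simp]: "cnj (gauss s x) = gauss s x" "cnj (gauss_deriv s x b) = gauss_deriv s x b" for x b :: 'a
    by (simp_all add: gauss_def gauss_deriv_def)
  have su: "square_integrable lebesgue u" "square_integrable lebesgue v" using u v by (auto intro: h10_pair_square_integrable)
  have V: "(LINT x|lebesgue. complex_of_real (V x) * u x * cnj (?v x)) = (LINT x|lebesgue. complex_of_real (V x) * (gauss s x * u x) * cnj (v x))"
    by (intro Bochner_Integration.integral_cong) (simp_all add: mult_ac)
  have L: "(LINT x|lebesgue. u x * cnj (?v x)) = (LINT x|lebesgue. gauss s x * u x * cnj (v x))"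
    by (intro Bochner_Integration.integral_cong) (simp_all add: mult_ac)
  have K: "(LINT x|lebesgue. (gauss s x * G b x + gauss_deriv s x b * u x) * cnj (H b x)) =
     (LINT x|lebesgue. G b x * cnj (?H b x)) - (LINT x|lebesgue. (2 * (gauss_deriv s x b * G b x) + gauss_deriv2 s x b b * u x) * cnj (v x))"
    if b: "b \<in> Basis" for b
  proof -
    have sG: "square_integrable lebesgue (G b)" "square_integrable lebesgue (H b)" using u v b by (auto intro: h10_pair_square_integrable)
    \<comment> \<open>The one error term in which the gradient falls on v; it is moved onto u and
      onto the derivative of the Gaussian.\<close>
    have ibp: "(LINT x|lebesgue. gauss_deriv s x b * u x * cnj (H b x)) =
       - (LINT x|lebesgue. (gauss_deriv s x b * G b x + gauss_deriv2 s x b b * u x) * cnj (v x))"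
    proof (rule h10_pair_integration_by_parts[OF u v b, where c = "\<lambda>x. gauss_deriv s x b" and c' = "\<lambda>x. gauss_deriv2 s x b" and B = "2 * s + 6 * s\<^sup>2"])
      show "((\<lambda>x. gauss_deriv s x b) has_derivative gauss_deriv2 s x b) (at x)" for x
        by (rule gauss_deriv_has_derivative)
      show "continuous_on UNIV (\<lambda>x. gauss_deriv2 s x b b)" by (rule gauss_deriv2_continuous)
      show "cmod (gauss_deriv s x b) \<le> 2 * s + 6 * s\<^sup>2" for x
        using gauss_bounds(3)[OF s(1) b, of x] by (smt (verit) zero_le_power2)
      show "cmod (gauss_deriv2 s x b b) \<le> 2 * s + 6 * s\<^sup>2" for x
        using gauss_bounds(4)[OF s(1) b, of x] s by linarith
    qed
    have i1: "integrable lebesgue (\<lambda>x. gauss s x * G b x * cnj (H b x))"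
      by (intro square_integrable_mult_integrable(2) gauss_products(1)[OF _ b] sG)
    have i2: "integrable lebesgue (\<lambda>x. gauss_deriv s x b * u x * cnj (H b x))"
      by (intro square_integrable_mult_integrable(2) gauss_products(2)[OF _ b] sG su)
    have i3: "integrable lebesgue (\<lambda>x. gauss_deriv s x b * G b x * cnj (v x))"
      by (intro square_integrable_mult_integrable(2) gauss_products(2)[OF _ b] sG su)
    have i4: "integrable lebesgue (\<lambda>x. gauss_deriv2 s x b b * u x * cnj (v x))"
      by (intro square_integrable_mult_integrable(2) gauss_products(3)[OF _ b] sG su)
    have "(LINT x|lebesgue. (gauss s x * G b x + gauss_deriv s x b * u x) * cnj (H b x)) =
      (LINT x|lebesgue. gauss s x * G b x * cnj (H b x)) + (LINT x|lebesgue. gauss_deriv s x b * u x * cnj (H b x))"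
      unfolding distrib_right by (rule Bochner_Integration.integral_add[OF i1 i2])
    also have "(LINT x|lebesgue. gauss_deriv s x b * u x * cnj (H b x)) =
      - ((LINT x|lebesgue. gauss_deriv s x b * G b x * cnj (v x)) + (LINT x|lebesgue. gauss_deriv2 s x b b * u x * cnj (v x)))"
      unfolding ibp distrib_right by (simp only: Bochner_Integration.integral_add[OF i3 i4])
    finally have 1: "(LINT x|lebesgue. (gauss s x * G b x + gauss_deriv s x b * u x) * cnj (H b x)) =
      (LINT x|lebesgue. gauss s x * G b x * cnj (H b x)) - (LINT x|lebesgue. gauss_deriv s x b * G b x * cnj (v x))
       - (LINT x|lebesgue. gauss_deriv2 s x b b * u x * cnj (v x))" by simp
    have "(LINT x|lebesgue. G b x * cnj (?H b x)) = (LINT x|lebesgue. gauss s x * G b x * cnj (H b x) + gauss_deriv s x b * G b x * cnj (v x))"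
      by (intro Bochner_Integration.integral_cong) (simp_all add: algebra_simps)
    also have "\<dots> = (LINT x|lebesgue. gauss s x * G b x * cnj (H b x)) + (LINT x|lebesgue. gauss_deriv s x b * G b x * cnj (v x))"
      by (rule Bochner_Integration.integral_add[OF i1 i3])
    finally have 2: "(LINT x|lebesgue. G b x * cnj (?H b x)) =
      (LINT x|lebesgue. gauss s x * G b x * cnj (H b x)) + (LINT x|lebesgue. gauss_deriv s x b * G b x * cnj (v x))" .
    have "(LINT x|lebesgue. (2 * (gauss_deriv s x b * G b x) + gauss_deriv2 s x b b * u x) * cnj (v x)) =
      (LINT x|lebesgue. 2 * (gauss_deriv s x b * G b x * cnj (v x)) + gauss_deriv2 s x b b * u x * cnj (v x))"
      by (intro Bochner_Integration.integral_cong) (simp_all add: algebra_simps)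
    also have "\<dots> = 2 * (LINT x|lebesgue. gauss_deriv s x b * G b x * cnj (v x)) + (LINT x|lebesgue. gauss_deriv2 s x b b * u x * cnj (v x))"
      using i3 i4 by simp
    finally show ?thesis using 1 2 by simp
  qed
  have "(LINT x|lebesgue. commutator_term s u G x * cnj (v x)) =
     (LINT x|lebesgue. (\<Sum>b\<in>Basis. complex_of_real (- a b) * ((2 * (gauss_deriv s x b * G b x) + gauss_deriv2 s x b b * u x) * cnj (v x))))"
    by (simp only: commutator_term_def sum_distrib_right mult.assoc)
  also have "\<dots> = (\<Sum>b\<in>Basis. (LINT x|lebesgue. complex_of_real (- a b) * ((2 * (gauss_deriv s x b * G b x) + gauss_deriv2 s x b b * u x) * cnj (v x))))"
    by (intro Bochner_Integration.integral_sum integrable_mult_right square_integrable_mult_integrable(2) square_integrable_add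
      square_integrable_cmult gauss_products h10_pair_square_integrable[OF u] su)
  also have "\<dots> = (\<Sum>b\<in>Basis. complex_of_real (- a b) * (LINT x|lebesgue. (2 * (gauss_deriv s x b * G b x) + gauss_deriv2 s x b b * u x) * cnj (v x)))"
    by (simp only: Bochner_Integration.integral_mult_right_zero)
  finally have f: "(LINT x|lebesgue. commutator_term s u G x * cnj (v x)) =
    (\<Sum>b\<in>Basis. complex_of_real (- a b) * (LINT x|lebesgue. (2 * (gauss_deriv s x b * G b x) + gauss_deriv2 s x b b * u x) * cnj (v x)))" .
  have "form (\<lambda>x. gauss s x * u x) (\<lambda>b x. gauss s x * G b x + gauss_deriv s x b * u x) v H =
    form u G ?v ?H + (LINT x|lebesgue. commutator_term s u G x * cnj (v x))"
    unfolding form_def V f using K by (simp add: right_diff_distrib sum_subtractf sum_negf)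
  \<comment> \<open>The solution property enters here, with the truncated v as test
    function.\<close>
  then show ?thesis using sol[OF h10_pair_gauss[OF v s(1)]] L by simp
qed

text \<open>The difference of the truncated eigenfunction and a slightly dilated copy is admissible, and
  the form is bounded below on it by a quantity of second order in the dilation parameter.\<close>

lemma truncated_virial:
  assumes E: "E \<ge> 0"
  shows "2 * kin (\<lambda>b x. gauss s x * G b x + gauss_deriv s x b * u x) + pot (\<lambda>x. gauss s x * u x) \<le>
    2 * (sqrt (sqnorm lebesgue (commutator_term s u G)) * ((DIM('a) / 2 + 2) / s * sqrt (sqnorm lebesgue (pair_modulus u G))))"
proof -
  define g where "g x = gauss s x * u x" for x
  define Gg where "Gg b x = gauss s x * G b x + gauss_deriv s x b * u x" for b x
  \<comment> \<open>(l - 1) K will bound the norm of the dilation difference, and K grows like 1 /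
    s; \<open>F\<close> is the norm of the commutator term.\<close>
  define K where "K = (DIM('a) / 2 + 2) / s * sqrt (sqnorm lebesgue (pair_modulus u G))"
  define F where "F = sqrt (sqnorm lebesgue (commutator_term s u G))"
  have K0: "K \<ge> 0" using s by (simp add: K_def)
  have F0: "F \<ge> 0" by (simp add: F_def)
  have g: "h10_pair \<Omega> g Gg" unfolding g_def[abs_def] Gg_def[abs_def] by (rule h10_pair_gauss[OF u s(1)])
  have ineq: "(inverse l + (inverse l)\<^sup>2) * kin Gg + inverse l * pot g \<le> (l - 1) * ((C + E) * K\<^sup>2) + 2 * (F * K)" if l: "l > 1" for l
  proof -
    define d where "d = dil l g"
    define D where "D b x = complex_of_real (inverse l) * dil l (Gg b) x" for b x
    have l0: "l > 0" "l \<ge> 1" using l by auto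
    have d: "h10_pair \<Omega> d D" unfolding d_def D_def[abs_def]
      by (rule h10_pair_dil[OF g l0(1)]) (use dilation l0 in auto)
    let ?w = "\<lambda>x. d x - g x" and ?W = "\<lambda>b x. D b x - Gg b x"
    have w: "h10_pair \<Omega> ?w ?W" by (rule h10_pair_diff[OF d g])
    define nw where "nw = sqrt (sqnorm lebesgue ?w)"
    have nw: "sqnorm lebesgue ?w = nw\<^sup>2" "nw \<ge> 0" by (simp_all add: nw_def)
    have "sqnorm lebesgue ?w \<le> (l - 1)\<^sup>2 * (((DIM('a) / 2 + 2) / s)\<^sup>2 * sqnorm lebesgue (pair_modulus u G))"
      unfolding d_def g_def by (rule dil_lipschitz_gauss[OF u s l0(2)])
    also have "\<dots> = ((l - 1) * K)\<^sup>2" by (simp only: K_def power_mult_distrib real_sqrt_pow2[OF sqnorm_nonneg])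
    finally have "nw\<^sup>2 \<le> ((l - 1) * K)\<^sup>2" unfolding nw(1) .
    then have nwK: "nw \<le> (l - 1) * K" by (rule power2_le_imp_le) (use l K0 in simp)
    have "- C * nw\<^sup>2 - E * nw\<^sup>2 \<le> kin ?W + pot ?w - E * sqnorm lebesgue ?w"
      using semibounded[OF w] nw(1) by (simp add: kin_def pot_def)
    also have "\<dots> = (kin D + pot d - E * sqnorm lebesgue d) - (kin Gg + pot g - E * sqnorm lebesgue g)
       - 2 * Re (form g Gg ?w ?W - complex_of_real E * (LINT x|lebesgue. g x * cnj (?w x)))"
      by (rule quadratic_diff_eq[OF d g])
    also have "kin D = (inverse l)\<^sup>2 * kin Gg" unfolding D_def[abs_def] by (rule kin_dil[OF g l0(1)])
    also have "pot d = inverse l * pot g" unfolding d_def by (rule pot_dil[OF g l0(1)])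
    also have "sqnorm lebesgue d = sqnorm lebesgue g"
      unfolding d_def by (rule dil_square_integrable(2)[OF h10_pair_square_integrable(1)[OF g] l0(1)])
    also have "form g Gg ?w ?W - complex_of_real E * (LINT x|lebesgue. g x * cnj (?w x)) = (LINT x|lebesgue. commutator_term s u G x * cnj (?w x))"
      using form_gauss[OF w] by (simp only: g_def[abs_def] Gg_def[abs_def])
    finally have 1: "- C * nw\<^sup>2 - E * nw\<^sup>2 \<le> ((inverse l)\<^sup>2 - 1) * kin Gg + (inverse l - 1) * pot g
       - 2 * Re (LINT x|lebesgue. commutator_term s u G x * cnj (?w x))"
      by (simp add: algebra_simps)
    have "cmod (LINT x|lebesgue. commutator_term s u G x * cnj (?w x)) \<le> F * nw"
      unfolding F_def nw_def
      by (rule cmod_integral_mult_le[OF commutator_term_square_integrable h10_pair_square_integrable(1)[OF w]])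
    then have "- Re (LINT x|lebesgue. commutator_term s u G x * cnj (?w x)) \<le> F * nw"
      using abs_Re_le_cmod[of "LINT x|lebesgue. commutator_term s u G x * cnj (?w x)"] by linarith
    then have 2: "(1 - (inverse l)\<^sup>2) * kin Gg + (1 - inverse l) * pot g \<le> (C + E) * nw\<^sup>2 + 2 * (F * nw)"
      using 1 by (simp add: algebra_simps)
    have "nw\<^sup>2 \<le> ((l - 1) * K)\<^sup>2" using nwK nw by (intro power_mono) auto
    then have "(C + E) * nw\<^sup>2 \<le> (C + E) * ((l - 1) * K)\<^sup>2" using C_nonneg E by (intro mult_left_mono) auto
    moreover have "F * nw \<le> F * ((l - 1) * K)" using nwK F0 by (rule mult_left_mono)
    ultimately have 3: "(1 - (inverse l)\<^sup>2) * kin Gg + (1 - inverse l) * pot g \<le> (C + E) * ((l - 1) * K)\<^sup>2 + 2 * (F * ((l - 1) * K))"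
      using 2 by linarith
    \<comment> \<open>Both coefficients on the left contain the factor l - 1, as does the right
      side, so it can be cancelled before l tends to 1.\<close>
    have i1: "1 - inverse l = (l - 1) * inverse l" using l by (simp add: field_simps)
    have i2: "1 - (inverse l)\<^sup>2 = (l - 1) * (inverse l + (inverse l)\<^sup>2)" using l by (simp add: field_simps power2_eq_square)
    have "(l - 1) * ((inverse l + (inverse l)\<^sup>2) * kin Gg + inverse l * pot g) \<le> (l - 1) * ((l - 1) * ((C + E) * K\<^sup>2) + 2 * (F * K))"
      using 3 unfolding i1 i2 by (simp add: power_mult_distrib power2_eq_square algebra_simps)
    then show ?thesis using l by (simp only: mult_le_cancel_left_pos diff_gt_0_iff_gt)
  qed
  \<comment> \<open>With s fixed, l decreases to 1: the contribution of \<open>C\<close> and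
    \<open>E\<close> still carries a factor l - 1 and disappears, while the commutator contribution
    F K survives.\<close>
  have "((\<lambda>l. (inverse l + (inverse l)\<^sup>2) * kin Gg + inverse l * pot g) \<longlongrightarrow> (inverse 1 + (inverse 1)\<^sup>2) * kin Gg + inverse 1 * pot g) (at_right (1::real))"
    by (intro tendsto_intros) auto
  moreover have "((\<lambda>l. (l - 1) * ((C + E) * K\<^sup>2) + 2 * (F * K)) \<longlongrightarrow> (1 - 1) * ((C + E) * K\<^sup>2) + 2 * (F * K)) (at_right (1::real))"
    by (intro tendsto_intros)
  moreover have "\<forall>\<^sub>F l in at_right (1::real). (inverse l + (inverse l)\<^sup>2) * kin Gg + inverse l * pot g \<le> (l - 1) * ((C + E) * K\<^sup>2) + 2 * (F * K)"
    using ineq by (auto simp: eventually_at_right_field intro!: exI[of _ 2])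
  ultimately have "(inverse 1 + (inverse 1)\<^sup>2) * kin Gg + inverse 1 * pot g \<le> (1 - 1) * ((C + E) * K\<^sup>2) + 2 * (F * K)"
    by (intro tendsto_le[OF trivial_limit_at_right_real])
  then show ?thesis by (simp add: K_def F_def Gg_def[abs_def] g_def[abs_def])
qed

end

text \<open>Lets s tend to 0 in the truncated inequality. The left side converges to 2 T + W by
  dominated convergence. On the right the factor 1 / s is attached to the commutator term, which
  even after division by s tends to 0 in L2.\<close>

theorem no_positive_eigenvalue:
  assumes u: "h10_pair \<Omega> u G" and E: "E > 0"
    and sol: "\<And>v H. h10_pair \<Omega> v H \<Longrightarrow> form u G v H = complex_of_real E * (LINT x|lebesgue. u x * cnj (v x))"
  shows "AE x in lebesgue. u x = 0"
proof -
  define s where "s n = inverse (real (Suc n))" for n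
  have s: "0 < s n" "s n \<le> 1" for n by (auto simp: s_def field_simps)
  have s0: "s \<longlonglongrightarrow> 0" unfolding s_def[abs_def] by (rule LIMSEQ_inverse_real_of_nat)
  let ?S = "pair_modulus u G"
  have S: "square_integrable lebesgue ?S" by (rule pair_modulus_square_integrable[OF u])
  have su: "square_integrable lebesgue u" and sG: "\<And>b. b \<in> Basis \<Longrightarrow> square_integrable lebesgue (G b)"
    using h10_pair_square_integrable[OF u] by auto
  note [measurable] = square_integrable_measurable[OF su] square_integrable_measurable[OF sG]
  have uS: "cmod (u x) \<le> cmod (?S x)" for x unfolding cmod_pair_modulus by (simp add: sum_nonneg)
  have GS: "cmod (G b x) \<le> cmod (?S x)" if "b \<in> Basis" for b x
    unfolding cmod_pair_modulus using that by (intro add_increasing member_le_sum) auto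
  have e1: "(\<lambda>n. gauss (s n) x) \<longlonglongrightarrow> 1" for x :: 'a
  proof -
    have "(\<lambda>n. gauss (s n) x) \<longlonglongrightarrow> complex_of_real (exp (- (0\<^sup>2 * (x \<bullet> x))))"
      unfolding gauss_def by (intro tendsto_intros s0)
    then show ?thesis by simp
  qed
  have e2: "(\<lambda>n. gauss_deriv (s n) x b) \<longlonglongrightarrow> 0" for x b :: 'a
  proof -
    have "(\<lambda>n. gauss_deriv (s n) x b) \<longlonglongrightarrow> complex_of_real (- (2 * 0\<^sup>2 * (x \<bullet> b)) * exp (- (0\<^sup>2 * (x \<bullet> x))))"
      unfolding gauss_deriv_def by (intro tendsto_intros s0)
    then show ?thesis by simp
  qed
  have kin_lim: "(\<lambda>n. kin (\<lambda>b x. gauss (s n) x * G b x + gauss_deriv (s n) x b * u x)) \<longlonglongrightarrow> kin G"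
    unfolding kin_def
  proof (intro tendsto_intros l2_tendsto_sqnorm)
    fix b :: 'a assume b: "b \<in> Basis"
    show "l2_tendsto lebesgue (\<lambda>n x. gauss (s n) x * G b x + gauss_deriv (s n) x b * u x) (G b)"
    proof (rule l2_tendsto_dominated)
      \<comment> \<open>3 = 1 + 2: the Gaussian is at most 1 and its derivative at most 2 s <=
        2.\<close>
      show "square_integrable lebesgue (\<lambda>x. 3 * ?S x)" by (rule square_integrable_cmult[OF S])
      show "G b \<in> borel_measurable lebesgue" by (rule square_integrable_measurable[OF sG[OF b]])
      show "(\<lambda>x. gauss (s n) x * G b x + gauss_deriv (s n) x b * u x) \<in> borel_measurable lebesgue" for n
        using h10_pair_square_integrable(2)[OF h10_pair_gauss[OF u s(1)] b] by (rule square_integrable_measurable)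
      show "AE x in lebesgue. cmod (gauss (s n) x * G b x + gauss_deriv (s n) x b * u x) \<le> cmod (3 * ?S x)" for n
      proof (rule AE_I2)
        fix x
        have "cmod (gauss (s n) x * G b x + gauss_deriv (s n) x b * u x) \<le> cmod (gauss (s n) x) * cmod (G b x) + cmod (gauss_deriv (s n) x b) * cmod (u x)"
          unfolding norm_mult[symmetric] by (rule norm_triangle_ineq)
        also have "\<dots> \<le> 1 * cmod (?S x) + 2 * cmod (?S x)"
          using gauss_bounds(1)[OF s(1), of n x] gauss_bounds(3)[OF s(1) b, of n x] s(2)[of n]
          by (intro add_mono mult_mono uS GS[OF b]) auto
        finally show "cmod (gauss (s n) x * G b x + gauss_deriv (s n) x b * u x) \<le> cmod (3 * ?S x)" by (simp add: norm_mult)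
      qed
      show "AE x in lebesgue. (\<lambda>n. gauss (s n) x * G b x + gauss_deriv (s n) x b * u x) \<longlonglongrightarrow> G b x"
      proof (rule AE_I2)
        fix x
        have "(\<lambda>n. gauss (s n) x * G b x + gauss_deriv (s n) x b * u x) \<longlonglongrightarrow> 1 * G b x + 0 * u x"
          by (intro tendsto_intros e1 e2)
        then show "(\<lambda>n. gauss (s n) x * G b x + gauss_deriv (s n) x b * u x) \<longlonglongrightarrow> G b x" by simp
      qed
    qed
  qed
  have pot_lim: "(\<lambda>n. pot (\<lambda>x. gauss (s n) x * u x)) \<longlonglongrightarrow> pot u"
    unfolding pot_def
  proof (rule integral_dominated_convergence)
    show "integrable lebesgue (\<lambda>x. norm (V x * (cmod (u x))\<^sup>2))" by (rule integrable_norm[OF V_integrable[OF u]])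
    show "(\<lambda>x. V x * (cmod (u x))\<^sup>2) \<in> borel_measurable lebesgue" using V_integrable[OF u] by (rule borel_measurable_integrable)
    show "(\<lambda>x. V x * (cmod (gauss (s n) x * u x))\<^sup>2) \<in> borel_measurable lebesgue" for n
      using V_integrable[OF h10_pair_gauss[OF u s(1)]] by (rule borel_measurable_integrable)
    show "AE x in lebesgue. (\<lambda>n. V x * (cmod (gauss (s n) x * u x))\<^sup>2) \<longlonglongrightarrow> V x * (cmod (u x))\<^sup>2"
    proof (rule AE_I2)
      fix x
      have "(\<lambda>n. V x * (cmod (gauss (s n) x * u x))\<^sup>2) \<longlonglongrightarrow> V x * (cmod (1 * u x))\<^sup>2"
        by (intro tendsto_intros e1)
      then show "(\<lambda>n. V x * (cmod (gauss (s n) x * u x))\<^sup>2) \<longlonglongrightarrow> V x * (cmod (u x))\<^sup>2" by simp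
    qed
    show "AE x in lebesgue. norm (V x * (cmod (gauss (s n) x * u x))\<^sup>2) \<le> norm (V x * (cmod (u x))\<^sup>2)" for n
    proof (rule AE_I2)
      fix x
      have "cmod (gauss (s n) x * u x) \<le> 1 * cmod (u x)"
        unfolding norm_mult using gauss_bounds(1)[OF s(1), of n x] by (intro mult_right_mono) auto
      then have "(cmod (gauss (s n) x * u x))\<^sup>2 \<le> (cmod (u x))\<^sup>2" by (intro power_mono) auto
      then show "norm (V x * (cmod (gauss (s n) x * u x))\<^sup>2) \<le> norm (V x * (cmod (u x))\<^sup>2)"
        by (simp add: abs_mult mult_left_mono)
    qed
  qed
  have com_lim: "l2_tendsto lebesgue (\<lambda>n x. complex_of_real (inverse (s n)) * commutator_term (s n) u G x) (\<lambda>x. 0)"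
  proof (rule l2_tendsto_dominated)
    \<comment> \<open>10 = 2 * 2 + 6: after division by s the first derivative of the Gaussian is
      bounded by 2 and occurs with factor 2, the second derivative is bounded by 6.\<close>
    let ?A = "\<Sum>b\<in>Basis. a b * 10"
    have A0: "?A \<ge> 0" using weight_nonneg by (intro sum_nonneg) auto
    show "square_integrable lebesgue (\<lambda>x. complex_of_real ?A * ?S x)" by (rule square_integrable_cmult[OF S])
    show "(\<lambda>x. complex_of_real (inverse (s n)) * commutator_term (s n) u G x) \<in> borel_measurable lebesgue" for n
      using square_integrable_measurable[OF commutator_term_square_integrable[OF u sol s]] by measurable
    have b1: "inverse (s n) * cmod (gauss_deriv (s n) x b) \<le> 2" "inverse (s n) * cmod (gauss_deriv2 (s n) x b b) \<le> 6"
      if b: "b \<in> Basis" for n and x b :: 'a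
    proof -
      have "inverse (s n) * cmod (gauss_deriv (s n) x b) \<le> inverse (s n) * (2 * s n)"
        using gauss_bounds(3)[OF s(1) b, of n x] s(1)[of n] by (intro mult_left_mono) auto
      also have "\<dots> = 2" using s(1)[of n] by simp
      finally show "inverse (s n) * cmod (gauss_deriv (s n) x b) \<le> 2" .
      have "inverse (s n) * cmod (gauss_deriv2 (s n) x b b) \<le> inverse (s n) * (6 * (s n)\<^sup>2)"
        using gauss_bounds(4)[OF s(1) b, of n x] s(1)[of n] by (intro mult_left_mono) auto
      also have "\<dots> = 6 * s n" using s(1)[of n] by (simp add: power2_eq_square)
      finally show "inverse (s n) * cmod (gauss_deriv2 (s n) x b b) \<le> 6" using s(2)[of n] by linarith
    qed
    show "AE x in lebesgue. cmod (complex_of_real (inverse (s n)) * commutator_term (s n) u G x) \<le> cmod (complex_of_real ?A * ?S x)" for n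
    proof (rule AE_I2)
      fix x
      have "cmod (complex_of_real (inverse (s n)) * commutator_term (s n) u G x) =
        cmod (\<Sum>b\<in>Basis. complex_of_real (inverse (s n)) * (complex_of_real (- a b) * (2 * (gauss_deriv (s n) x b * G b x) + gauss_deriv2 (s n) x b b * u x)))"
        by (simp only: commutator_term_def sum_distrib_left)
      also have "\<dots> \<le> (\<Sum>b\<in>Basis. a b * 10 * cmod (?S x))"
      proof (rule sum_norm_le)
        fix b :: 'a assume b: "b \<in> Basis"
        have "cmod (complex_of_real (inverse (s n)) * (complex_of_real (- a b) * (2 * (gauss_deriv (s n) x b * G b x) + gauss_deriv2 (s n) x b b * u x)))
          = inverse (s n) * a b * cmod (2 * (gauss_deriv (s n) x b * G b x) + gauss_deriv2 (s n) x b b * u x)"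
          unfolding norm_mult norm_of_real using s(1)[of n] weight_nonneg[OF b] by simp
        also have "\<dots> \<le> inverse (s n) * a b * (2 * (cmod (gauss_deriv (s n) x b) * cmod (G b x)) + cmod (gauss_deriv2 (s n) x b b) * cmod (u x))"
        proof (rule mult_left_mono)
          show "cmod (2 * (gauss_deriv (s n) x b * G b x) + gauss_deriv2 (s n) x b b * u x) \<le> 2 * (cmod (gauss_deriv (s n) x b) * cmod (G b x)) + cmod (gauss_deriv2 (s n) x b b) * cmod (u x)"
            by (rule order_trans[OF norm_triangle_ineq]) (simp add: norm_mult)
        qed (use s(1)[of n] weight_nonneg[OF b] in simp)
        also have "\<dots> = a b * (2 * ((inverse (s n) * cmod (gauss_deriv (s n) x b)) * cmod (G b x)) + (inverse (s n) * cmod (gauss_deriv2 (s n) x b b)) * cmod (u x))"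
          by (simp only: distrib_left mult_ac)
        also have "\<dots> \<le> a b * (2 * (2 * cmod (?S x)) + 6 * cmod (?S x))"
          using b1[OF b, of n x] weight_nonneg[OF b]
          by (intro mult_left_mono add_mono mult_mono GS[OF b] uS) auto
        also have "\<dots> = a b * 10 * cmod (?S x)" by simp
        finally show "cmod (complex_of_real (inverse (s n)) * (complex_of_real (- a b) * (2 * (gauss_deriv (s n) x b * G b x) + gauss_deriv2 (s n) x b b * u x))) \<le> a b * 10 * cmod (?S x)" .
      qed
      also have "\<dots> = cmod (complex_of_real ?A * ?S x)"
        unfolding norm_mult norm_of_real using A0 by (simp only: sum_distrib_right abs_of_nonneg)
      finally show "cmod (complex_of_real (inverse (s n)) * commutator_term (s n) u G x) \<le> cmod (complex_of_real ?A * ?S x)" .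
    qed
    show "AE x in lebesgue. (\<lambda>n. complex_of_real (inverse (s n)) * commutator_term (s n) u G x) \<longlonglongrightarrow> 0"
    proof (rule AE_I2)
      fix x :: 'a
      \<comment> \<open>The derivatives of the Gaussian carry the factor s^2, so one power of s is
        left after the division and gives pointwise convergence to 0.\<close>
      have q1: "(\<lambda>n. complex_of_real (inverse (s n)) * gauss_deriv (s n) x b) \<longlonglongrightarrow> 0" for b
      proof -
        have "complex_of_real (inverse (s n)) * gauss_deriv (s n) x b = complex_of_real (- (2 * s n * (x \<bullet> b)) * exp (- ((s n)\<^sup>2 * (x \<bullet> x))))" for n
          unfolding gauss_deriv_def of_real_mult[symmetric] using s(1)[of n] by (simp add: power2_eq_square)
        moreover have "(\<lambda>n. complex_of_real (- (2 * s n * (x \<bullet> b)) * exp (- ((s n)\<^sup>2 * (x \<bullet> x))))) \<longlonglongrightarrow> complex_of_real (- (2 * 0 * (x \<bullet> b)) * exp (- (0\<^sup>2 * (x \<bullet> x))))"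
          by (intro tendsto_intros s0)
        ultimately show ?thesis by simp
      qed
      have q2: "(\<lambda>n. complex_of_real (inverse (s n)) * gauss_deriv2 (s n) x b b) \<longlonglongrightarrow> 0" for b
      proof -
        have "complex_of_real (inverse (s n)) * gauss_deriv2 (s n) x b b =
          complex_of_real ((- (2 * s n * (b \<bullet> b)) + 4 * ((s n) * (s n)\<^sup>2) * (x \<bullet> b) * (x \<bullet> b)) * exp (- ((s n)\<^sup>2 * (x \<bullet> x))))" for n
          unfolding gauss_deriv2_def of_real_mult[symmetric] using s(1)[of n]
          by (intro arg_cong[where f = complex_of_real]) (simp add: power2_eq_square field_simps)
        moreover have "(\<lambda>n. complex_of_real ((- (2 * s n * (b \<bullet> b)) + 4 * ((s n) * (s n)\<^sup>2) * (x \<bullet> b) * (x \<bullet> b)) * exp (- ((s n)\<^sup>2 * (x \<bullet> x)))))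
          \<longlonglongrightarrow> complex_of_real ((- (2 * 0 * (b \<bullet> b)) + 4 * (0 * 0\<^sup>2) * (x \<bullet> b) * (x \<bullet> b)) * exp (- (0\<^sup>2 * (x \<bullet> x))))"
          by (intro tendsto_intros s0)
        ultimately show ?thesis by simp
      qed
      have "(\<lambda>n. \<Sum>b\<in>Basis. complex_of_real (- a b) * (2 * ((complex_of_real (inverse (s n)) * gauss_deriv (s n) x b) * G b x) + (complex_of_real (inverse (s n)) * gauss_deriv2 (s n) x b b) * u x))
        \<longlonglongrightarrow> (\<Sum>b\<in>Basis. complex_of_real (- a b) * (2 * (0 * G b x) + 0 * u x))"
        by (intro tendsto_intros q1 q2)
      moreover have "complex_of_real (inverse (s n)) * commutator_term (s n) u G x =
        (\<Sum>b\<in>Basis. complex_of_real (- a b) * (2 * ((complex_of_real (inverse (s n)) * gauss_deriv (s n) x b) * G b x) + (complex_of_real (inverse (s n)) * gauss_deriv2 (s n) x b b) * u x))" for n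
        unfolding commutator_term_def sum_distrib_left by (intro sum.cong refl) (simp add: algebra_simps)
      ultimately show "(\<lambda>n. complex_of_real (inverse (s n)) * commutator_term (s n) u G x) \<longlonglongrightarrow> 0" by simp
    qed
  qed simp
  let ?c = "(DIM('a) / 2 + 2) * sqrt (sqnorm lebesgue ?S)"
  have "(\<lambda>n. 2 * (sqrt (sqnorm lebesgue (\<lambda>x. complex_of_real (inverse (s n)) * commutator_term (s n) u G x)) * ?c)) \<longlonglongrightarrow> 2 * (sqrt (sqnorm lebesgue (\<lambda>x::'a. 0)) * ?c)"
    by (intro tendsto_intros l2_tendsto_sqnorm[OF com_lim])
  then have rhs: "(\<lambda>n. 2 * (sqrt (sqnorm lebesgue (\<lambda>x. complex_of_real (inverse (s n)) * commutator_term (s n) u G x)) * ?c)) \<longlonglongrightarrow> 0"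
    by (simp add: sqnorm_def)
  have lhs: "(\<lambda>n. 2 * kin (\<lambda>b x. gauss (s n) x * G b x + gauss_deriv (s n) x b * u x) + pot (\<lambda>x. gauss (s n) x * u x)) \<longlonglongrightarrow> 2 * kin G + pot u"
    by (intro tendsto_intros kin_lim pot_lim)
  have "2 * kin (\<lambda>b x. gauss (s n) x * G b x + gauss_deriv (s n) x b * u x) + pot (\<lambda>x. gauss (s n) x * u x)
    \<le> 2 * (sqrt (sqnorm lebesgue (\<lambda>x. complex_of_real (inverse (s n)) * commutator_term (s n) u G x)) * ?c)" for n
  proof -
    have "sqrt (sqnorm lebesgue (\<lambda>x. complex_of_real (inverse (s n)) * commutator_term (s n) u G x)) = inverse (s n) * sqrt (sqnorm lebesgue (commutator_term (s n) u G))"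
      unfolding sqnorm_cmult real_sqrt_mult norm_of_real using s(1)[of n] by simp
    then have "2 * (sqrt (sqnorm lebesgue (\<lambda>x. complex_of_real (inverse (s n)) * commutator_term (s n) u G x)) * ?c) =
      2 * (sqrt (sqnorm lebesgue (commutator_term (s n) u G)) * ((DIM('a) / 2 + 2) / s n * sqrt (sqnorm lebesgue ?S)))"
      by (simp only: divide_inverse mult_ac)
    then show ?thesis using truncated_virial[OF u sol s, of n] E by simp
  qed
  then have virial: "2 * kin G + pot u \<le> 0" by (intro LIMSEQ_le[OF lhs rhs]) auto
  have "complex_of_real (kin G + pot u) = complex_of_real (E * sqnorm lebesgue u)"
    unfolding form_diag[OF u, symmetric] sol[OF u] of_real_mult complex_of_real_sqnorm ..
  then have en: "kin G + pot u = E * sqnorm lebesgue u" by (simp only: of_real_eq_iff)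
  have "kin G \<ge> 0" unfolding kin_def using weight_nonneg by (intro sum_nonneg) auto
  then have "E * sqnorm lebesgue u \<le> 0" using virial en by linarith
  then have "sqnorm lebesgue u = 0" using E sqnorm_nonneg[of lebesgue u] by (simp add: mult_le_0_iff)
  then show ?thesis using sqnorm_eq_0_iff[OF su] by simp
qed

end

section \<open>The Coulomb potential\<close>

text \<open>The field y / sqrt (|y|^2 + \<delta>) in the relative coordinate has length at most 1
  and, for d >= 2, divergence at least 1 / sqrt (|y|^2 + \<delta>). Integrating the divergence
  against |u|^2 by parts bounds the weighted integral by twice that of |u| |grad u|, and Young's
  inequality with parameter \<eta> splits the product. The regularization makes the field smooth
  with bounded derivative, and the final bound does not depend on \<delta>.\<close>

lemma singular_weight_bound:
  fixes u :: "'a::euclidean_space \<times> 'a \<Rightarrow> complex"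
  assumes u: "h10_pair \<Omega> u G" and d: "DIM('a) \<ge> 2" and \<eta>: "\<eta> > 0" and \<delta>: "\<delta> > 0"
  shows "integrable lebesgue (\<lambda>x. (cmod (u x))\<^sup>2 / sqrt ((fst x - snd x) \<bullet> (fst x - snd x) + \<delta>))"
    and "(LINT x|lebesgue. (cmod (u x))\<^sup>2 / sqrt ((fst x - snd x) \<bullet> (fst x - snd x) + \<delta>)) \<le>
      (1 / \<eta>) * sqnorm lebesgue u + \<eta> * (\<Sum>e\<in>Basis. sqnorm lebesgue (G (e, 0)))"
proof -
  define y where "y x = fst x - snd x" for x :: "'a \<times> 'a"
  define n where "n x = sqrt (y x \<bullet> y x + \<delta>)" for x
  \<comment> \<open>\<open>c e\<close> is the e-component of the regularized unit field and
    \<open>c' e x\<close> its differential on the product space. Differentiating in the directions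
    (e, 0) means moving the first particle only.\<close>
  define c where "c e x = (y x \<bullet> e) * inverse (n x)" for e x
  define c' where "c' e x v = ((fst v - snd v) \<bullet> e) / n x - (y x \<bullet> e) * (y x \<bullet> (fst v - snd v)) / (n x) ^ 3" for e x and v :: "'a \<times> 'a"
  have n0: "n x > 0" for x using \<delta> inner_ge_zero[of "y x"] by (simp add: n_def add_nonneg_pos)
  have nsq: "(n x)\<^sup>2 = y x \<bullet> y x + \<delta>" for x using \<delta> inner_ge_zero[of "y x"] by (simp add: n_def)
  have n\<delta>: "sqrt \<delta> \<le> n x" for x unfolding n_def by simp
  have dy: "(y has_derivative (\<lambda>v. fst v - snd v)) (at x)" for x
    unfolding y_def[abs_def] by (auto intro!: derivative_eq_intros)
  have cy: "continuous_on UNIV y" unfolding y_def[abs_def] by (intro continuous_intros)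
  have cn: "continuous_on UNIV n" unfolding n_def[abs_def] by (intro continuous_intros cy)
  have dn: "(n has_derivative (\<lambda>v. (y x \<bullet> (fst v - snd v)) / n x)) (at x)" for x
  proof -
    have "y x \<bullet> y x + \<delta> > 0" using \<delta> inner_ge_zero[of "y x"] by linarith
    then have 1: "(n has_derivative (\<lambda>v. (y x \<bullet> (fst v - snd v) + (fst v - snd v) \<bullet> y x) * (inverse (sqrt (y x \<bullet> y x + \<delta>)) / 2))) (at x)"
      unfolding n_def[abs_def] by (auto intro!: derivative_eq_intros dy)
    have "(y x \<bullet> w + w \<bullet> y x) * (inverse (sqrt (y x \<bullet> y x + \<delta>)) / 2) = (y x \<bullet> w) / n x" for w
      unfolding inner_commute[of w "y x"] n_def[symmetric] by (simp add: inverse_eq_divide)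
    with 1 show ?thesis by simp
  qed
  have dc: "(c e has_derivative c' e x) (at x)" for e x
  proof -
    have 1: "((\<lambda>x. (y x \<bullet> e) * inverse (n x)) has_derivative
      (\<lambda>v. (y x \<bullet> e) * (- (inverse (n x) * ((y x \<bullet> (fst v - snd v)) / n x) * inverse (n x))) + ((fst v - snd v) \<bullet> e) * inverse (n x))) (at x)"
    proof (rule has_derivative_mult)
      show "((\<lambda>x. y x \<bullet> e) has_derivative (\<lambda>v. (fst v - snd v) \<bullet> e)) (at x)"
        by (rule has_derivative_inner_left[OF dy])
      show "((\<lambda>x. inverse (n x)) has_derivative (\<lambda>v. - (inverse (n x) * ((y x \<bullet> (fst v - snd v)) / n x) * inverse (n x)))) (at x)"
        by (rule Deriv.has_derivative_inverse[OF _ dn]) (use n0[of x] in simp)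
    qed
    have "(y x \<bullet> e) * (- (inverse (n x) * ((y x \<bullet> w) / n x) * inverse (n x))) + (w \<bullet> e) * inverse (n x) =
      (w \<bullet> e) / n x - (y x \<bullet> e) * (y x \<bullet> w) / (n x) ^ 3" for w
      using n0[of x] by (simp add: divide_inverse power3_eq_cube algebra_simps)
    with 1 show ?thesis by (simp only: c_def[abs_def] c'_def[abs_def])
  qed
  have cc': "continuous_on UNIV (\<lambda>x. c' e x v)" for e v
    unfolding c'_def using n0 by (intro continuous_intros cy cn) (auto simp: less_imp_neq[THEN not_sym])
  have c'e: "c' e x (e, 0) = 1 / n x - (y x \<bullet> e)\<^sup>2 / (n x) ^ 3" if "e \<in> Basis" for e x
    using that by (simp add: c'_def power2_eq_square)
  have yb: "(y x \<bullet> e)\<^sup>2 \<le> (n x)\<^sup>2" if "e \<in> Basis" for e x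
  proof -
    have "\<bar>y x \<bullet> e\<bar> \<le> norm (y x)" using Basis_le_norm[OF that] .
    then have "(y x \<bullet> e)\<^sup>2 \<le> y x \<bullet> y x" using power_mono[of "\<bar>y x \<bullet> e\<bar>" "norm (y x)" 2] by (simp add: power2_norm_eq_inner)
    then show ?thesis using \<delta> by (simp add: nsq)
  qed
  have cb: "\<bar>c e x\<bar> \<le> 1" if "e \<in> Basis" for e x
  proof -
    have "(c e x)\<^sup>2 \<le> 1" using yb[OF that, of x] n0[of x] by (simp add: c_def power_mult_distrib power_inverse field_simps)
    then show ?thesis by (simp add: abs_square_le_1)
  qed
  have c'b: "0 \<le> c' e x (e, 0)" "c' e x (e, 0) \<le> 1 / sqrt \<delta>" if e: "e \<in> Basis" for e x
  proof -
    have "(y x \<bullet> e)\<^sup>2 / (n x) ^ 3 \<le> (n x)\<^sup>2 / (n x) ^ 3" using yb[OF e, of x] n0[of x] by (intro divide_right_mono) auto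
    also have "\<dots> = 1 / n x" using n0[of x] by (simp add: power2_eq_square power3_eq_cube)
    finally show "0 \<le> c' e x (e, 0)" by (simp add: c'e[OF e])
    have "0 \<le> (y x \<bullet> e)\<^sup>2 / (n x) ^ 3" using n0[of x] by simp
    then have "c' e x (e, 0) \<le> 1 / n x" by (simp add: c'e[OF e])
    also have "\<dots> \<le> 1 / sqrt \<delta>" using n\<delta>[of x] \<delta> by (intro divide_left_mono) (auto simp: n0)
    finally show "c' e x (e, 0) \<le> 1 / sqrt \<delta>" .
  qed
  have su: "square_integrable lebesgue u" and sG: "\<And>b. b \<in> Basis \<Longrightarrow> square_integrable lebesgue (G b)"
    using h10_pair_square_integrable[OF u] by auto
  have Bp: "(e, 0) \<in> (Basis :: ('a \<times> 'a) set)" if "e \<in> Basis" for e using that by (auto simp: Basis_prod_def)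
  have u2: "integrable lebesgue (\<lambda>x. (cmod (u x))\<^sup>2)" using su by (simp add: square_integrable_def)
  have G2: "integrable lebesgue (\<lambda>x. (cmod (G (e, 0) x))\<^sup>2)" if "e \<in> Basis" for e using sG[OF Bp[OF that]] by (simp add: square_integrable_def)
  have mc: "(\<lambda>x. c e x) \<in> borel_measurable lebesgue" "(\<lambda>x. c' e x v) \<in> borel_measurable lebesgue" "n \<in> borel_measurable lebesgue" for e v
  proof -
    have "continuous_on UNIV (c e)" by (intro continuous_at_imp_continuous_on ballI has_derivative_continuous[OF dc])
    moreover have "f \<in> borel_measurable lebesgue" if "continuous_on UNIV f" for f :: "'a \<times> 'a \<Rightarrow> real"
      using borel_measurable_continuous_onI[OF that] by (intro measurable_completion) simp
    ultimately show "(\<lambda>x. c e x) \<in> borel_measurable lebesgue" "(\<lambda>x. c' e x v) \<in> borel_measurable lebesgue" "n \<in> borel_measurable lebesgue"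
      using cc'[of e v] cn by blast+
  qed
  have ic': "integrable lebesgue (\<lambda>x. c' e x (e, 0) * (cmod (u x))\<^sup>2)" if e: "e \<in> Basis" for e
  proof (rule Bochner_Integration.integrable_bound)
    show "integrable lebesgue (\<lambda>x. (1 / sqrt \<delta>) * (cmod (u x))\<^sup>2)" using u2 by (rule integrable_mult_right)
    show "(\<lambda>x. c' e x (e, 0) * (cmod (u x))\<^sup>2) \<in> borel_measurable lebesgue"
      by (intro borel_measurable_times mc borel_measurable_integrable[OF u2])
    show "AE x in lebesgue. norm (c' e x (e, 0) * (cmod (u x))\<^sup>2) \<le> norm ((1 / sqrt \<delta>) * (cmod (u x))\<^sup>2)"
    proof (rule AE_I2)
      fix x
      have "\<bar>c' e x (e, 0)\<bar> * (cmod (u x))\<^sup>2 \<le> \<bar>1 / sqrt \<delta>\<bar> * (cmod (u x))\<^sup>2"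
      proof (rule mult_right_mono)
        have "0 \<le> 1 / sqrt \<delta>" using \<delta> by simp
        then show "\<bar>c' e x (e, 0)\<bar> \<le> \<bar>1 / sqrt \<delta>\<bar>" using c'b[OF e, of x] by linarith
      qed simp
      then show "norm (c' e x (e, 0) * (cmod (u x))\<^sup>2) \<le> norm ((1 / sqrt \<delta>) * (cmod (u x))\<^sup>2)"
        by (simp add: abs_mult)
    qed
  qed
  have ibp: "(LINT x|lebesgue. c' e x (e, 0) * (cmod (u x))\<^sup>2) \<le>
     (LINT x|lebesgue. (c e x)\<^sup>2 * (cmod (u x))\<^sup>2 / \<eta> + \<eta> * (cmod (G (e, 0) x))\<^sup>2)" if e: "e \<in> Basis" for e
  proof -
    let ?c = "\<lambda>x. complex_of_real (c e x)" and ?c' = "\<lambda>x v. complex_of_real (c' e x v)" and ?G = "G (e, 0)"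
    have dcc: "(?c has_derivative ?c' x) (at x)" for x
      by (rule bounded_linear.has_derivative[OF bounded_linear_of_real dc])
    have sc: "square_integrable lebesgue (\<lambda>x. ?c x * u x)" "square_integrable lebesgue (\<lambda>x. ?c x * ?G x)"
      using cb[OF e] mc(1) by (auto intro!: square_integrable_mult_bounded(1)[where B = 1] su sG[OF Bp[OF e]])
    have sc': "square_integrable lebesgue (\<lambda>x. ?c' x (e, 0) * u x)"
      using c'b[OF e] mc(2) by (auto intro!: square_integrable_mult_bounded(1)[where B = "1 / sqrt \<delta>"] su)
    have I: "(LINT x|lebesgue. ?c x * u x * cnj (?G x)) = - (LINT x|lebesgue. (?c x * ?G x + ?c' x (e, 0) * u x) * cnj (u x))"
    \<comment> \<open>A single constant has to bound both the coefficient, by 1, and its derivative,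
      by 1 / sqrt \<delta>; hence the sum.\<close>
    proof (rule h10_pair_integration_by_parts[OF u u Bp[OF e] dcc, where B = "1 + 1 / sqrt \<delta>"])
      show "continuous_on UNIV (\<lambda>x. ?c' x (e, 0))" by (intro continuous_intros cc')
      show "cmod (?c x) \<le> 1 + 1 / sqrt \<delta>" for x using cb[OF e, of x] \<delta> by (simp add: add_increasing2)
      show "cmod (?c' x (e, 0)) \<le> 1 + 1 / sqrt \<delta>" for x using c'b[OF e, of x] \<delta> by simp
    qed
    have i1: "integrable lebesgue (\<lambda>x. ?c x * ?G x * cnj (u x))" and i2: "integrable lebesgue (\<lambda>x. ?c' x (e, 0) * u x * cnj (u x))"
      and i3: "integrable lebesgue (\<lambda>x. ?c x * u x * cnj (?G x))"
      by (intro square_integrable_mult_integrable(2) sc sc' su sG[OF Bp[OF e]])+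
    have "(LINT x|lebesgue. ?c' x (e, 0) * u x * cnj (u x)) = - ((LINT x|lebesgue. ?c x * u x * cnj (?G x)) + (LINT x|lebesgue. ?c x * ?G x * cnj (u x)))"
      unfolding I distrib_right Bochner_Integration.integral_add[OF i1 i2] by simp
    also have "\<dots> = (LINT x|lebesgue. - (?c x * u x * cnj (?G x) + ?c x * ?G x * cnj (u x)))"
      using i1 i3 by simp
    also have "\<dots> = (LINT x|lebesgue. complex_of_real (- 2 * c e x * Re (?G x * cnj (u x))))"
      by (intro Bochner_Integration.integral_cong refl) (simp add: complex_eq_iff algebra_simps)
    also have "\<dots> = complex_of_real (LINT x|lebesgue. - 2 * c e x * Re (?G x * cnj (u x)))" by (rule integral_complex_of_real)
    finally have 1: "(LINT x|lebesgue. ?c' x (e, 0) * u x * cnj (u x)) = complex_of_real (LINT x|lebesgue. - 2 * c e x * Re (?G x * cnj (u x)))" .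
    have "(LINT x|lebesgue. ?c' x (e, 0) * u x * cnj (u x)) = (LINT x|lebesgue. complex_of_real (c' e x (e, 0) * (cmod (u x))\<^sup>2))"
      by (intro Bochner_Integration.integral_cong refl) (simp only: mult.assoc complex_norm_square[symmetric] of_real_mult)
    also have "\<dots> = complex_of_real (LINT x|lebesgue. c' e x (e, 0) * (cmod (u x))\<^sup>2)" by (rule integral_complex_of_real)
    finally have 2: "(LINT x|lebesgue. c' e x (e, 0) * (cmod (u x))\<^sup>2) = (LINT x|lebesgue. - 2 * c e x * Re (?G x * cnj (u x)))"
      using 1 by (simp only: of_real_eq_iff)
    show ?thesis unfolding 2
    proof (rule integral_mono)
      have "integrable lebesgue (\<lambda>x. Re (?c x * ?G x * cnj (u x)))" using i1 by (rule integrable_Re)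
      then have "integrable lebesgue (\<lambda>x. (- 2) * Re (?c x * ?G x * cnj (u x)))" by (rule integrable_mult_right)
      also have "(\<lambda>x. (- 2) * Re (?c x * ?G x * cnj (u x))) = (\<lambda>x. - 2 * c e x * Re (?G x * cnj (u x)))"
        by (simp add: fun_eq_iff algebra_simps)
      finally show "integrable lebesgue (\<lambda>x. - 2 * c e x * Re (?G x * cnj (u x)))" .
      have "integrable lebesgue (\<lambda>x. (cmod (?c x * u x))\<^sup>2)" using sc(1) by (simp add: square_integrable_def)
      then have "integrable lebesgue (\<lambda>x. (c e x)\<^sup>2 * (cmod (u x))\<^sup>2)" by (simp add: norm_mult power_mult_distrib)
      then show "integrable lebesgue (\<lambda>x. (c e x)\<^sup>2 * (cmod (u x))\<^sup>2 / \<eta> + \<eta> * (cmod (G (e, 0) x))\<^sup>2)"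
        using G2[OF e] by simp
      fix x
      have "- 2 * c e x * Re (?G x * cnj (u x)) \<le> \<bar>2 * c e x * Re (?G x * cnj (u x))\<bar>" by simp
      also have "\<dots> = 2 * \<bar>c e x\<bar> * \<bar>Re (?G x * cnj (u x))\<bar>" by (simp only: abs_mult abs_numeral)
      also have "\<dots> \<le> 2 * \<bar>c e x\<bar> * cmod (?G x * cnj (u x))" by (intro mult_left_mono abs_Re_le_cmod) simp
      \<comment> \<open>Young's inequality with weight \<eta>: the factor sqrt \<eta> is moved to
        the gradient so that its share can later be made small.\<close>
      also have "\<dots> = 2 * (\<bar>c e x\<bar> * cmod (u x) / sqrt \<eta>) * (sqrt \<eta> * cmod (?G x))"
        using \<eta> by (simp add: norm_mult)
      also have "\<dots> \<le> (\<bar>c e x\<bar> * cmod (u x) / sqrt \<eta>)\<^sup>2 + (sqrt \<eta> * cmod (?G x))\<^sup>2" by (rule sum_squares_bound)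
      also have "\<dots> = (c e x)\<^sup>2 * (cmod (u x))\<^sup>2 / \<eta> + \<eta> * (cmod (?G x))\<^sup>2"
        using \<eta> by (simp add: power_mult_distrib power_divide)
      finally show "- 2 * c e x * Re (?G x * cnj (u x)) \<le> (c e x)\<^sup>2 * (cmod (u x))\<^sup>2 / \<eta> + \<eta> * (cmod (?G x))\<^sup>2" .
    qed
  qed
  have ysum: "(\<Sum>e\<in>Basis. (y x \<bullet> e)\<^sup>2) = y x \<bullet> y x" for x
    by (simp add: euclidean_inner[of "y x" "y x"] power2_eq_square)
  \<comment> \<open>The divergence is d / n - |y|^2 / n^3, and |y| <= n makes it at least (d - 1) /
    n; this is where d >= 2 enters.\<close>
  have div: "1 / n x \<le> (\<Sum>e\<in>Basis. c' e x (e, 0))" for x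
  proof -
    have "(\<Sum>e\<in>Basis. c' e x (e, 0)) = real DIM('a) / n x - (y x \<bullet> y x) / (n x) ^ 3"
      by (simp add: c'e sum_subtractf sum_divide_distrib[symmetric] ysum)
    moreover have "(y x \<bullet> y x) / (n x) ^ 3 \<le> (n x)\<^sup>2 / (n x) ^ 3"
      using n0[of x] \<delta> by (intro divide_right_mono) (auto simp: nsq)
    moreover have "(n x)\<^sup>2 / (n x) ^ 3 = 1 / n x" using n0[of x] by (simp add: power2_eq_square power3_eq_cube)
    moreover have "2 / n x \<le> real DIM('a) / n x" using d n0[of x] by (intro divide_right_mono) auto
    moreover have "2 / n x = 1 / n x + 1 / n x" by simp
    ultimately show ?thesis by linarith
  qed
  have csum: "(\<Sum>e\<in>Basis. (c e x)\<^sup>2) \<le> 1" for x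
  proof -
    have "(\<Sum>e\<in>Basis. (c e x)\<^sup>2) = (y x \<bullet> y x) / (n x)\<^sup>2"
      by (simp add: c_def power_mult_distrib sum_distrib_right[symmetric] ysum divide_inverse power_inverse)
    also have "\<dots> \<le> 1"
      by (subst divide_le_eq_1_pos[OF zero_less_power[OF n0]]) (use \<delta> in \<open>simp add: nsq\<close>)
    finally show ?thesis .
  qed
  have int: "integrable lebesgue (\<lambda>x. (cmod (u x))\<^sup>2 / n x)"
  proof (rule Bochner_Integration.integrable_bound)
    show "integrable lebesgue (\<lambda>x. (1 / sqrt \<delta>) * (cmod (u x))\<^sup>2)" using u2 by (rule integrable_mult_right)
    show "(\<lambda>x. (cmod (u x))\<^sup>2 / n x) \<in> borel_measurable lebesgue"
      by (intro borel_measurable_divide mc borel_measurable_integrable[OF u2])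
    show "AE x in lebesgue. norm ((cmod (u x))\<^sup>2 / n x) \<le> norm ((1 / sqrt \<delta>) * (cmod (u x))\<^sup>2)"
    proof (rule AE_I2)
      fix x
      have "(cmod (u x))\<^sup>2 / n x \<le> (cmod (u x))\<^sup>2 / sqrt \<delta>"
        using n\<delta>[of x] \<delta> n0[of x] by (intro divide_left_mono) auto
      then show "norm ((cmod (u x))\<^sup>2 / n x) \<le> norm ((1 / sqrt \<delta>) * (cmod (u x))\<^sup>2)"
        using n0[of x] \<delta> by simp
    qed
  qed
  then show "integrable lebesgue (\<lambda>x. (cmod (u x))\<^sup>2 / sqrt ((fst x - snd x) \<bullet> (fst x - snd x) + \<delta>))"
    by (simp add: n_def y_def)
  have icu: "integrable lebesgue (\<lambda>x. (c e x)\<^sup>2 * (cmod (u x))\<^sup>2)" if e: "e \<in> Basis" for e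
  proof -
    have "square_integrable lebesgue (\<lambda>x. complex_of_real (c e x) * u x)"
      using cb[OF e] mc(1) by (auto intro!: square_integrable_mult_bounded(1)[where B = 1] su)
    then show ?thesis by (simp add: square_integrable_def norm_mult power_mult_distrib)
  qed
  have "(LINT x|lebesgue. (cmod (u x))\<^sup>2 / n x) \<le> (LINT x|lebesgue. (\<Sum>e\<in>Basis. c' e x (e, 0) * (cmod (u x))\<^sup>2))"
  proof (rule integral_mono[OF int])
    show "integrable lebesgue (\<lambda>x. \<Sum>e\<in>Basis. c' e x (e, 0) * (cmod (u x))\<^sup>2)" by (intro Bochner_Integration.integrable_sum ic')
    show "(cmod (u x))\<^sup>2 / n x \<le> (\<Sum>e\<in>Basis. c' e x (e, 0) * (cmod (u x))\<^sup>2)" for x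
      using mult_right_mono[OF div[of x], of "(cmod (u x))\<^sup>2"] by (simp add: sum_distrib_right)
  qed
  also have "\<dots> = (\<Sum>e\<in>Basis. (LINT x|lebesgue. c' e x (e, 0) * (cmod (u x))\<^sup>2))"
    by (rule Bochner_Integration.integral_sum) (rule ic')
  also have "\<dots> \<le> (\<Sum>e\<in>Basis. (LINT x|lebesgue. (c e x)\<^sup>2 * (cmod (u x))\<^sup>2 / \<eta> + \<eta> * (cmod (G (e, 0) x))\<^sup>2))"
    by (intro sum_mono ibp)
  also have "\<dots> = (\<Sum>e\<in>Basis. (LINT x|lebesgue. (c e x)\<^sup>2 * (cmod (u x))\<^sup>2) / \<eta> + \<eta> * sqnorm lebesgue (G (e, 0)))"
    using icu G2 by (intro sum.cong refl) (simp add: sqnorm_def)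
  also have "\<dots> = (\<Sum>e\<in>Basis. (LINT x|lebesgue. (c e x)\<^sup>2 * (cmod (u x))\<^sup>2)) / \<eta> + \<eta> * (\<Sum>e\<in>Basis. sqnorm lebesgue (G (e, 0)))"
    by (simp add: sum.distrib sum_divide_distrib sum_distrib_left)
  \<comment> \<open>The sum goes back under the integral to use that the whole field has length at
    most 1; bounding each component separately would cost a factor d.\<close>
  also have "(\<Sum>e\<in>Basis. (LINT x|lebesgue. (c e x)\<^sup>2 * (cmod (u x))\<^sup>2)) = (LINT x|lebesgue. (\<Sum>e\<in>Basis. (c e x)\<^sup>2 * (cmod (u x))\<^sup>2))"
    by (rule Bochner_Integration.integral_sum[symmetric]) (rule icu)
  also have "\<dots> \<le> sqnorm lebesgue u" unfolding sqnorm_def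
  proof (rule integral_mono[OF _ u2])
    show "integrable lebesgue (\<lambda>x. \<Sum>e\<in>Basis. (c e x)\<^sup>2 * (cmod (u x))\<^sup>2)" by (intro Bochner_Integration.integrable_sum icu)
    show "(\<Sum>e\<in>Basis. (c e x)\<^sup>2 * (cmod (u x))\<^sup>2) \<le> (cmod (u x))\<^sup>2" for x
      using mult_right_mono[OF csum[of x], of "(cmod (u x))\<^sup>2"] by (simp add: sum_distrib_right)
  qed
  finally have "(LINT x|lebesgue. (cmod (u x))\<^sup>2 / n x) \<le> sqnorm lebesgue u / \<eta> + \<eta> * (\<Sum>e\<in>Basis. sqnorm lebesgue (G (e, 0)))"
    using \<eta> by (simp add: divide_right_mono)
  then show "(LINT x|lebesgue. (cmod (u x))\<^sup>2 / sqrt ((fst x - snd x) \<bullet> (fst x - snd x) + \<delta>)) \<le>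
      (1 / \<eta>) * sqnorm lebesgue u + \<eta> * (\<Sum>e\<in>Basis. sqnorm lebesgue (G (e, 0)))"
    by (simp add: n_def y_def)
qed

text \<open>Fatou's lemma for \<open>\<delta> \<rightarrow> 0\<close>. On the diagonal the left integrand is the junk value
  \<open>x / 0 = 0\<close>, so no null set has to be removed.\<close>

lemma coulomb_weight_bound:
  fixes u :: "'a::euclidean_space \<times> 'a \<Rightarrow> complex"
  assumes u: "h10_pair \<Omega> u G" and d: "DIM('a) \<ge> 2" and \<eta>: "\<eta> > 0"
  shows "integrable lebesgue (\<lambda>x. (cmod (u x))\<^sup>2 / norm (fst x - snd x))"
    and "(LINT x|lebesgue. (cmod (u x))\<^sup>2 / norm (fst x - snd x)) \<le>
      (1 / \<eta>) * sqnorm lebesgue u + \<eta> * (\<Sum>e\<in>Basis. sqnorm lebesgue (G (e, 0)))"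
proof -
  let ?B = "(1 / \<eta>) * sqnorm lebesgue u + \<eta> * (\<Sum>e\<in>Basis. sqnorm lebesgue (G (e, 0)))"
  define y where "y x = fst x - snd x" for x :: "'a \<times> 'a"
  define \<delta> where "\<delta> k = inverse (real (Suc k))" for k
  have \<delta>: "\<delta> k > 0" for k by (simp add: \<delta>_def)
  have \<delta>0: "\<delta> \<longlonglongrightarrow> 0" unfolding \<delta>_def[abs_def] by (rule LIMSEQ_inverse_real_of_nat)
  have B0: "?B \<ge> 0" using \<eta> by (intro add_nonneg_nonneg mult_nonneg_nonneg sum_nonneg) auto
  define f where "f k x = (cmod (u x))\<^sup>2 / sqrt (y x \<bullet> y x + \<delta> k)" for k x
  have fi: "integrable lebesgue (f k)" and fB: "(LINT x|lebesgue. f k x) \<le> ?B" for k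
    using singular_weight_bound[OF u d \<eta> \<delta>[of k]] by (auto simp: f_def[abs_def] y_def)
  have f0: "f k x \<ge> 0" for k x using \<delta>[of k] by (auto simp: f_def intro!: divide_nonneg_nonneg)
  have my: "y \<in> borel_measurable lebesgue"
    by (intro measurable_completion) (auto simp: y_def[abs_def] intro!: borel_measurable_continuous_onI continuous_intros)
  have m: "(\<lambda>x. (cmod (u x))\<^sup>2 / norm (y x)) \<in> borel_measurable lebesgue"
    using my square_integrable_measurable[OF h10_pair_square_integrable(1)[OF u]] by measurable
  have "(\<integral>\<^sup>+x. ennreal ((cmod (u x))\<^sup>2 / norm (y x)) \<partial>lebesgue) \<le> (\<integral>\<^sup>+x. liminf (\<lambda>k. ennreal (f k x)) \<partial>lebesgue)"
  proof (rule nn_integral_mono)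
    fix x
    show "ennreal ((cmod (u x))\<^sup>2 / norm (y x)) \<le> liminf (\<lambda>k. ennreal (f k x))"
    proof (cases "y x = 0")
      case True then show ?thesis by simp
    next
      case False
      have "(\<lambda>k. f k x) \<longlonglongrightarrow> (cmod (u x))\<^sup>2 / sqrt (y x \<bullet> y x + 0)"
        unfolding f_def using False by (intro tendsto_intros \<delta>0) auto
      then have "(\<lambda>k. ennreal (f k x)) \<longlonglongrightarrow> ennreal ((cmod (u x))\<^sup>2 / norm (y x))"
        by (intro tendsto_ennrealI) (simp add: norm_eq_sqrt_inner)
      from lim_imp_Liminf[OF _ this] show ?thesis by simp
    qed
  qed
  also have "\<dots> \<le> liminf (\<lambda>k. \<integral>\<^sup>+x. ennreal (f k x) \<partial>lebesgue)"
    by (rule nn_integral_liminf) (use fi in \<open>auto dest: borel_measurable_integrable\<close>)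
  also have "\<dots> \<le> limsup (\<lambda>k. \<integral>\<^sup>+x. ennreal (f k x) \<partial>lebesgue)" by (rule Liminf_le_Limsup) simp
  also have "\<dots> \<le> ennreal ?B"
  proof (rule Limsup_bounded, rule always_eventually, rule allI)
    fix k
    have "(\<integral>\<^sup>+x. ennreal (f k x) \<partial>lebesgue) = ennreal (LINT x|lebesgue. f k x)"
      by (rule nn_integral_eq_integral[OF fi]) (simp add: f0)
    then show "(\<integral>\<^sup>+x. ennreal (f k x) \<partial>lebesgue) \<le> ennreal ?B" using fB[of k] by (simp add: ennreal_leI)
  qed
  finally have le: "(\<integral>\<^sup>+x. ennreal ((cmod (u x))\<^sup>2 / norm (y x)) \<partial>lebesgue) \<le> ennreal ?B" .
  have int: "integrable lebesgue (\<lambda>x. (cmod (u x))\<^sup>2 / norm (y x))"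
    by (rule integrableI_nonneg[OF m _ le_less_trans[OF le]]) auto
  then show "integrable lebesgue (\<lambda>x. (cmod (u x))\<^sup>2 / norm (fst x - snd x))" by (simp add: y_def)
  have "ennreal (LINT x|lebesgue. (cmod (u x))\<^sup>2 / norm (y x)) \<le> ennreal ?B"
    using le nn_integral_eq_integral[OF int] by simp
  then show "(LINT x|lebesgue. (cmod (u x))\<^sup>2 / norm (fst x - snd x)) \<le> ?B"
    using B0 by (simp add: y_def)
qed

section \<open>The Coulomb Hamiltonian as a homogeneous form\<close>

lemma sum_Basis_Times:
  fixes f :: "'a::euclidean_space \<times> 'b::euclidean_space \<Rightarrow> 'c::comm_monoid_add"
  shows "sum f Basis = (\<Sum>e\<in>Basis. f (e, 0)) + (\<Sum>e\<in>Basis. f (0, e))"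
proof -
  have "inj_on (\<lambda>e. (e::'a, 0::'b)) Basis" "inj_on (\<lambda>e. (0::'a, e::'b)) Basis" by (auto intro!: inj_onI)
  moreover have "(\<lambda>e. (e::'a, 0::'b)) ` Basis \<inter> (\<lambda>e. (0::'a, e::'b)) ` Basis = {}" by (auto simp: nonzero_Basis)
  ultimately show ?thesis unfolding Basis_prod_def by (simp add: sum.union_disjoint sum.reindex)
qed

text \<open>On the domain the terms with the fixed charge are bounded because |x| >= r there. The
  interaction, whatever its sign, is absorbed by the kinetic energy of the first particle through
  the weighted Coulomb bound.\<close>

lemma coulomb_homogeneous_form:
  fixes \<Omega>\<^sub>1 :: "'a::euclidean_space set" and m\<^sub>1 m\<^sub>2 q\<^sub>1 q\<^sub>2 qncl r :: real
  defines "a b \<equiv> if snd b = 0 then 1 / (2 * m\<^sub>1) else 1 / (2 * m\<^sub>2)"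
  assumes d: "DIM('a) \<ge> 2" and op: "open \<Omega>\<^sub>1" and m: "m\<^sub>1 > 0" "m\<^sub>2 > 0"
    and dilation: "\<And>x l. x \<in> \<Omega>\<^sub>1 \<Longrightarrow> l \<ge> 1 \<Longrightarrow> l *\<^sub>R x \<in> \<Omega>\<^sub>1"
    and r: "r > 0" "\<And>x. x \<in> \<Omega>\<^sub>1 \<Longrightarrow> r \<le> norm x"
  shows "\<exists>C. homogeneous_form (\<Omega>\<^sub>1 \<times> \<Omega>\<^sub>1) a (coulomb_potential q\<^sub>1 q\<^sub>2 qncl :: 'a \<times> 'a \<Rightarrow> real) C"
proof -
  let ?\<Omega> = "\<Omega>\<^sub>1 \<times> \<Omega>\<^sub>1" and ?V = "coulomb_potential q\<^sub>1 q\<^sub>2 qncl :: 'a \<times> 'a \<Rightarrow> real"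
  define C0 where "C0 = (\<bar>q\<^sub>1 * qncl\<bar> + \<bar>q\<^sub>2 * qncl\<bar>) / r"
  define k where "k = \<bar>q\<^sub>1 * q\<^sub>2\<bar>"
  \<comment> \<open>Chosen so that k \<eta> is at most the kinetic weight 1 / (2 m1); the summand 1
    keeps the quotient defined when the interaction vanishes.\<close>
  define \<eta> where "\<eta> = (1 / (2 * m\<^sub>1)) / (k + 1)"
  define C where "C = C0 + k / \<eta>"
  have C0: "C0 \<ge> 0" and k: "k \<ge> 0" using r by (auto simp: C0_def k_def)
  have \<eta>: "\<eta> > 0" using m k by (simp add: \<eta>_def)
  have k\<eta>: "k * \<eta> \<le> 1 / (2 * m\<^sub>1)"
  proof -
    have "k * \<eta> = (1 / (2 * m\<^sub>1)) * (k / (k + 1))" by (simp add: \<eta>_def)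
    also have "\<dots> \<le> (1 / (2 * m\<^sub>1)) * 1" using k m by (intro mult_left_mono) auto
    finally show ?thesis by simp
  qed
  have op2: "open ?\<Omega>" by (intro open_Times op)
  have V_bound: "\<bar>?V x\<bar> \<le> C0 + k / norm (fst x - snd x)" if "x \<in> ?\<Omega>" for x
  proof -
    have q: "\<bar>q / norm z\<bar> \<le> \<bar>q\<bar> / r" if "z \<in> \<Omega>\<^sub>1" for q and z :: 'a
      using r(1) r(2)[OF that] by (simp add: abs_divide frac_le)
    have "\<bar>?V x\<bar> \<le> \<bar>q\<^sub>1 * qncl / norm (fst x)\<bar> + \<bar>q\<^sub>2 * qncl / norm (snd x)\<bar> + \<bar>q\<^sub>1 * q\<^sub>2 / norm (fst x - snd x)\<bar>"
      unfolding coulomb_potential_def by linarith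
    also have "\<dots> \<le> \<bar>q\<^sub>1 * qncl\<bar> / r + \<bar>q\<^sub>2 * qncl\<bar> / r + k / norm (fst x - snd x)"
      using that by (intro add_mono q) (auto simp: k_def abs_divide)
    finally show ?thesis by (simp add: C0_def add_divide_distrib)
  qed
  have mV: "?V \<in> borel_measurable lebesgue"
  proof -
    have "(\<lambda>x::'a \<times> 'a. norm (fst x)) \<in> borel_measurable borel" "(\<lambda>x::'a \<times> 'a. norm (snd x)) \<in> borel_measurable borel"
      "(\<lambda>x::'a \<times> 'a. norm (fst x - snd x)) \<in> borel_measurable borel"
      by (intro borel_measurable_continuous_onI continuous_intros)+
    then have "?V \<in> borel_measurable borel" unfolding coulomb_potential_def[abs_def]
      by (intro borel_measurable_add borel_measurable_divide borel_measurable_const)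
    then show ?thesis by (intro measurable_completion) simp
  qed
  \<comment> \<open>The pointwise bound on the potential holds on the domain only; elsewhere u
    vanishes almost everywhere, so the estimate of the product is global.\<close>
  have dom: "AE x in lebesgue. \<bar>?V x * (cmod (u x))\<^sup>2\<bar> \<le> C0 * (cmod (u x))\<^sup>2 + k * ((cmod (u x))\<^sup>2 / norm (fst x - snd x))"
    if u: "h10_pair ?\<Omega> u G" for u G
    using h10_pair_AE(1)[OF op2 u]
  proof eventually_elim
    case (elim x)
    show ?case
    proof (cases "x \<in> ?\<Omega>")
      case True
      from mult_right_mono[OF V_bound[OF this], of "(cmod (u x))\<^sup>2"]
      show ?thesis by (simp add: abs_mult algebra_simps)
    next
      case False
      then have "u x = 0" using elim by (simp add: zero_extend_def)
      then show ?thesis by simp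
    qed
  qed
  have i1: "integrable lebesgue (\<lambda>x. C0 * (cmod (u x))\<^sup>2 + k * ((cmod (u x))\<^sup>2 / norm (fst x - snd x)))"
    if u: "h10_pair ?\<Omega> u G" for u G
    using h10_pair_square_integrable(1)[OF u] coulomb_weight_bound(1)[OF u d \<eta>]
    by (intro Bochner_Integration.integrable_add integrable_mult_right) (auto simp: square_integrable_def)
  have i2: "integrable lebesgue (\<lambda>x. ?V x * (cmod (u x))\<^sup>2)" if u: "h10_pair ?\<Omega> u G" for u G
  proof (rule Bochner_Integration.integrable_bound[OF i1[OF u]])
    show "(\<lambda>x. ?V x * (cmod (u x))\<^sup>2) \<in> borel_measurable lebesgue"
      using mV square_integrable_measurable[OF h10_pair_square_integrable(1)[OF u]] by measurable
    show "AE x in lebesgue. norm (?V x * (cmod (u x))\<^sup>2) \<le> norm (C0 * (cmod (u x))\<^sup>2 + k * ((cmod (u x))\<^sup>2 / norm (fst x - snd x)))"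
      using dom[OF u] by eventually_elim simp
  qed
  have low: "- C * sqnorm lebesgue u \<le> (\<Sum>b\<in>Basis. a b * sqnorm lebesgue (G b)) + (LINT x|lebesgue. ?V x * (cmod (u x))\<^sup>2)"
    if u: "h10_pair ?\<Omega> u G" for u G
  proof -
    let ?S = "\<Sum>e\<in>Basis. sqnorm lebesgue (G (e, 0))"
    have "- (LINT x|lebesgue. ?V x * (cmod (u x))\<^sup>2) = (LINT x|lebesgue. - (?V x * (cmod (u x))\<^sup>2))" by simp
    also have "\<dots> \<le> (LINT x|lebesgue. C0 * (cmod (u x))\<^sup>2 + k * ((cmod (u x))\<^sup>2 / norm (fst x - snd x)))"
    proof (rule integral_mono_AE[OF _ i1[OF u]])
      show "integrable lebesgue (\<lambda>x. - (?V x * (cmod (u x))\<^sup>2))" using i2[OF u] by simp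
      show "AE x in lebesgue. - (?V x * (cmod (u x))\<^sup>2) \<le> C0 * (cmod (u x))\<^sup>2 + k * ((cmod (u x))\<^sup>2 / norm (fst x - snd x))"
        using dom[OF u] by eventually_elim linarith
    qed
    also have "\<dots> = C0 * sqnorm lebesgue u + k * (LINT x|lebesgue. (cmod (u x))\<^sup>2 / norm (fst x - snd x))"
      using h10_pair_square_integrable(1)[OF u] coulomb_weight_bound(1)[OF u d \<eta>]
      unfolding sqnorm_def square_integrable_def
      by (subst Bochner_Integration.integral_add) (auto simp del: times_divide_eq_right)
    also have "\<dots> \<le> C0 * sqnorm lebesgue u + k * ((1 / \<eta>) * sqnorm lebesgue u + \<eta> * ?S)"
      using coulomb_weight_bound(2)[OF u d \<eta>] k by (intro add_left_mono mult_left_mono) auto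
    also have "\<dots> = C * sqnorm lebesgue u + (k * \<eta>) * ?S" by (simp add: C_def algebra_simps)
    also have "\<dots> \<le> C * sqnorm lebesgue u + (1 / (2 * m\<^sub>1)) * ?S"
      using k\<eta> by (intro add_left_mono mult_right_mono) (auto intro: sum_nonneg)
    also have "(1 / (2 * m\<^sub>1)) * ?S \<le> (\<Sum>b\<in>Basis. a b * sqnorm lebesgue (G b))"
    proof -
      have "(\<Sum>b\<in>Basis. a b * sqnorm lebesgue (G b)) = (\<Sum>e\<in>Basis. a (e, 0) * sqnorm lebesgue (G (e, 0))) + (\<Sum>e\<in>Basis. a (0, e) * sqnorm lebesgue (G (0, e)))"
        by (rule sum_Basis_Times)
      moreover have "(\<Sum>e\<in>Basis. a (e, 0) * sqnorm lebesgue (G (e, 0))) = (1 / (2 * m\<^sub>1)) * ?S"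
        by (simp add: a_def sum_distrib_left)
      moreover have "0 \<le> (\<Sum>e\<in>Basis. a (0, e) * sqnorm lebesgue (G (0, e)))"
        using m by (intro sum_nonneg) (auto simp: a_def)
      ultimately show ?thesis by linarith
    qed
    finally show ?thesis by simp
  qed
  have "homogeneous_form ?\<Omega> a ?V C"
  proof
    show "l *\<^sub>R x \<in> ?\<Omega>" if "x \<in> ?\<Omega>" "l \<ge> 1" for x l
      using that dilation by (cases x) auto
    show "0 \<le> a b" for b using m by (simp add: a_def)
    show "?V (x /\<^sub>R l) = l * ?V x" if "l > 0" for x l
    proof -
      have "norm (fst (x /\<^sub>R l) - snd (x /\<^sub>R l)) = norm (fst x - snd x) / l"
        using that by (simp add: scaleR_right_diff_distrib[symmetric] divide_inverse_commute)
      moreover have "norm (fst (x /\<^sub>R l)) = norm (fst x) / l" "norm (snd (x /\<^sub>R l)) = norm (snd x) / l"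
        using that by (simp_all add: divide_inverse_commute)
      ultimately show ?thesis using that unfolding coulomb_potential_def by (simp add: algebra_simps)
    qed
    show "C \<ge> 0" using C0 k \<eta> by (simp add: C_def)
  qed (fact mV i2 low)+
  then show ?thesis by blast
qed

text \<open>Only u is extended: in the abstract form the second argument is already a function on
  the whole space, and one vanishing factor suffices to remove the restriction.\<close>

lemma set_integral_zero_extend:
  "(LINT x:\<Omega>|lebesgue. complex_of_real (V x) * u x * cnj (v x)) =
    (LINT x|lebesgue. complex_of_real (V x) * zero_extend \<Omega> u x * cnj (v x))"
  unfolding set_lebesgue_integral_def
  by (intro Bochner_Integration.integral_cong) (auto simp: zero_extend_def indicator_def)

theorem corollary1p7:
  fixes \<Theta>\<^sub>1 \<Omega>\<^sub>1 :: "(real ^ 'n) set"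
    and m\<^sub>1 m\<^sub>2 q\<^sub>1 q\<^sub>2 qncl :: real
  assumes "CARD('n) \<ge> 2"
    and "strictly_convex \<Theta>\<^sub>1" and "0 \<in> \<Theta>\<^sub>1"
    and "\<Omega>\<^sub>1 = UNIV - closure \<Theta>\<^sub>1"
    and "m\<^sub>1 > 0" and "m\<^sub>2 > 0"
  shows "\<not> (\<exists>E::real. E > 0 \<and>
            is_eigenvalue (\<Omega>\<^sub>1 \<times> \<Omega>\<^sub>1)
              (dirichlet_hamiltonian m\<^sub>1 m\<^sub>2 q\<^sub>1 q\<^sub>2 qncl (\<Omega>\<^sub>1 \<times> \<Omega>\<^sub>1))
              (complex_of_real E))"
proof
  assume "\<exists>E::real. E > 0 \<and> is_eigenvalue (\<Omega>\<^sub>1 \<times> \<Omega>\<^sub>1)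
              (dirichlet_hamiltonian m\<^sub>1 m\<^sub>2 q\<^sub>1 q\<^sub>2 qncl (\<Omega>\<^sub>1 \<times> \<Omega>\<^sub>1)) (complex_of_real E)"
  then obtain E u where E: "E > 0"
    and eig: "(u, \<lambda>x. complex_of_real E * u x) \<in> dirichlet_hamiltonian m\<^sub>1 m\<^sub>2 q\<^sub>1 q\<^sub>2 qncl (\<Omega>\<^sub>1 \<times> \<Omega>\<^sub>1)"
    and nz: "\<not> (AE x in lebesgue. x \<in> \<Omega>\<^sub>1 \<times> \<Omega>\<^sub>1 \<longrightarrow> u x = 0)"
    unfolding is_eigenvalue_def by auto
  let ?\<Omega> = "\<Omega>\<^sub>1 \<times> \<Omega>\<^sub>1"
  define a where "a b = (if snd b = 0 then 1 / (2 * m\<^sub>1) else 1 / (2 * m\<^sub>2))" for b :: "(real ^ 'n) \<times> (real ^ 'n)"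
  have op: "open \<Theta>\<^sub>1" using assms(2) by (simp add: strictly_convex_def)
  have op1: "open \<Omega>\<^sub>1" unfolding assms(4) by (intro open_Diff open_UNIV closed_closure)
  then have op2: "open ?\<Omega>" by (intro open_Times)
  have conv: "convex (closure \<Theta>\<^sub>1)" by (intro convex_closure strictly_convex_imp_convex assms(2))
  have z: "0 \<in> closure \<Theta>\<^sub>1" using assms(3) closure_subset by blast
  have dilation: "l *\<^sub>R x \<in> \<Omega>\<^sub>1" if x: "x \<in> \<Omega>\<^sub>1" and l: "l \<ge> 1" for x l
  proof (rule ccontr)
    assume "l *\<^sub>R x \<notin> \<Omega>\<^sub>1"
    then have "l *\<^sub>R x \<in> closure \<Theta>\<^sub>1" by (simp add: assms(4))
    \<comment> \<open>x is the convex combination of l x and 0 with weights 1 / l and 1 - 1 / l, so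
      l x in the closure would put x there too.\<close>
    from convexD[OF conv this z, of "inverse l" "1 - inverse l"] l
    have "x \<in> closure \<Theta>\<^sub>1" by (simp add: inverse_le_1_iff)
    then show False using x by (simp add: assms(4))
  qed
  obtain r where r: "r > 0" "ball 0 r \<subseteq> \<Theta>\<^sub>1" using op assms(3) open_contains_ball by blast
  have far: "r \<le> norm x" if "x \<in> \<Omega>\<^sub>1" for x
  proof (rule ccontr)
    assume "\<not> r \<le> norm x"
    then have "x \<in> ball 0 r" by simp
    then show False using r(2) that closure_subset[of \<Theta>\<^sub>1] by (auto simp: assms(4))
  qed
  obtain C where "homogeneous_form ?\<Omega> a (coulomb_potential q\<^sub>1 q\<^sub>2 qncl :: (real ^ 'n) \<times> (real ^ 'n) \<Rightarrow> real) C"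
    using coulomb_homogeneous_form[OF _ op1 assms(5,6) dilation r(1) far, of q\<^sub>1 q\<^sub>2 qncl] assms(1)
    unfolding a_def[abs_def] by auto
  then interpret homogeneous_form ?\<Omega> a "coulomb_potential q\<^sub>1 q\<^sub>2 qncl :: (real ^ 'n) \<times> (real ^ 'n) \<Rightarrow> real" C .
  define G where "G b = zero_extend ?\<Omega> (weak_partial ?\<Omega> b u)" for b
  have uH: "u \<in> H10 ?\<Omega>"
    and weak: "\<And>v. v \<in> H10 ?\<Omega> \<Longrightarrow> coulomb_form m\<^sub>1 m\<^sub>2 q\<^sub>1 q\<^sub>2 qncl ?\<Omega> u v = L2_inner ?\<Omega> (\<lambda>x. complex_of_real E * u x) v"
    using eig by (auto simp: dirichlet_hamiltonian_def form_operator_def)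
  have pair: "h10_pair ?\<Omega> (zero_extend ?\<Omega> u) G" unfolding G_def[abs_def] by (rule h10_pair_H10[OF op2 uH])
  have "AE x in lebesgue. zero_extend ?\<Omega> u x = 0"
  proof (rule no_positive_eigenvalue[OF pair E])
    fix v H assume v: "h10_pair ?\<Omega> v H"
    \<comment> \<open>The form uses the chosen \<open>weak_partial\<close> of v, the abstract form
      uses \<open>H\<close>; the two agree almost everywhere, so the inner products
      coincide.\<close>
    have ip: "L2_inner ?\<Omega> (weak_partial ?\<Omega> b u) (weak_partial ?\<Omega> b v) = (LINT x|lebesgue. G b x * cnj (H b x))" if b: "b \<in> Basis" for b
      unfolding L2_inner_eq G_def
    proof (rule integral_cong_AE)
      have mG: "zero_extend ?\<Omega> (weak_partial ?\<Omega> b u) \<in> borel_measurable lebesgue"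
        using h10_pair_square_integrable(2)[OF pair b] by (simp add: G_def square_integrable_measurable)
      have mH: "H b \<in> borel_measurable lebesgue" using h10_pair_square_integrable(2)[OF v b] by (rule square_integrable_measurable)
      have mv: "zero_extend ?\<Omega> (weak_partial ?\<Omega> b v) \<in> borel_measurable lebesgue"
        using h10_pair_square_integrable(2)[OF h10_pair_H10[OF op2 H10_h10_pair(1)[OF op2 v]] b] by (rule square_integrable_measurable)
      show "(\<lambda>x. zero_extend ?\<Omega> (weak_partial ?\<Omega> b u) x * cnj (zero_extend ?\<Omega> (weak_partial ?\<Omega> b v) x)) \<in> borel_measurable lebesgue"
        "(\<lambda>x. zero_extend ?\<Omega> (weak_partial ?\<Omega> b u) x * cnj (H b x)) \<in> borel_measurable lebesgue"
        using mG mH mv by measurable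
      show "AE x in lebesgue. zero_extend ?\<Omega> (weak_partial ?\<Omega> b u) x * cnj (zero_extend ?\<Omega> (weak_partial ?\<Omega> b v) x) =
        zero_extend ?\<Omega> (weak_partial ?\<Omega> b u) x * cnj (H b x)"
        using H10_h10_pair(2)[OF op2 v b] by eventually_elim simp
    qed
    have B: "(e, 0) \<in> Basis" "(0, e) \<in> Basis" if "e \<in> Basis" for e :: "real ^ 'n" using that by (auto simp: Basis_prod_def)
    have s1: "complex_of_real (1 / (2 * m\<^sub>1)) * (\<Sum>e\<in>Basis. L2_inner ?\<Omega> (weak_partial ?\<Omega> (e, 0) u) (weak_partial ?\<Omega> (e, 0) v)) =
      (\<Sum>e\<in>Basis. complex_of_real (a (e, 0)) * (LINT x|lebesgue. G (e, 0) x * cnj (H (e, 0) x)))"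
      unfolding sum_distrib_left by (intro sum.cong refl) (simp only: ip B a_def snd_conv if_True simp_thms)
    have s2: "complex_of_real (1 / (2 * m\<^sub>2)) * (\<Sum>e\<in>Basis. L2_inner ?\<Omega> (weak_partial ?\<Omega> (0, e) u) (weak_partial ?\<Omega> (0, e) v)) =
      (\<Sum>e\<in>Basis. complex_of_real (a (0, e)) * (LINT x|lebesgue. G (0, e) x * cnj (H (0, e) x)))"
      unfolding sum_distrib_left
    proof (intro sum.cong refl)
      fix e :: "real ^ 'n" assume e: "e \<in> Basis"
      \<comment> \<open>The weight recognizes directions of the second particle by a nonzero second
        component.\<close>
      then have "e \<noteq> 0" using nonzero_Basis by blast
      then have "a (0, e) = 1 / (2 * m\<^sub>2)" by (simp add: a_def)
      then show "complex_of_real (1 / (2 * m\<^sub>2)) * L2_inner ?\<Omega> (weak_partial ?\<Omega> (0, e) u) (weak_partial ?\<Omega> (0, e) v) =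
        complex_of_real (a (0, e)) * (LINT x|lebesgue. G (0, e) x * cnj (H (0, e) x))"
        by (simp only: ip[OF B(2)[OF e]])
    qed
    have "form (zero_extend ?\<Omega> u) G v H = coulomb_form m\<^sub>1 m\<^sub>2 q\<^sub>1 q\<^sub>2 qncl ?\<Omega> u v"
      unfolding form_def coulomb_form_def s1 s2 set_integral_zero_extend sum_Basis_Times ..
    also have "\<dots> = L2_inner ?\<Omega> (\<lambda>x. complex_of_real E * u x) v" by (rule weak[OF H10_h10_pair(1)[OF op2 v]])
    also have "\<dots> = (LINT x|lebesgue. complex_of_real E * (zero_extend ?\<Omega> u x * cnj (v x)))"
      unfolding L2_inner_eq by (intro Bochner_Integration.integral_cong) (auto simp: zero_extend_def indicator_def)
    also have "\<dots> = complex_of_real E * (LINT x|lebesgue. zero_extend ?\<Omega> u x * cnj (v x))"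
      by (rule Bochner_Integration.integral_mult_right_zero)
    finally show "form (zero_extend ?\<Omega> u) G v H = complex_of_real E * (LINT x|lebesgue. zero_extend ?\<Omega> u x * cnj (v x))" .
  qed
  then have "AE x in lebesgue. x \<in> ?\<Omega> \<longrightarrow> u x = 0" by eventually_elim (auto simp: zero_extend_def)
  then show False using nz by contradiction
qed

end
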